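(* Let $m\ge 2$ be an integer, let $R$ be an $(m+1)$-dimensional Cohen-Macaulay local ring with maximal ideal $\mathfrak{m}$, let $x_1,\dots,x_{m+1}$ be a system of parameters for $R$, and let $\{\alpha_{ij}\}_{1\le i\le m,\,1\le j\le m+1}$ be a family of positive integers. Let $M=(x_{ij})$ be the $m\times(m+1)$ matrix with $$x_{ij}=\begin{cases}x_{i+j-1}^{\alpha_{ij}} & \text{if } i+j\le m+2,\\ x_{i+j-m-2}^{\alpha_{ij}} & \text{if } i+j>m+2,\end{cases}$$ and let $I$ be the ideal of $R$ generated by the $m$-minors of $M$. For $1\le k\le m+1$ let $\beta_k$ be the minimum of the exponents of $x_k$ appearing in the entries of $M$, that is, $$\beta_k=\begin{cases}\min\big(\{\alpha_{i,k-i+1}\}_{1\le i\le k}\cup\{\alpha_{i,k-i+m+2}\}_{k<i\le m}\big) & \text{if } 1\le k<m,\\ \min\{\alpha_{i,k-i+1}\}_{1\le i\le m} & \text{if } k=m \text{ or } k=m+1,\end{cases}$$ and let $Q=(x_1^{\beta_1},x_2^{\beta_2},\dots,x_{m+1}^{\beta_{m+1}})R$. Then $(I^m)^{\mathrm{sat}}=I^m:_R Q$, and $(I^m)^{\mathrm{sat}}/I^m\cong R/Q$ as $R$-modules.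
   Context: For an ideal $J$ of a Noetherian local ring $(R,\mathfrak{m})$, the saturation of $J$ is $(J)^{\mathrm{sat}}=\bigcup_{i>0}(J:_R\mathfrak{m}^i)$. *)

theory Defs
  imports
    "HOL-Library.Set_Algebras"
    "HOL-Library.Extended_Nat"
    "Jordan_Normal_Form.Determinant"
    "Jordan_Normal_Form.DL_Submatrix"
begin

section \<open>Ideals\<close>

text \<open>
  The ring \<open>R\<close> is a type of class \<^class>\<open>comm_ring_1\<close>. Its ideals are its submodules as a module
  over itself, so ideals and generated ideals are \<open>subspace\<close> and \<open>span\<close> of the theory
  \<^theory>\<open>HOL.Modules\<close> for the scalar multiplication \<^term>\<open>(*)\<close>.
\<close>

global_interpretation ideals: Modules.module "(*) :: 'a::comm_ring_1 \<Rightarrow> 'a \<Rightarrow> 'a"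
  by unfold_locales (simp_all add: algebra_simps)

abbreviation is_ideal :: "'a::comm_ring_1 set \<Rightarrow> bool"
  where "is_ideal \<equiv> ideals.subspace"

abbreviation ideal_gen :: "'a::comm_ring_1 set \<Rightarrow> 'a set"
  where "ideal_gen \<equiv> ideals.span"

definition prime_ideal :: "'a::comm_ring_1 set \<Rightarrow> bool"
  where "prime_ideal P \<longleftrightarrow>
    is_ideal P \<and> P \<noteq> UNIV \<and> (\<forall>a b. a * b \<in> P \<longrightarrow> a \<in> P \<or> b \<in> P)"

definition maximal_ideal :: "'a::comm_ring_1 set \<Rightarrow> bool"
  where "maximal_ideal M \<longleftrightarrow>
    is_ideal M \<and> M \<noteq> UNIV \<and> (\<forall>J. is_ideal J \<and> M \<subseteq> J \<longrightarrow> J = M \<or> J = UNIV)"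

definition radical :: "'a::comm_ring_1 set \<Rightarrow> 'a set"
  where "radical J = {r. \<exists>n. r ^ n \<in> J}"

text \<open>\<^term>\<open>I * J\<close> is the elementwise product of sets, hence not yet an ideal; likewise the
  class power \<^term>\<open>I ^ n\<close> of sets is not the power of ideals.\<close>

definition ideal_mult :: "'a::comm_ring_1 set \<Rightarrow> 'a set \<Rightarrow> 'a set"
  where "ideal_mult I J = ideal_gen (I * J)"

primrec ideal_power :: "'a::comm_ring_1 set \<Rightarrow> nat \<Rightarrow> 'a set"
  where
    "ideal_power I 0 = UNIV"
  | "ideal_power I (Suc n) = ideal_mult I (ideal_power I n)"

definition colon :: "'a::comm_ring_1 set \<Rightarrow> 'a set \<Rightarrow> 'a set"
  where "colon J K = {r. \<forall>a\<in>K. r * a \<in> J}"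

definition saturation :: "'a::comm_ring_1 set \<Rightarrow> 'a set \<Rightarrow> 'a set"
  where "saturation \<mm> J = (\<Union>i\<in>{0<..}. colon J (ideal_power \<mm> i))"


section \<open>Cohen-Macaulay local rings\<close>

text \<open>Properties of the whole ring take the ring as a type argument.\<close>

definition noetherian :: "'a::comm_ring_1 itself \<Rightarrow> bool"
  where "noetherian _ \<longleftrightarrow>
    (\<forall>J :: 'a set. is_ideal J \<longrightarrow> (\<exists>S. finite S \<and> J = ideal_gen S))"

definition krull_dim :: "'a::comm_ring_1 itself \<Rightarrow> enat"
  where "krull_dim _ = Sup {enat n | n.
    \<exists>P :: nat \<Rightarrow> 'a set. (\<forall>i\<le>n. prime_ideal (P i)) \<and> (\<forall>i<n. P i \<subset> P (Suc i))}"

definition local_ring :: "'a::comm_ring_1 set \<Rightarrow> bool"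
  where "local_ring \<mm> \<longleftrightarrow> {M. maximal_ideal M} = {\<mm>}"

definition regular_sequence :: "'a::comm_ring_1 list \<Rightarrow> bool"
  where "regular_sequence ys \<longleftrightarrow>
    (\<forall>i<length ys. \<forall>a. ys ! i * a \<in> ideal_gen (set (take i ys)) \<longrightarrow>
                        a \<in> ideal_gen (set (take i ys))) \<and>
    ideal_gen (set ys) \<noteq> UNIV"

definition depth :: "'a::comm_ring_1 set \<Rightarrow> enat"
  where "depth \<mm> = Sup {enat (length ys) | ys. regular_sequence ys \<and> set ys \<subseteq> \<mm>}"

definition cohen_macaulay_local :: "'a::comm_ring_1 set \<Rightarrow> bool"
  where "cohen_macaulay_local \<mm> \<longleftrightarrow>
    noetherian TYPE('a) \<and> local_ring \<mm> \<and> depth \<mm> = krull_dim TYPE('a)"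

definition system_of_parameters :: "'a::comm_ring_1 set \<Rightarrow> 'a list \<Rightarrow> bool"
  where "system_of_parameters \<mm> ys \<longleftrightarrow>
    enat (length ys) = krull_dim TYPE('a) \<and> set ys \<subseteq> \<mm> \<and> radical (ideal_gen (set ys)) = \<mm>"


section \<open>Quotient modules\<close>

text \<open>
  For ideals \<open>B \<subseteq> A\<close>, the \<open>R\<close>-module \<open>A/B\<close> has as elements the cosets \<^term>\<open>a +o B\<close> with
  \<^term>\<open>a \<in> A\<close>. Its addition is the elementwise sum of cosets and its scalar multiplication is
  \<open>coset_scale\<close>. The set \<^term>\<open>r *o (a +o B)\<close> is in general only a subset of the coset of
  \<^term>\<open>r * a\<close>, and adding \<open>B\<close> restores the full coset (see the two lemmas).
\<close>

definition quotient_module :: "'a::comm_ring_1 set \<Rightarrow> 'a set \<Rightarrow> 'a set set"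
  where "quotient_module A B = (\<lambda>a. a +o B) ` A"

definition coset_scale :: "'a::comm_ring_1 set \<Rightarrow> 'a \<Rightarrow> 'a set \<Rightarrow> 'a set"
  where "coset_scale B r X = r *o X + B"

lemma coset_add:
  assumes "is_ideal B"
  shows "(a +o B) + (b +o B) = (a + b) +o B"
proof (intro subset_antisym subsetI)
  fix z assume "z \<in> (a +o B) + (b +o B)"
  then obtain u v where "u \<in> B" "v \<in> B" "z = (a + u) + (b + v)"
    by (auto simp: set_plus_def elt_set_plus_def)
  then show "z \<in> (a + b) +o B"
    using ideals.subspace_add[OF assms]
    by (auto simp: elt_set_plus_def algebra_simps intro!: bexI[of _ "u + v"])
next
  fix z assume "z \<in> (a + b) +o B"
  then obtain u where "u \<in> B" "z = (a + u) + (b + 0)"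
    by (auto simp: elt_set_plus_def algebra_simps)
  then show "z \<in> (a +o B) + (b +o B)"
    using ideals.subspace_0[OF assms] unfolding set_plus_def elt_set_plus_def by blast
qed

lemma coset_scale_coset:
  assumes "is_ideal B"
  shows "coset_scale B r (a +o B) = (r * a) +o B"
proof (intro subset_antisym subsetI)
  fix z assume "z \<in> coset_scale B r (a +o B)"
  then obtain u v where "u \<in> B" "v \<in> B" "z = r * (a + u) + v"
    by (auto simp: coset_scale_def set_plus_def elt_set_plus_def elt_set_times_def)
  moreover have "r * u + v \<in> B"
    using \<open>u \<in> B\<close> \<open>v \<in> B\<close> ideals.subspace_add[OF assms] ideals.subspace_scale[OF assms] by blast
  ultimately show "z \<in> (r * a) +o B"
    unfolding elt_set_plus_def by (auto simp: algebra_simps intro!: bexI[of _ "r * u + v"])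
next
  fix z assume "z \<in> (r * a) +o B"
  then obtain u where "u \<in> B" "z = r * (a + 0) + u"
    by (auto simp: elt_set_plus_def)
  then show "z \<in> coset_scale B r (a +o B)"
    using ideals.subspace_0[OF assms]
    unfolding coset_scale_def set_plus_def elt_set_plus_def elt_set_times_def by blast
qed

definition quotient_modules_isomorphic ::
    "'a::comm_ring_1 set \<Rightarrow> 'a set \<Rightarrow> 'a set \<Rightarrow> 'a set \<Rightarrow> bool"
  where "quotient_modules_isomorphic A B A' B' \<longleftrightarrow>
    (\<exists>\<phi>. bij_betw \<phi> (quotient_module A B) (quotient_module A' B') \<and>
         (\<forall>X\<in>quotient_module A B. \<forall>Y\<in>quotient_module A B. \<phi> (X + Y) = \<phi> X + \<phi> Y) \<and>
         (\<forall>r. \<forall>X\<in>quotient_module A B. \<phi> (coset_scale B r X) = coset_scale B' r (\<phi> X)))"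


section \<open>The matrix of powers of parameters\<close>

definition minors :: "nat \<Rightarrow> 'a::comm_ring_1 mat \<Rightarrow> 'a set"
  where "minors k A = {det (submatrix A I J) | I J.
    I \<subseteq> {..<dim_row A} \<and> card I = k \<and> J \<subseteq> {..<dim_col A} \<and> card J = k}"

text \<open>Indices of \<open>x\<close> and \<open>\<alpha>\<close> start at \<open>1\<close>, those of the type \<^type>\<open>mat\<close> at \<open>0\<close>.\<close>

definition param_entry ::
    "nat \<Rightarrow> (nat \<Rightarrow> 'a::comm_ring_1) \<Rightarrow> (nat \<Rightarrow> nat \<Rightarrow> nat) \<Rightarrow> nat \<Rightarrow> nat \<Rightarrow> 'a"
  where "param_entry m x \<alpha> i j =
    (if i + j \<le> m + 2 then x (i + j - 1) ^ \<alpha> i j else x (i + j - m - 2) ^ \<alpha> i j)"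

definition param_matrix ::
    "nat \<Rightarrow> (nat \<Rightarrow> 'a::comm_ring_1) \<Rightarrow> (nat \<Rightarrow> nat \<Rightarrow> nat) \<Rightarrow> 'a mat"
  where "param_matrix m x \<alpha> = mat m (m + 1) (\<lambda>(i, j). param_entry m x \<alpha> (i + 1) (j + 1))"

text \<open>The column index \<open>k - i + m + 2\<close> with \<open>k < i\<close> is written \<^term>\<open>k + m + 2 - i\<close>, because
  subtraction of natural numbers truncates.\<close>

definition min_exponent :: "nat \<Rightarrow> (nat \<Rightarrow> nat \<Rightarrow> nat) \<Rightarrow> nat \<Rightarrow> nat"
  where "min_exponent m \<alpha> k =
    (if k < m then Min ((\<lambda>i. \<alpha> i (k - i + 1)) ` {1..k} \<union> (\<lambda>i. \<alpha> i (k + m + 2 - i)) ` {k<..m})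
     else Min ((\<lambda>i. \<alpha> i (k - i + 1)) ` {1..m}))"

end

theory Submission
  imports Defs "HOL-Library.Poly_Mapping"
begin

text \<open>
  Let \<open>S = R[T\<^sub>1, \<dots>, T\<^bsub>m+1\<^esub>]\<close>, and let \<open>f\<^sub>i\<close> be the linear form whose coefficients are the
  \<open>i\<close>-th row of \<open>M\<close>. Sending \<open>T\<^sub>j\<close> to the \<open>j\<close>-th signed maximal minor makes \<open>S/(f\<^sub>1, \<dots>, f\<^sub>m)\<close> the
  Rees algebra of \<open>I\<close>, because the \<open>t\<close>-minors of the first \<open>t\<close> rows have grade at least
  \<open>m + 2 - t\<close>: together with \<open>x\<^sub>1, \<dots>, x\<^bsub>t-1\<^esub>\<close>, those from consecutive columns form a system of
  parameters, being antitriangular with a power of a single parameter on the antidiagonal. The same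
  grades show that every sequence \<open>X\<^sub>1, \<dots>, X\<^sub>k, f\<^sub>1, \<dots>, f\<^sub>i\<close> with \<open>k + i \<le> m + 1\<close> is regular on \<open>S\<close>, where the
  \<open>X\<^sub>k\<close> are any positive powers of the parameters \<open>x\<^sub>k\<close>.

  Write \<open>X\<close> for the ideal of \<open>X\<^sub>1, \<dots>, X\<^bsub>m+1\<^esub>\<close>, in \<open>R\<close> and in \<open>S\<close>, and \<open>V = X + (f\<^sub>1, \<dots>, f\<^sub>m)\<close>. Then
  \<open>(I\<^sup>m : X)/I\<^sup>m\<close> is the degree \<open>m\<close> part of the quotient of \<open>(X\<^sub>1, f\<^sub>1, \<dots>, f\<^sub>m) : V\<close> by
  \<open>(X\<^sub>1, f\<^sub>1, \<dots>, f\<^sub>m)\<close>. Exchanging the \<open>f\<^sub>i\<close> one by one for parameters, each time lowering the degree by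
  one, identifies it with the degree \<open>0\<close> part of \<open>(X : V)/X\<close>, which is \<open>(X :\<^sub>R Q)/X\<close> since the entries
  of \<open>M\<close> generate \<open>Q\<close>. For \<open>X = Q\<close> this is \<open>R/Q\<close>. For \<open>X\<^sub>k = x\<^sub>k\<^sup>n\<close> with \<open>n\<close> arbitrary it shows that \<open>Q\<close>
  annihilates the quotient of the saturation of \<open>I\<^sup>m\<close> by \<open>I\<^sup>m\<close>.
\<close>


text \<open>Here scaling is ring multiplication, so this rule reassociates products against
  \<open>mult.assoc\<close> and makes the simplifier loop.\<close>

declare ideals.scale_scale [simp del]

section \<open>Grade and the list complex\<close>

text \<open>No localization is constructed: a statement over the ring with a minor \<open>u\<close>
  inverted is expressed by allowing a power of \<open>u\<close> as a factor. A block of size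
  \<open>t\<close> with determinant \<open>u\<close> turns the first \<open>t\<close> linear forms
  into \<open>u\<close>-multiples of coordinates, so after inverting \<open>u\<close> the quotient
  by them is a polynomial ring over the base, to which grades transfer coefficientwise. Membership
  then descends along \<open>t\<close>: what holds up to powers of all blocks of size
  \<open>t + 1\<close> holds up to powers of each block of size \<open>t\<close>, and the empty
  block has determinant \<open>1\<close>. Grades are measured by cochains, because a quotient by a
  regular element then costs one degree even when everything is known only up to powers of
  \<open>u\<close>. The exponent \<open>m\<close> comes from a count: there are \<open>m\<close>
  exchanges, each lowers the degree by one and brings in one of the \<open>m\<close> parameters
  other than \<open>X 1\<close>. Starting in degree \<open>m\<close> thus ends with constants modulo
  all parameters, where the linear forms act through the entries of \<open>M\<close>. The exchanges
  are kept as relations, since the partner of an element is determined only modulo the next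
  ideal.\<close>

definition regular_mod :: "'a::comm_ring_1 set \<Rightarrow> 'a \<Rightarrow> bool"
  where "regular_mod K y \<longleftrightarrow> (\<forall>a. y * a \<in> K \<longrightarrow> a \<in> K)"

lemma regular_modD: "regular_mod K y \<Longrightarrow> y * a \<in> K \<Longrightarrow> a \<in> K"
  unfolding regular_mod_def by blast

lemma regular_mod_mult: "regular_mod K y \<Longrightarrow> regular_mod K y' \<Longrightarrow> regular_mod K (y * y')"
  unfolding regular_mod_def by (metis mult.assoc)

lemma regular_mod_power: "regular_mod K y \<Longrightarrow> regular_mod K (y ^ N)"
proof (induction N)
  case 0
  show ?case by (simp add: regular_mod_def)
next
  case (Suc N)
  then show ?case using regular_mod_mult by fastforce
qed

lemma is_ideal_gen: "is_ideal (ideal_gen A)"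
  by (rule ideals.subspace_span)

lemma ideal_mult_left: "is_ideal K \<Longrightarrow> a \<in> K \<Longrightarrow> r * a \<in> K"
  using ideals.subspace_scale by blast

lemma ideal_mult_right: "is_ideal K \<Longrightarrow> a \<in> K \<Longrightarrow> a * r \<in> K"
  using ideal_mult_left[of K a r] by (simp add: mult.commute)

lemma mem_ideal_gen_insert: "x \<in> ideal_gen (insert a S) \<longleftrightarrow> (\<exists>r. x - r * a \<in> ideal_gen S)"
  by (rule ideals.span_breakdown_eq)

lemma ideal_gen_subset_insert: "ideal_gen S \<subseteq> ideal_gen (insert a S)"
  by (rule ideals.span_mono) blast

lemma ideal_gen_subset: "is_ideal K \<Longrightarrow> S \<subseteq> K \<Longrightarrow> ideal_gen S \<subseteq> K"
  by (rule ideals.span_minimal)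

lemma ideal_cong_mem: "is_ideal K \<Longrightarrow> a - b \<in> K \<Longrightarrow> a \<in> K \<longleftrightarrow> b \<in> K"
  using ideals.subspace_diff[of K a "a - b"] ideals.subspace_add[of K b "a - b"] by auto

text \<open>
  The cochains of degree \<open>p\<close> are all functions on lists of indices of length \<open>p\<close>; nothing is
  required to be alternating. The complex is larger than the Koszul complex, but its cohomology
  vanishes in the same range of degrees, and recursion on lists avoids all sign bookkeeping.
\<close>

fun list_diff :: "('i \<Rightarrow> 'a::comm_ring_1) \<Rightarrow> ('i list \<Rightarrow> 'a) \<Rightarrow> 'i list \<Rightarrow> 'a"
  where
    "list_diff z c [] = 0"
  | "list_diff z c (i # L) = z i * c L - list_diff z (\<lambda>L'. c (i # L')) L"

lemma list_diff_zero [simp]: "list_diff z (\<lambda>_. 0) L = 0"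
  by (induction L) auto

lemma list_diff_add: "list_diff z (\<lambda>L. c L + c' L) L = list_diff z c L + list_diff z c' L"
proof (induction L arbitrary: c c')
  case (Cons i L)
  show ?case using Cons[of "\<lambda>L. c (i # L)" "\<lambda>L. c' (i # L)"] by (simp add: distrib_left)
qed simp

lemma list_diff_scale: "list_diff z (\<lambda>L. r * c L) L = r * list_diff z c L"
proof (induction L arbitrary: c)
  case (Cons i L)
  show ?case using Cons[of "\<lambda>L. c (i # L)"] by (simp add: right_diff_distrib mult.left_commute)
qed simp

lemma list_diff_scale_right: "list_diff z (\<lambda>L. c L * r) L = list_diff z c L * r"
  using list_diff_scale[of z r c L] by (simp add: mult.commute)

lemma list_diff_minus: "list_diff z (\<lambda>L. c L - c' L) L = list_diff z c L - list_diff z c' L"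
  using list_diff_add[of z c "\<lambda>L. -1 * c' L"] list_diff_scale[of z "-1" c'] by simp

lemma list_diff_sum: "list_diff z (\<lambda>L. \<Sum>k\<in>S. c k L) L = (\<Sum>k\<in>S. list_diff z (c k) L)"
  by (induction S rule: infinite_finite_induct) (auto simp: list_diff_add)

lemma list_diff_list_diff: "list_diff z (list_diff z c) L = 0"
proof (induction L arbitrary: c)
  case (Cons i L)
  have "list_diff z (list_diff z c) (i # L) =
      z i * list_diff z c L - list_diff z (\<lambda>L. z i * c L - list_diff z (\<lambda>L'. c (i # L')) L) L"
    by simp
  also have "\<dots> = 0"
    using Cons[of "\<lambda>L'. c (i # L')"] by (simp add: list_diff_minus list_diff_scale)
  finally show ?case .
qed simp

lemma list_diff_in_ideal:
  assumes "is_ideal K" and "\<And>L'. set L' \<subseteq> set L \<Longrightarrow> Suc (length L') = length L \<Longrightarrow> c L' \<in> K"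
  shows "list_diff z c L \<in> K"
  using assms(2)
proof (induction L arbitrary: c)
  case Nil
  then show ?case using ideals.subspace_0[OF assms(1)] by simp
next
  case (Cons i L)
  have "list_diff z (\<lambda>L'. c (i # L')) L \<in> K"
  proof (rule Cons.IH)
    fix L' assume "set L' \<subseteq> set L" "Suc (length L') = length L"
    then show "c (i # L') \<in> K" by (intro Cons.prems) auto
  qed
  moreover have "c L \<in> K" by (rule Cons.prems) auto
  ultimately show ?case
    using ideals.subspace_diff[OF assms(1)] ideal_mult_left[OF assms(1)] by simp
qed

definition words :: "'i set \<Rightarrow> nat \<Rightarrow> 'i list set"
  where "words I p = {L. set L \<subseteq> I \<and> length L = p}"

lemma list_diff_words:
  assumes "is_ideal K" and "\<And>L. L \<in> words I p \<Longrightarrow> c L \<in> K" and "L \<in> words I (Suc p)"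
  shows "list_diff z c L \<in> K"
  by (rule list_diff_in_ideal[OF assms(1)]) (use assms in \<open>auto simp: words_def\<close>)

text \<open>Cohomology classes need only vanish after multiplication by a power of \<open>u\<close>, so this is a
  lower bound for the grade after inverting \<open>u\<close>; the grade itself is the case \<open>u = 1\<close>.\<close>

definition grade_ge ::
    "'a::comm_ring_1 \<Rightarrow> ('i \<Rightarrow> 'a) \<Rightarrow> 'i set \<Rightarrow> 'a set \<Rightarrow> nat \<Rightarrow> bool"
  where "grade_ge u z I K n \<longleftrightarrow> (\<forall>p<n. \<forall>c.
    (\<forall>L\<in>words I (Suc p). list_diff z c L \<in> K) \<longrightarrow>
    (\<exists>N b. \<forall>L\<in>words I p. u ^ N * c L - list_diff z b L \<in> K))"

lemma grade_geD:
  assumes "grade_ge u z I K n" "p < n" "\<And>L. L \<in> words I (Suc p) \<Longrightarrow> list_diff z c L \<in> K"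
  shows "\<exists>N b. \<forall>L\<in>words I p. u ^ N * c L - list_diff z b L \<in> K"
  using assms unfolding grade_ge_def by blast

lemma words_choice:
  assumes "\<And>L. L \<in> words I p \<Longrightarrow> d L \<in> ideal_gen (insert y A)"
  shows "\<exists>e. \<forall>L\<in>words I p. d L - e L * y \<in> ideal_gen A"
  using assms unfolding mem_ideal_gen_insert by (intro bchoice) blast

lemma grade_ge_mono:
  assumes "grade_ge u z I K n" "n' \<le> n"
  shows "grade_ge u z I K n'"
  unfolding grade_ge_def
proof (intro allI impI)
  fix p c
  assume "p < n'" and c: "\<forall>L\<in>words I (Suc p). list_diff z c L \<in> K"
  then have "p < n" using assms(2) by simp
  then show "\<exists>N b. \<forall>L\<in>words I p. u ^ N * c L - list_diff z b L \<in> K"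
    using assms(1) c unfolding grade_ge_def by simp
qed

text \<open>This is vanishing in degree \<open>0\<close>: a cochain on the empty word is an element,
  and there is no coboundary term because \<open>list_diff\<close> is zero on the empty
  word.\<close>

lemma grade_ge_torsion:
  assumes "grade_ge u z I K n" "n > 0" "\<And>i. i \<in> I \<Longrightarrow> z i * a \<in> K"
  shows "\<exists>N. u ^ N * a \<in> K"
proof -
  have "\<exists>N b. \<forall>L\<in>words I 0. u ^ N * a - list_diff z b L \<in> K"
  proof (rule grade_geD[OF assms(1,2)])
    fix L assume "L \<in> words I (Suc 0)"
    then obtain i where "L = [i]" "i \<in> I"
      unfolding words_def by (cases L) auto
    then show "list_diff z (\<lambda>_. a) L \<in> K" using assms(3) by simp
  qed
  then obtain N b where "\<forall>L\<in>words I 0. u ^ N * a - list_diff z b L \<in> K" by blast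
  moreover have "[] \<in> words I 0" by (simp add: words_def)
  ultimately have "u ^ N * a - list_diff z b [] \<in> K" by (rule bspec)
  then show ?thesis by auto
qed

text \<open>The long exact sequence for multiplication by \<open>y\<close>, written out. A cocycle
  modulo \<open>y\<close> has differential \<open>y * e\<close>; regularity makes \<open>e\<close> a
  cocycle one degree higher, and correcting \<open>c\<close> by \<open>y\<close> times a primitive
  of \<open>e\<close> gives a cocycle modulo \<open>A\<close>. Each of the two primitives costs a
  power of \<open>u\<close>, so the exponents add.\<close>

lemma grade_ge_cut:
  assumes G: "grade_ge u z I (ideal_gen A) (Suc n)" and y: "regular_mod (ideal_gen A) y"
  shows "grade_ge u z I (ideal_gen (insert y A)) n"
  unfolding grade_ge_def
proof (intro allI impI)
  fix p c
  assume p: "p < n" and c: "\<forall>L\<in>words I (Suc p). list_diff z c L \<in> ideal_gen (insert y A)"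
  let ?K = "ideal_gen A"
  note K = is_ideal_gen[of A]
  have "\<exists>e. \<forall>L\<in>words I (Suc p). list_diff z c L - e L * y \<in> ?K"
    by (intro words_choice) (use c in blast)
  then obtain e where e: "\<And>L. L \<in> words I (Suc p) \<Longrightarrow> list_diff z c L - e L * y \<in> ?K"
    by blast
  have "\<exists>N b. \<forall>L\<in>words I (Suc p). u ^ N * e L - list_diff z b L \<in> ?K"
  proof (rule grade_geD[OF G Suc_mono[OF p]])
    fix L assume L: "L \<in> words I (Suc (Suc p))"
    have "list_diff z (\<lambda>L. list_diff z c L - y * e L) L \<in> ?K"
      by (rule list_diff_words[OF K _ L]) (use e in \<open>simp add: mult.commute\<close>)
    then have "y * (- list_diff z e L) \<in> ?K"
      by (simp add: list_diff_minus list_diff_scale list_diff_list_diff)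
    then have "- list_diff z e L \<in> ?K" by (rule regular_modD[OF y])
    from ideals.subspace_neg[OF K this] show "list_diff z e L \<in> ?K" by simp
  qed
  then obtain N b where b: "\<And>L. L \<in> words I (Suc p) \<Longrightarrow> u ^ N * e L - list_diff z b L \<in> ?K"
    by blast
  have "\<exists>N' b'. \<forall>L\<in>words I p. u ^ N' * (u ^ N * c L - y * b L) - list_diff z b' L \<in> ?K"
  proof (rule grade_geD[OF G less_SucI[OF p]])
    fix L assume L: "L \<in> words I (Suc p)"
    have "u ^ N * (list_diff z c L - e L * y) + y * (u ^ N * e L - list_diff z b L) \<in> ?K"
      by (intro ideals.subspace_add[OF K] ideal_mult_left[OF K] e b L)
    then show "list_diff z (\<lambda>L. u ^ N * c L - y * b L) L \<in> ?K"
      by (simp add: list_diff_minus list_diff_scale list_diff_scale_right algebra_simps)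
  qed
  then obtain N' b' where
    b': "\<And>L. L \<in> words I p \<Longrightarrow> u ^ N' * (u ^ N * c L - y * b L) - list_diff z b' L \<in> ?K"
    by blast
  have "u ^ (N' + N) * c L - list_diff z b' L \<in> ideal_gen (insert y A)" if "L \<in> words I p" for L
    unfolding mem_ideal_gen_insert
    using b'[OF that] by (intro exI[of _ "u ^ N' * b L"]) (simp add: power_add algebra_simps)
  then show "\<exists>N b. \<forall>L\<in>words I p. u ^ N * c L - list_diff z b L \<in> ideal_gen (insert y A)"
    by blast
qed

text \<open>Prepending the index \<open>i\<close> is a homotopy for multiplication by
  \<open>z i = y\<close>: for a cocycle \<open>c\<close>, the product \<open>y * c\<close> is the
  differential of \<open>?h\<close>. So \<open>?h\<close> is a cocycle modulo \<open>y\<close>; up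
  to a coboundary it is \<open>y * e\<close>, and cancelling \<open>y\<close> leaves
  \<open>e\<close> as a primitive of \<open>c\<close>.\<close>

lemma grade_ge_lift:
  assumes G: "grade_ge 1 z I (ideal_gen (insert y A)) n" and y: "regular_mod (ideal_gen A) y"
    and i: "i \<in> I" "z i = y"
  shows "grade_ge 1 z I (ideal_gen A) (Suc n)"
  unfolding grade_ge_def power_one mult_1
proof (intro allI impI)
  fix p c
  assume p: "p < Suc n" and c: "\<forall>L\<in>words I (Suc p). list_diff z c L \<in> ideal_gen A"
  let ?K = "ideal_gen A" and ?h = "\<lambda>L. c (i # L)"
  note K = is_ideal_gen[of A]
  have hc: "y * c L - list_diff z ?h L \<in> ?K" if "L \<in> words I p" for L
  proof -
    have "i # L \<in> words I (Suc p)" using that i by (simp add: words_def)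
    then have "list_diff z c (i # L) \<in> ?K" using c by blast
    then show ?thesis using i by simp
  qed
  show "\<exists>N::nat. \<exists>b. \<forall>L\<in>words I p. c L - list_diff z b L \<in> ?K"
  proof (cases p)
    case 0
    then have "[] \<in> words I p" by (simp add: words_def)
    from hc[OF this] have "c [] \<in> ?K" using regular_modD[OF y] by simp
    then show ?thesis using 0 by (simp add: words_def)
  next
    case (Suc q)
    then have q: "q < n" using p by simp
    have "\<exists>N b. \<forall>L\<in>words I q. 1 ^ N * ?h L - list_diff z b L \<in> ideal_gen (insert y A)"
    proof (rule grade_geD[OF G q])
      fix L assume "L \<in> words I (Suc q)"
      then have "y * c L - list_diff z ?h L \<in> ?K" using hc Suc by simp
      from ideals.subspace_neg[OF K this]
      show "list_diff z ?h L \<in> ideal_gen (insert y A)"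
        unfolding mem_ideal_gen_insert by (intro exI[of _ "c L"]) (simp add: mult.commute)
    qed
    then obtain b where "\<And>L. L \<in> words I q \<Longrightarrow> ?h L - list_diff z b L \<in> ideal_gen (insert y A)"
      unfolding power_one mult_1 by blast
    then have "\<exists>e. \<forall>L\<in>words I q. ?h L - list_diff z b L - e L * y \<in> ?K"
      by (intro words_choice)
    then obtain e where e: "\<And>L. L \<in> words I q \<Longrightarrow> ?h L - list_diff z b L - e L * y \<in> ?K"
      by blast
    have "c L - list_diff z e L \<in> ?K" if L: "L \<in> words I p" for L
    proof -
      have "list_diff z (\<lambda>L. ?h L - list_diff z b L - y * e L) L \<in> ?K"
        by (rule list_diff_words[OF K _ L[unfolded Suc]]) (use e in \<open>simp add: mult.commute\<close>)
      then have "list_diff z ?h L - y * list_diff z e L \<in> ?K"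
        by (simp add: list_diff_minus list_diff_scale list_diff_list_diff)
      from ideals.subspace_add[OF K hc[OF L] this]
      have "y * (c L - list_diff z e L) \<in> ?K" by (simp add: right_diff_distrib)
      then show ?thesis by (rule regular_modD[OF y])
    qed
    then show ?thesis by blast
  qed
qed

text \<open>Induction along the filtration by powers of \<open>y\<close>: a primitive modulo
  \<open>y\<close> leaves an error \<open>e * y\<close>, and regularity of \<open>y\<close> makes
  \<open>e\<close> a cocycle modulo \<open>y ^ N\<close>. This is needed because only powers of the
  members of a regular sequence have to lie in the ideal whose grade is measured.\<close>

lemma grade_ge_insert_power:
  assumes G: "grade_ge 1 z I (ideal_gen (insert y A)) n" and y: "regular_mod (ideal_gen A) y"
  shows "grade_ge 1 z I (ideal_gen (insert (y ^ N) A)) n"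
proof (induction N)
  case 0
  have "r * 1 \<in> ideal_gen (insert 1 A)" for r :: 'a
    by (intro ideals.span_scale ideals.span_base) simp
  then show ?case unfolding grade_ge_def by simp
next
  case (Suc N)
  let ?K = "ideal_gen A" and ?K1 = "ideal_gen (insert (y ^ N) A)"
    and ?K2 = "ideal_gen (insert (y ^ Suc N) A)"
  note K = is_ideal_gen[of A] and K1 = is_ideal_gen[of "insert (y ^ N) A"]
  show ?case unfolding grade_ge_def power_one mult_1
  proof (intro allI impI)
    fix p c
    assume p: "p < n" and "\<forall>L\<in>words I (Suc p). list_diff z c L \<in> ?K2"
    then have "\<exists>r. \<forall>L\<in>words I (Suc p). list_diff z c L - r L * y ^ Suc N \<in> ?K"
      by (intro words_choice) blast
    then obtain r where r: "\<And>L. L \<in> words I (Suc p) \<Longrightarrow> list_diff z c L - r L * y ^ Suc N \<in> ?K"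
      by blast
    have "\<exists>N b. \<forall>L\<in>words I p. 1 ^ N * c L - list_diff z b L \<in> ideal_gen (insert y A)"
    proof (rule grade_geD[OF G p])
      fix L assume "L \<in> words I (Suc p)"
      from r[OF this] show "list_diff z c L \<in> ideal_gen (insert y A)"
        unfolding mem_ideal_gen_insert
        by (intro exI[of _ "r L * y ^ N"]) (simp add: algebra_simps)
    qed
    then obtain b where "\<And>L. L \<in> words I p \<Longrightarrow> c L - list_diff z b L \<in> ideal_gen (insert y A)"
      unfolding power_one mult_1 by blast
    then have "\<exists>e. \<forall>L\<in>words I p. c L - list_diff z b L - e L * y \<in> ?K"
      by (intro words_choice)
    then obtain e where e: "\<And>L. L \<in> words I p \<Longrightarrow> c L - list_diff z b L - e L * y \<in> ?K"
      by blast
    have "\<exists>N b'. \<forall>L\<in>words I p. 1 ^ N * e L - list_diff z b' L \<in> ?K1"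
    proof (rule grade_geD[OF Suc p])
      fix L assume L: "L \<in> words I (Suc p)"
      have "list_diff z (\<lambda>L. c L - list_diff z b L - y * e L) L \<in> ?K"
        by (rule list_diff_words[OF K _ L]) (use e in \<open>simp add: mult.commute\<close>)
      then have 1: "list_diff z c L - y * list_diff z e L \<in> ?K"
        by (simp add: list_diff_minus list_diff_scale list_diff_list_diff)
      from ideals.subspace_diff[OF K r[OF L] 1]
      have "y * (list_diff z e L - r L * y ^ N) \<in> ?K" by (simp add: algebra_simps)
      then have "list_diff z e L - r L * y ^ N \<in> ?K" by (rule regular_modD[OF y])
      then show "list_diff z e L \<in> ?K1" unfolding mem_ideal_gen_insert by blast
    qed
    then obtain b' where "\<And>L. L \<in> words I p \<Longrightarrow> e L - list_diff z b' L \<in> ?K1"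
      unfolding power_one mult_1 by blast
    then have "\<exists>e'. \<forall>L\<in>words I p. e L - list_diff z b' L - e' L * y ^ N \<in> ?K"
      by (intro words_choice)
    then obtain e' where e': "\<And>L. L \<in> words I p \<Longrightarrow> e L - list_diff z b' L - e' L * y ^ N \<in> ?K"
      by blast
    have "c L - list_diff z (\<lambda>L. b L + y * b' L) L \<in> ?K2" if L: "L \<in> words I p" for L
    proof -
      have "(c L - list_diff z b L - e L * y) + y * (e L - list_diff z b' L - e' L * y ^ N) \<in> ?K"
        by (intro ideals.subspace_add[OF K] ideal_mult_left[OF K] e e' L)
      then show ?thesis unfolding mem_ideal_gen_insert
        by (intro exI[of _ "e' L"]) (simp add: list_diff_add list_diff_scale list_diff_scale_right algebra_simps)
    qed
    then show "\<exists>N::nat. \<exists>b. \<forall>L\<in>words I p. c L - list_diff z b L \<in> ?K2"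
      by blast
  qed
qed

fun regular_on :: "'a::comm_ring_1 set \<Rightarrow> 'a list \<Rightarrow> bool"
  where
    "regular_on A [] = True"
  | "regular_on A (y # ys) = (regular_mod (ideal_gen A) y \<and> regular_on (insert y A) ys)"

text \<open>The set \<open>J\<close> indexes itself, so any power of \<open>y\<close> lying in
  \<open>J\<close> can play the role of \<open>z i\<close> in \<open>grade_ge_lift\<close>.\<close>

lemma grade_ge_regular_on:
  assumes "regular_on A ys" and "\<And>y. y \<in> set ys \<Longrightarrow> \<exists>N. y ^ N \<in> J"
  shows "grade_ge 1 (\<lambda>a. a) J (ideal_gen A) (length ys)"
  using assms
proof (induction ys arbitrary: A)
  case Nil
  then show ?case by (simp add: grade_ge_def)
next
  case (Cons y ys)
  obtain N where N: "y ^ N \<in> J" using Cons.prems(2)[of y] by auto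
  have y: "regular_mod (ideal_gen A) y" using Cons.prems by simp
  have yN: "regular_mod (ideal_gen A) (y ^ N)"
    by (rule regular_mod_power[OF y])
  have "grade_ge 1 (\<lambda>a. a) J (ideal_gen (insert y A)) (length ys)"
    using Cons by auto
  from grade_ge_insert_power[OF this y, of N]
  show ?case using grade_ge_lift[OF _ yN, of "\<lambda>a. a" J _ "y ^ N"] N by simp
qed

lemma grade_ge_cuts:
  assumes "grade_ge u z I (ideal_gen A) (n + i)"
    and "\<And>j. j < i \<Longrightarrow> regular_mod (ideal_gen (A \<union> w ` {..<j})) (w j)"
  shows "grade_ge u z I (ideal_gen (A \<union> w ` {..<i})) n"
  using assms
proof (induction i arbitrary: n)
  case (Suc i)
  have "grade_ge u z I (ideal_gen (A \<union> w ` {..<i})) (Suc n)"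
    by (rule Suc.IH) (use Suc.prems in auto)
  from grade_ge_cut[OF this Suc.prems(2)[OF lessI]]
  show ?case by (simp add: lessThan_Suc)
qed simp

section \<open>Noetherian local rings\<close>

lemma noetherian_maximal:
  fixes F :: "'a::comm_ring_1 set set"
  assumes R: "noetherian TYPE('a)" and F: "\<And>A. A \<in> F \<Longrightarrow> is_ideal A" "A0 \<in> F"
  shows "\<exists>A\<in>F. \<forall>B\<in>F. A \<subseteq> B \<longrightarrow> B = A"
proof -
  let ?r = "{(B, A). A \<in> F \<and> B \<in> F \<and> A \<subset> B}"
  have "wf ?r"
    unfolding wf_iff_no_infinite_down_chain
  proof
    assume "\<exists>f. \<forall>i. (f (Suc i), f i) \<in> ?r"
    then obtain f where "\<And>i. (f (Suc i), f i) \<in> ?r" by blast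
    then have f: "\<And>i. f i \<in> F" "\<And>i. f i \<subset> f (Suc i)" by auto
    have mono: "f i \<subseteq> f j" if "i \<le> j" for i j
      using lift_Suc_mono_le[of f i j] f(2) that by blast
    let ?U = "\<Union>i. f i"
    have U: "is_ideal ?U"
    proof (rule ideals.subspaceI)
      show "0 \<in> ?U" using ideals.subspace_0[OF F(1)[OF f(1)[of 0]]] by auto
    next
      fix a b assume "a \<in> ?U" "b \<in> ?U"
      then obtain i j where "a \<in> f i" "b \<in> f j" by auto
      then have "a \<in> f (max i j)" "b \<in> f (max i j)"
        using mono[of i "max i j"] mono[of j "max i j"] by auto
      then have "a + b \<in> f (max i j)" using ideals.subspace_add[OF F(1)[OF f(1)]] by blast
      then show "a + b \<in> ?U" by blast
    next
      fix c a assume "a \<in> ?U"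
      then obtain i where "a \<in> f i" by auto
      then have "c * a \<in> f i" by (rule ideal_mult_left[OF F(1)[OF f(1)]])
      then show "c * a \<in> ?U" by blast
    qed
    obtain S where S: "finite S" "?U = ideal_gen S"
      using R[unfolded noetherian_def, rule_format, OF U] by blast
    have "\<exists>n. S' \<subseteq> f n" if "finite S'" "S' \<subseteq> ?U" for S'
      using that
    proof (induction S')
      case (insert s S')
      then obtain n k where "S' \<subseteq> f n" "s \<in> f k" by auto
      then have "insert s S' \<subseteq> f (max n k)"
        using mono[of n "max n k"] mono[of k "max n k"] by auto
      then show ?case by blast
    qed simp
    from this[OF S(1)] obtain n where "S \<subseteq> f n"
      unfolding S(2) using ideals.span_superset[of S] by blast
    then have "?U \<subseteq> f n" unfolding S(2) by (rule ideal_gen_subset[OF F(1)[OF f(1)]])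
    then show False using f(2)[of n] by blast
  qed
  then have "\<exists>A\<in>F. \<forall>B. (B, A) \<in> ?r \<longrightarrow> B \<notin> F"
    using F(2) unfolding wf_eq_minimal by blast
  then obtain A where A: "A \<in> F" "\<forall>B. (B, A) \<in> ?r \<longrightarrow> B \<notin> F" by (rule bexE)
  have "B = A" if "B \<in> F" "A \<subseteq> B" for B
    using A(1) A(2)[rule_format, of B] that by auto
  then show ?thesis using A(1) by blast
qed

lemma ideal_gen_ideal [simp]: "is_ideal K \<Longrightarrow> ideal_gen K = K"
  by (simp only: ideals.span_eq_iff)

lemma mem_ideal_insert: "is_ideal K \<Longrightarrow> x \<in> ideal_gen (insert a K) \<longleftrightarrow> (\<exists>r. x - r * a \<in> K)"
  by (simp add: mem_ideal_gen_insert)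

text \<open>Here \<open>x\<close> lies in the Jacobson radical and \<open>N\<close> is a bare set,
  so the ascending chain condition replaces generators: among the ideals generated by
  \<open>K\<close> and one element of \<open>N\<close> that contain \<open>b\<close>, take a maximal
  one. Passing from \<open>a\<close> to \<open>a'\<close> cannot enlarge it, so \<open>a'\<close> is
  congruent to \<open>r * x * a'\<close> modulo \<open>K\<close>.\<close>

lemma nakayama:
  fixes K :: "'a::comm_ring_1 set"
  assumes R: "noetherian TYPE('a)" and K: "is_ideal K"
    and x: "\<And>r. \<exists>v. v * (1 - r * x) = 1"
    and N: "\<And>a. a \<in> N \<Longrightarrow> \<exists>a'\<in>N. a - x * a' \<in> K"
  shows "N \<subseteq> K"
proof
  fix b assume b: "b \<in> N"
  let ?F = "(\<lambda>a. ideal_gen (insert a K)) ` {a\<in>N. b \<in> ideal_gen (insert a K)}"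
  have "ideal_gen (insert b K) \<in> ?F"
    using b ideals.span_base[of b "insert b K"] by blast
  then have "\<exists>A\<in>?F. \<forall>B\<in>?F. A \<subseteq> B \<longrightarrow> B = A"
    by (intro noetherian_maximal[OF R]) (auto simp: is_ideal_gen)
  then obtain A where A: "A \<in> ?F" "\<forall>B\<in>?F. A \<subseteq> B \<longrightarrow> B = A" by (rule bexE)
  then obtain a where a: "a \<in> N" "b \<in> ideal_gen (insert a K)" "A = ideal_gen (insert a K)"
    by blast
  obtain a' where a': "a' \<in> N" "a - x * a' \<in> K" using N[OF a(1)] by blast
  have "a - x * a' \<in> ideal_gen (insert a' K)" "a' \<in> ideal_gen (insert a' K)"
    using a'(2) by (simp_all add: ideals.span_base)
  then have "(a - x * a') + x * a' \<in> ideal_gen (insert a' K)"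
    by (intro ideals.span_add ideals.span_scale)
  then have "insert a K \<subseteq> ideal_gen (insert a' K)"
    using ideals.span_superset[of "insert a' K"] by simp
  then have sub: "A \<subseteq> ideal_gen (insert a' K)"
    unfolding a(3) by (rule ideal_gen_subset[OF is_ideal_gen])
  moreover have "ideal_gen (insert a' K) \<in> ?F" using a(2,3) a'(1) sub by blast
  ultimately have "ideal_gen (insert a' K) = A" using A(2) by blast
  then have "a' \<in> A" using ideals.span_base[of a' "insert a' K"] by blast
  then obtain r where r: "a' - r * a \<in> K" unfolding a(3) mem_ideal_insert[OF K] by blast
  obtain v where v: "v * (1 - r * x) = 1" using x by blast
  have "(a' - r * a) + r * (a - x * a') \<in> K"
    using r a'(2) by (intro ideals.subspace_add[OF K] ideal_mult_left[OF K])
  then have "(1 - r * x) * a' \<in> K" by (simp add: algebra_simps)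
  then have "v * ((1 - r * x) * a') \<in> K" by (rule ideal_mult_left[OF K])
  then have "v * (1 - r * x) * a' \<in> K" by (simp only: mult.assoc)
  then have "a' \<in> K" unfolding v mult_1_left .
  then have "a \<in> K" using a'(2) ideal_cong_mem[OF K a'(2)] ideal_mult_left[OF K] by blast
  then have "insert a K = K" by blast
  then show "b \<in> K" using a(2) K by simp
qed

section \<open>Prime avoidance and the existence of regular elements\<close>

lemma prime_ideal_prod:
  assumes "prime_ideal P" "finite S" "prod g S \<in> P"
  shows "\<exists>s\<in>S. g s \<in> P"
  using assms(2,3)
proof (induction S)
  case empty
  then have "r * 1 \<in> P" for r
    using assms(1) ideal_mult_left[of P 1 r] unfolding prime_ideal_def by simp
  then show ?case using assms(1) unfolding prime_ideal_def by auto
next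
  case (insert s S)
  then have "g s * prod g S \<in> P" by simp
  then have "g s \<in> P \<or> prod g S \<in> P" using assms(1) unfolding prime_ideal_def by blast
  then show ?case using insert by blast
qed

text \<open>In a minimal covering subfamily each prime \<open>P\<close> contains an element
  \<open>x P\<close> of \<open>J\<close> that lies in no other member. With at least two members,
  \<open>x P\<close> plus the product of all the other chosen elements lies in none of them.\<close>

lemma prime_avoidance:
  assumes F: "finite F" "\<And>P. P \<in> F \<Longrightarrow> prime_ideal P" and J: "is_ideal J" "J \<subseteq> \<Union>F"
  shows "\<exists>P\<in>F. J \<subseteq> P"
proof -
  obtain G where G: "G \<subseteq> F" "J \<subseteq> \<Union>G" and min: "\<And>H. H \<subset> G \<Longrightarrow> \<not> J \<subseteq> \<Union>H"
  proof -
    let ?C = "{G. G \<subseteq> F \<and> J \<subseteq> \<Union>G}"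
    have "finite ?C" "?C \<noteq> {}" using F(1) J(2) by auto
    then have "\<exists>G\<in>?C. \<forall>H\<in>?C. H \<subseteq> G \<longrightarrow> G = H" by (rule finite_has_minimal)
    then obtain G where G: "G \<in> ?C" "\<forall>H\<in>?C. H \<subseteq> G \<longrightarrow> G = H" by (rule bexE)
    have "\<not> J \<subseteq> \<Union>H" if H: "H \<subset> G" for H
    proof
      assume "J \<subseteq> \<Union>H"
      moreover have "H \<subseteq> F" using G(1) H by blast
      ultimately have "G = H" using G(2) H by blast
      then show False using H by simp
    qed
    moreover have "G \<subseteq> F" "J \<subseteq> \<Union>G" using G(1) by simp_all
    ultimately show thesis by (intro that[of G])
  qed
  have finG: "finite G" using finite_subset[OF G(1) F(1)] .
  have prime: "prime_ideal P" if "P \<in> G" for P using that F(2) G(1) by blast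
  have "\<exists>a. a \<in> J \<and> a \<notin> \<Union>(G - {P})" if "P \<in> G" for P
    using min[of "G - {P}"] that by blast
  then obtain x where x: "\<And>P. P \<in> G \<Longrightarrow> x P \<in> J" "\<And>P P'. P \<in> G \<Longrightarrow> P' \<in> G \<Longrightarrow> P \<noteq> P' \<Longrightarrow> x P \<notin> P'"
    by (metis Diff_iff Union_iff singletonD)
  have xP: "x P \<in> P" if "P \<in> G" for P using x that G(2) by blast
  obtain P where P: "P \<in> G" using G(2) ideals.subspace_0[OF J(1)] by blast
  show ?thesis
  proof (cases "G = {P}")
    case True
    then show ?thesis using G by blast
  next
    case False
    let ?p = "prod x (G - {P})"
    have memI: "?p \<in> A" if A: "is_ideal A" "P' \<in> G" "P' \<noteq> P" "x P' \<in> A" for A P'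
    proof -
      have "?p = x P' * prod x (G - {P} - {P'})"
        by (rule prod.remove) (use finG A in auto)
      then show ?thesis using ideal_mult_right[OF A(1,4)] by simp
    qed
    obtain P1 where P1: "P1 \<in> G" "P1 \<noteq> P" using False P by blast
    have "?p \<in> J" using memI[OF J(1) P1] x(1)[OF P1(1)] by blast
    then have "x P + ?p \<in> J" using ideals.subspace_add[OF J(1) x(1)[OF P]] by blast
    then obtain P2 where P2: "P2 \<in> G" "x P + ?p \<in> P2" using G(2) by blast
    have I2: "is_ideal P2" using prime[OF P2(1)] unfolding prime_ideal_def by blast
    show ?thesis
    proof (cases "P2 = P")
      case True
      then have "?p \<in> P" using ideals.subspace_diff[OF I2 P2(2)] xP[OF P] by fastforce
      then obtain P3 where "P3 \<in> G - {P}" "x P3 \<in> P"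
        using prime_ideal_prod[OF prime[OF P], of "G - {P}" x] finG by blast
      then show ?thesis using x(2) P by blast
    next
      case False
      then have "?p \<in> P2" using memI[OF I2 P2(1)] xP[OF P2(1)] by blast
      then have "x P \<in> P2" using ideals.subspace_diff[OF I2 P2(2)] by fastforce
      then show ?thesis using x(2)[OF P P2(1)] False by blast
    qed
  qed
qed

text \<open>Zero divisors modulo \<open>K\<close> lie in maximal annihilators, which are prime and,
  as shown below, finite in number. Prime avoidance would put \<open>J\<close> inside the
  annihilator of a single element outside \<open>K\<close>, against \<open>JK\<close>.\<close>

lemma exists_regular_mod:
  fixes K :: "'a::comm_ring_1 set"
  assumes R: "noetherian TYPE('a)" and K: "is_ideal K" and J: "is_ideal J"
    and JK: "\<And>a. (\<And>y. y \<in> J \<Longrightarrow> y * a \<in> K) \<Longrightarrow> a \<in> K"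
  shows "\<exists>y\<in>J. regular_mod K y"
proof (rule ccontr)
  assume "\<not> ?thesis"
  then have zd: "\<exists>a. a \<notin> K \<and> y * a \<in> K" if "y \<in> J" for y
    using that unfolding regular_mod_def by blast
  define ann where "ann b = {r. r * b \<in> K}" for b
  have ann: "is_ideal (ann b)" for b
    unfolding ann_def using ideals.subspace_0[OF K] ideals.subspace_add[OF K] ideal_mult_left[OF K]
    by (intro ideals.subspaceI) (auto simp: distrib_right mult.assoc)
  define B where "B = {b. b \<notin> K \<and> (\<forall>b'. b' \<notin> K \<longrightarrow> ann b \<subseteq> ann b' \<longrightarrow> ann b' = ann b)}"
  have Bex: "\<exists>b\<in>B. ann a \<subseteq> ann b" if a: "a \<notin> K" for a
  proof -
    let ?F = "ann ` {b. b \<notin> K \<and> ann a \<subseteq> ann b}"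
    have "ann a \<in> ?F" using a by blast
    then have "\<exists>A\<in>?F. \<forall>A'\<in>?F. A \<subseteq> A' \<longrightarrow> A' = A"
      by (intro noetherian_maximal[OF R]) (auto simp: ann)
    then obtain b where b: "b \<notin> K" "ann a \<subseteq> ann b"
      and max: "\<And>b'. b' \<notin> K \<Longrightarrow> ann a \<subseteq> ann b' \<Longrightarrow> ann b \<subseteq> ann b' \<Longrightarrow> ann b' = ann b"
      by auto
    have "b \<in> B" unfolding B_def using b max order_trans[OF b(2)] by simp
    then show ?thesis using b(2) by blast
  qed
  have prime: "prime_ideal (ann b)" if b: "b \<in> B" for b
    unfolding prime_ideal_def
  proof (intro conjI allI impI ann)
    have "1 \<notin> ann b" using b unfolding B_def ann_def by simp
    then show "ann b \<noteq> UNIV" by blast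
    fix r s assume rs: "r * s \<in> ann b"
    show "r \<in> ann b \<or> s \<in> ann b"
    proof (cases "s * b \<in> K")
      case False
      have "ann b \<subseteq> ann (s * b)"
        unfolding ann_def using ideal_mult_left[OF K, of "_ * b" s]
        by (auto simp: mult.left_commute[of _ s])
      then have "ann (s * b) = ann b" using b False unfolding B_def by blast
      moreover have "r \<in> ann (s * b)" using rs unfolding ann_def by (simp add: mult.assoc)
      ultimately show ?thesis by blast
    qed (simp add: ann_def)
  qed
  let ?F = "(\<lambda>S. ideal_gen (S \<union> K)) ` {S. finite S \<and> S \<subseteq> B}"
  have "ideal_gen ({} \<union> K) \<in> ?F" by blast
  then have "\<exists>A\<in>?F. \<forall>A'\<in>?F. A \<subseteq> A' \<longrightarrow> A' = A"
    by (intro noetherian_maximal[OF R]) (auto simp: is_ideal_gen)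
  then obtain A where A: "A \<in> ?F" "\<forall>A'\<in>?F. A \<subseteq> A' \<longrightarrow> A' = A" by (rule bexE)
  then obtain S where S: "finite S" "S \<subseteq> B" "A = ideal_gen (S \<union> K)" by blast
  have BA: "b \<in> A" if "b \<in> B" for b
  proof -
    have "ideal_gen (insert b S \<union> K) \<in> ?F" using S that by blast
    moreover have "A \<subseteq> ideal_gen (insert b S \<union> K)" unfolding S(3) by (rule ideals.span_mono) blast
    ultimately have "ideal_gen (insert b S \<union> K) = A" using A(2) by blast
    then show ?thesis using ideals.span_base[of b "insert b S \<union> K"] by blast
  qed
  \<comment> \<open>Finiteness of the set of maximal annihilators: were \<open>ann b\<close>
    different from every \<open>ann s\<close>, each \<open>ann s\<close> would contain some
    \<open>r s\<close> outside \<open>ann b\<close>. The product of these kills the finitely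
    generated ideal \<open>A\<close> modulo \<open>K\<close>, hence \<open>b\<close>, although
    \<open>ann b\<close> is prime.\<close>
  have annS: "\<exists>s\<in>S. ann s = ann b" if b: "b \<in> B" for b
  proof (rule ccontr)
    assume "\<not> ?thesis"
    then have "\<not> ann s \<subseteq> ann b" if "s \<in> S" for s
      using that b S(2) unfolding B_def by blast
    then have "\<forall>s\<in>S. \<exists>r. r \<in> ann s \<and> r \<notin> ann b" by blast
    from bchoice[OF this] obtain r where r: "\<And>s. s \<in> S \<Longrightarrow> r s \<in> ann s" "\<And>s. s \<in> S \<Longrightarrow> r s \<notin> ann b"
      by blast
    have "prod r S \<in> ann s" if "s \<in> S" for s
      using ideal_mult_right[OF ann r(1)[OF that]] prod.remove[OF S(1) that, of r] by simp
    then have "S \<union> K \<subseteq> {a. prod r S * a \<in> K}"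
      using ideal_mult_left[OF K] unfolding ann_def by auto
    moreover have "is_ideal {a. prod r S * a \<in> K}"
      using ann[of "prod r S"] unfolding ann_def by (simp add: mult.commute)
    ultimately have "A \<subseteq> {a. prod r S * a \<in> K}" unfolding S(3) by (intro ideal_gen_subset)
    then have "prod r S \<in> ann b" using BA[OF b] unfolding ann_def by blast
    then show False using prime_ideal_prod[OF prime[OF b] S(1)] r(2) by blast
  qed
  have "J \<subseteq> \<Union>(ann ` S)"
  proof
    fix y assume "y \<in> J"
    then obtain a where "a \<notin> K" "y \<in> ann a" using zd unfolding ann_def by blast
    then obtain b where "b \<in> B" "y \<in> ann b" using Bex by blast
    then show "y \<in> \<Union>(ann ` S)" using annS by blast
  qed
  with S(1,2) J prime obtain s where "s \<in> S" "J \<subseteq> ann s"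
    using prime_avoidance[of "ann ` S" J] by blast
  then have "y * s \<in> K" if "y \<in> J" for y using that unfolding ann_def by blast
  then have "s \<in> K" by (rule JK)
  then show False using \<open>s \<in> S\<close> S(2) unfolding B_def by blast
qed

section \<open>Systems of parameters in Cohen-Macaulay local rings are regular sequences\<close>

lemma local_ring_unit:
  fixes \<mm> :: "'a::comm_ring_1 set"
  assumes R: "noetherian TYPE('a)" and m: "local_ring \<mm>" and x: "x \<in> \<mm>"
  shows "\<exists>v. v * (1 - r * x) = 1"
proof (rule ccontr)
  assume no: "\<not> ?thesis"
  let ?A = "ideal_gen {1 - r * x}"
  let ?F = "{J. is_ideal J \<and> J \<noteq> UNIV \<and> ?A \<subseteq> J}"
  have mm: "maximal_ideal \<mm>" using m unfolding local_ring_def by blast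
  then have I: "is_ideal \<mm>" unfolding maximal_ideal_def by blast
  have "1 \<notin> ?A"
  proof
    assume "1 \<in> ?A"
    then obtain v where "1 - v * (1 - r * x) = 0" unfolding mem_ideal_gen_insert by auto
    then show False using no by auto
  qed
  then have "?A \<in> ?F" using is_ideal_gen[of "{1 - r * x}"] by blast
  then have "\<exists>M\<in>?F. \<forall>B\<in>?F. M \<subseteq> B \<longrightarrow> B = M"
    by (intro noetherian_maximal[OF R]) auto
  then obtain M where M: "M \<in> ?F" "\<forall>B\<in>?F. M \<subseteq> B \<longrightarrow> B = M" by (rule bexE)
  then have "maximal_ideal M" unfolding maximal_ideal_def by blast
  then have "M = \<mm>" using m unfolding local_ring_def by blast
  then have "1 - r * x \<in> \<mm>" using M(1) ideals.span_base[of "1 - r * x" "{1 - r * x}"] by blast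
  from ideals.subspace_add[OF I this ideal_mult_left[OF I x, of r]] have "1 \<in> \<mm>" by simp
  then have "\<mm> = UNIV" using ideal_mult_left[OF I, of 1] by auto
  then show False using mm unfolding maximal_ideal_def by blast
qed

text \<open>Adding an element of the Jacobson radical to \<open>J\<close> raises the grade by at
  most one. Once \<open>J\<close> is known to contain a regular element \<open>y\<close>, cutting by
  \<open>y\<close>, the induction hypothesis and lifting finish the step. Such a \<open>y\<close>
  exists if the set \<open>N\<close> of elements killed by \<open>J\<close> lies in
  \<open>K\<close>; vanishing in degrees \<open>0\<close> and \<open>1\<close> shows that each
  element of \<open>N\<close> is \<open>x\<close> times another one modulo \<open>K\<close>, and
  Nakayama applies.\<close>

lemma grade_ge_drop:
  fixes A :: "'a::comm_ring_1 set"
  assumes R: "noetherian TYPE('a)" and J: "is_ideal J" and x: "\<And>r. \<exists>v. v * (1 - r * x) = 1"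
    and G: "grade_ge 1 (\<lambda>a. a) (ideal_gen (insert x J)) (ideal_gen A) (Suc n)"
  shows "grade_ge 1 (\<lambda>a. a) J (ideal_gen A) n"
  using G
proof (induction n arbitrary: A)
  case 0
  show ?case by (simp add: grade_ge_def)
next
  case (Suc n)
  let ?K = "ideal_gen A" and ?Jx = "ideal_gen (insert x J)"
  note K = is_ideal_gen[of A]
  define N where "N = {a. \<forall>j\<in>J. j * a \<in> ?K}"
  have Nmult: "r * a \<in> N" if "a \<in> N" for r a
    using that ideal_mult_left[OF K, of "_ * a" r] unfolding N_def
    by (auto simp: mult.left_commute[of _ r])
  have Nx: "a \<in> ?K" if a: "a \<in> N" "x * a \<in> ?K" for a
  proof -
    have "\<exists>N. 1 ^ N * a \<in> ?K"
    proof (rule grade_ge_torsion[OF Suc.prems])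
      fix w assume "w \<in> ?Jx"
      then obtain r where "w - r * x \<in> J" unfolding mem_ideal_insert[OF J] by blast
      then have "(w - r * x) * a \<in> ?K" using a unfolding N_def by blast
      from ideals.subspace_add[OF K this ideal_mult_left[OF K a(2), of r]]
      show "w * a \<in> ?K" by (simp add: algebra_simps)
    qed simp
    then show ?thesis by simp
  qed
  have "N \<subseteq> ?K"
  proof (rule nakayama[OF R K x])
    fix a assume a: "a \<in> N"
    have "\<exists>r. \<forall>w\<in>?Jx. w - r w * x \<in> J"
      by (intro bchoice) (simp add: mem_ideal_insert[OF J])
    then obtain r where r: "\<And>w. w \<in> ?Jx \<Longrightarrow> w - r w * x \<in> J" by blast
    \<comment> \<open>On \<open>a\<close> an element \<open>w\<close> acts as
      \<open>r w * x\<close>, so the cochain \<open>r w * a\<close> is formally \<open>w * a\<close>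
      divided by \<open>x\<close>. It is a cocycle, and the value \<open>b []\<close> of its
      primitive is the wanted quotient of \<open>a\<close> by \<open>x\<close>.\<close>
    have "\<exists>M b. \<forall>L\<in>words ?Jx 1. 1 ^ M * (r (hd L) * a) - list_diff (\<lambda>a. a) b L \<in> ?K"
    proof (rule grade_geD[OF Suc.prems])
      fix L assume "L \<in> words ?Jx (Suc 1)"
      then obtain u v where L: "L = [u, v]" and uv: "u \<in> ?Jx" "v \<in> ?Jx"
        unfolding words_def by (auto simp: length_Suc_conv)
      have "r v * ((u - r u * x) * a) - r u * ((v - r v * x) * a) \<in> ?K"
        using a r[OF uv(1)] r[OF uv(2)] unfolding N_def
        by (intro ideals.subspace_diff[OF K] ideal_mult_left[OF K, of "_ * a"]) auto
      then show "list_diff (\<lambda>a. a) (\<lambda>L. r (hd L) * a) L \<in> ?K"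
        by (simp add: L algebra_simps)
    qed simp
    then obtain b where b: "\<And>L. L \<in> words ?Jx 1 \<Longrightarrow> r (hd L) * a - list_diff (\<lambda>a. a) b L \<in> ?K"
      unfolding power_one mult_1 by blast
    have b: "r w * a - w * b [] \<in> ?K" if "w \<in> ?Jx" for w
      using b[of "[w]"] that by (simp add: words_def)
    have xJ: "x \<in> ?Jx" by (rule ideals.span_base) simp
    have "b [] \<in> N"
      unfolding N_def
    proof (intro CollectI ballI)
      fix j assume j: "j \<in> J"
      then have jJ: "j \<in> ?Jx" by (intro ideals.span_base) simp
      have "r j * x \<in> J" using ideals.subspace_diff[OF J j r[OF jJ]] by simp
      then have "r j * x * a \<in> ?K" using a unfolding N_def by blast
      then have "x * (r j * a) \<in> ?K" by (simp add: algebra_simps)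
      then have "r j * a \<in> ?K" by (rule Nx[OF Nmult[OF a]])
      from ideals.subspace_diff[OF K this b[OF jJ]]
      show "j * b [] \<in> ?K" by simp
    qed
    moreover have "a - x * b [] \<in> ?K"
    proof -
      \<comment> \<open>The cofactor \<open>r x\<close> was chosen arbitrarily and need not be
        \<open>1\<close>; injectivity of \<open>x\<close> on \<open>N\<close> modulo
        \<open>K\<close> shows that it acts on \<open>a\<close> as \<open>1\<close>.\<close>
      have "(x - r x * x) * a \<in> ?K" using a r[OF xJ] unfolding N_def by blast
      then have "x * ((1 - r x) * a) \<in> ?K" by (simp add: algebra_simps)
      then have "(1 - r x) * a \<in> ?K" by (rule Nx[OF Nmult[OF a]])
      from ideals.subspace_add[OF K this b[OF xJ]] show ?thesis by (simp add: algebra_simps)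
    qed
    ultimately show "\<exists>a'\<in>N. a - x * a' \<in> ?K" by blast
  qed
  then obtain y where y: "y \<in> J" "regular_mod ?K y"
    using exists_regular_mod[OF R K J] unfolding N_def by blast
  have "grade_ge 1 (\<lambda>a. a) J (ideal_gen (insert y A)) n"
    by (rule Suc.IH) (rule grade_ge_cut[OF Suc.prems y(2)])
  from grade_ge_lift[OF this y(2,1)] show ?case by simp
qed

lemma regular_on_nth:
  assumes "\<And>i. i < length ys \<Longrightarrow> regular_mod (ideal_gen (A \<union> set (take i ys))) (ys ! i)"
  shows "regular_on A ys"
  using assms
proof (induction ys arbitrary: A)
  case (Cons y ys)
  have "regular_mod (ideal_gen (insert y A \<union> set (take i ys))) (ys ! i)" if "i < length ys" for i
    using Cons.prems[of "Suc i"] that by simp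
  then show ?case using Cons.IH Cons.prems[of 0] by simp
qed simp

text \<open>Since the supremum defining \<open>depth\<close> equals the finite number
  \<open>n\<close>, some regular sequence in \<open>\<mm>\<close> has length at least
  \<open>n\<close>. Powers of its members lie in \<open>J\<close>, which suffices for
  \<open>grade_ge_regular_on\<close>.\<close>

lemma cohen_macaulay_grade:
  fixes \<mm> :: "'a::comm_ring_1 set"
  assumes CM: "cohen_macaulay_local \<mm>" and dim: "krull_dim TYPE('a) = enat n"
    and J: "\<mm> \<subseteq> radical J"
  shows "grade_ge 1 (\<lambda>a. a) J (ideal_gen {}) n"
proof (cases n)
  case 0
  then show ?thesis by (simp add: grade_ge_def)
next
  case (Suc k)
  let ?S = "{enat (length ys) | ys. regular_sequence ys \<and> set ys \<subseteq> \<mm>}"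
  have "Sup ?S = enat n"
    using CM dim unfolding cohen_macaulay_local_def depth_def by simp
  then have "\<not> Sup ?S \<le> enat k" using Suc by simp
  then have "\<exists>s\<in>?S. \<not> s \<le> enat k" using Sup_least[of ?S "enat k"] by blast
  then obtain ys where ys: "regular_sequence ys" "set ys \<subseteq> \<mm>" "n \<le> length ys"
    using Suc by auto
  have "regular_on {} ys"
    by (rule regular_on_nth) (use ys(1) in \<open>auto simp: regular_sequence_def regular_mod_def\<close>)
  then have "grade_ge 1 (\<lambda>a. a) J (ideal_gen {}) (length ys)"
    by (rule grade_ge_regular_on) (use ys(2) J in \<open>auto simp: radical_def\<close>)
  then show ?thesis using ys(3) by (rule grade_ge_mono)
qed

text \<open>Removing the generators from the last one on, each at the cost of at most one, leaves
  grade at least \<open>j\<close> for the first \<open>j\<close>. Modulo the first \<open>i\<close>,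
  already known to be a regular sequence, the first \<open>i + 1\<close> elements keep grade at
  least \<open>1\<close>, so nothing new is killed by \<open>w i\<close>.\<close>

lemma cohen_macaulay_regular:
  fixes \<mm> :: "'a::comm_ring_1 set"
  assumes CM: "cohen_macaulay_local \<mm>" and dim: "krull_dim TYPE('a) = enat n"
    and w: "\<And>i. i < n \<Longrightarrow> w i \<in> \<mm>" "\<mm> \<subseteq> radical (ideal_gen (w ` {..<n}))"
    and i: "i < n"
  shows "regular_mod (ideal_gen (w ` {..<i})) (w i)"
proof -
  have R: "noetherian TYPE('a)" "local_ring \<mm>" using CM unfolding cohen_macaulay_local_def by auto
  have G: "grade_ge 1 (\<lambda>a. a) (ideal_gen (w ` {..<j})) (ideal_gen {}) j" if "j \<le> n" for j
    using that
  proof (induction j rule: inc_induct)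
    case base
    show ?case by (rule cohen_macaulay_grade[OF CM dim w(2)])
  next
    case (step j)
    have "ideal_gen (insert (w j) (ideal_gen (w ` {..<j}))) = ideal_gen (w ` {..<Suc j})"
      by (auto simp: mem_ideal_gen_insert lessThan_Suc)
    then show ?case
      using grade_ge_drop[OF R(1) is_ideal_gen local_ring_unit[OF R w(1)[OF step(2)]], of "w ` {..<j}" "{}" j]
        step(3) by simp
  qed
  show ?thesis using i
  proof (induction i rule: less_induct)
    case (less i)
    have "grade_ge 1 (\<lambda>a. a) (ideal_gen (w ` {..<Suc i})) (ideal_gen ({} \<union> w ` {..<i})) 1"
      by (rule grade_ge_cuts) (use G[of "Suc i"] less in auto)
    then have G1: "grade_ge 1 (\<lambda>a. a) (ideal_gen (w ` {..<Suc i})) (ideal_gen (w ` {..<i})) 1" by simp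
    show ?case unfolding regular_mod_def
    proof (intro allI impI)
      fix a assume a: "w i * a \<in> ideal_gen (w ` {..<i})"
      have "\<exists>N. 1 ^ N * a \<in> ideal_gen (w ` {..<i})"
      proof (rule grade_ge_torsion[OF G1])
        fix v assume "v \<in> ideal_gen (w ` {..<Suc i})"
        then obtain r where "v - r * w i \<in> ideal_gen (w ` {..<i})"
          by (auto simp: lessThan_Suc mem_ideal_gen_insert)
        then have "a * (v - r * w i) + r * (w i * a) \<in> ideal_gen (w ` {..<i})"
          by (intro ideals.span_add ideals.span_scale a)
        then show "v * a \<in> ideal_gen (w ` {..<i})" by (simp add: algebra_simps)
      qed simp
      then show "a \<in> ideal_gen (w ` {..<i})" by simp
    qed
  qed
qed

section \<open>Polynomials over the ring\<close>

type_synonym 'a pol = "(nat \<Rightarrow>\<^sub>0 nat) \<Rightarrow>\<^sub>0 'a"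

abbreviation lookup :: "('k \<Rightarrow>\<^sub>0 'b::zero) \<Rightarrow> 'k \<Rightarrow> 'b"
  where "lookup \<equiv> Poly_Mapping.lookup"

abbreviation keys :: "('k \<Rightarrow>\<^sub>0 'b::zero) \<Rightarrow> 'k set"
  where "keys \<equiv> Poly_Mapping.keys"

abbreviation single :: "'k \<Rightarrow> 'b \<Rightarrow> 'k \<Rightarrow>\<^sub>0 'b::zero"
  where "single \<equiv> Poly_Mapping.single"

definition pconst :: "'a::comm_ring_1 \<Rightarrow> 'a pol"
  where "pconst r = single 0 r"

definition pvar :: "nat \<Rightarrow> 'a::comm_ring_1 pol"
  where "pvar j = single (single j 1) 1"

lemma pconst_hom: "comm_ring_hom pconst"
  by unfold_locales (simp_all add: pconst_def single_add mult_single)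

interpretation pconst: comm_ring_hom pconst
  by (rule pconst_hom)

lemma poly_mapping_sum_single:
  "g = (\<Sum>k\<in>keys g. single k (lookup g k))"
  by (rule poly_mapping_eqI)
    (auto simp: lookup_sum lookup_single when_def in_keys_iff sum.If_cases)

lemma pvar_power: "pvar j ^ n = single (single j n) 1"
  by (induction n) (simp_all add: pvar_def mult_single single_add[symmetric])

lemma single_eq_pconst_times: "single k r = pconst r * single k 1"
  by (simp add: pconst_def mult_single)

lemma pol_induct [case_names const var add mult]:
  fixes g :: "'a::comm_ring_1 pol"
  assumes const: "\<And>r. P (pconst r)" and var: "\<And>j. P (pvar j)"
    and add: "\<And>f g. P f \<Longrightarrow> P g \<Longrightarrow> P (f + g)" and mult: "\<And>f g. P f \<Longrightarrow> P g \<Longrightarrow> P (f * g)"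
  shows "P g"
proof -
  have pow: "P (pvar j ^ n)" for j n
    by (induction n) (use const[of 1] var mult in simp_all)
  have mono: "P (single k 1)" for k
  proof (induction k rule: update_induct)
    case const
    show ?case using assms(1)[of 1] by (simp add: pconst_def)
  next
    case (update k a v)
    have "Poly_Mapping.update a v k = k + single a v"
      by (rule poly_mapping_eqI)
        (use update(1) in \<open>auto simp: lookup_update lookup_add lookup_single when_def in_keys_iff\<close>)
    then have "single (Poly_Mapping.update a v k) 1 =
        single k 1 * (pvar a ^ v :: 'a pol)"
      by (simp add: pvar_power mult_single)
    then show ?case using mult[OF update(3) pow] by simp
  qed
  have "P (\<Sum>k\<in>A. single k (lookup g k))" if "finite A" for A
    using that
  proof (induction A)
    case empty
    show ?case using const[of 0] by simp
  next
    case (insert k A)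
    have "P (single k (lookup g k))"
      by (subst single_eq_pconst_times) (intro mult const mono)
    then show ?case using insert add by simp
  qed
  from this[of "keys g"] show ?thesis
    unfolding poly_mapping_sum_single[of g, symmetric] by simp
qed

lemma hom_eqI:
  assumes "comm_ring_hom h" "comm_ring_hom h'"
    and "\<And>r. h (pconst r) = h' (pconst r)" "\<And>j. h (pvar j) = h' (pvar j)"
  shows "h g = h' g"
proof -
  interpret h: comm_ring_hom h by fact
  interpret h': comm_ring_hom h' by fact
  show ?thesis
    by (induction g rule: pol_induct) (simp_all add: assms h.hom_add h'.hom_add h.hom_mult h'.hom_mult)
qed

lemma hom_compose:
  assumes "comm_ring_hom h" "comm_ring_hom h'"
  shows "comm_ring_hom (\<lambda>g. h (h' g))"
proof -
  interpret h: comm_ring_hom h by fact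
  interpret h': comm_ring_hom h' by fact
  show ?thesis
    by unfold_locales (simp_all add: h.hom_add h'.hom_add h.hom_mult h'.hom_mult)
qed

section \<open>Evaluation homomorphisms\<close>

definition peval :: "('a::comm_ring_1 \<Rightarrow> 'b::comm_ring_1) \<Rightarrow> (nat \<Rightarrow> 'b) \<Rightarrow> 'a pol \<Rightarrow> 'b"
  where "peval \<phi> \<theta> g = (\<Sum>k\<in>keys g. \<phi> (lookup g k) *
    (\<Prod>j\<in>keys k. \<theta> j ^ lookup k j))"

locale pol_eval = comm_ring_hom \<phi>
  for \<phi> :: "'a::comm_ring_1 \<Rightarrow> 'b::comm_ring_1" +
  fixes \<theta> :: "nat \<Rightarrow> 'b"
begin

definition mon :: "(nat \<Rightarrow>\<^sub>0 nat) \<Rightarrow> 'b"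
  where "mon k = (\<Prod>j\<in>keys k. \<theta> j ^ lookup k j)"

lemma mon_superset:
  assumes "finite A" "keys k \<subseteq> A"
  shows "mon k = (\<Prod>j\<in>A. \<theta> j ^ lookup k j)"
  unfolding mon_def by (rule prod.mono_neutral_left) (use assms in \<open>auto simp: in_keys_iff\<close>)

lemma mon_add: "mon (k + l) = mon k * mon l"
proof -
  let ?A = "keys k \<union> keys l"
  have "mon (k + l) = (\<Prod>j\<in>?A. \<theta> j ^ lookup (k + l) j)"
    by (rule mon_superset) (use keys_add[of k l] in auto)
  also have "\<dots> = (\<Prod>j\<in>?A. \<theta> j ^ lookup k j) * (\<Prod>j\<in>?A. \<theta> j ^ lookup l j)"
    by (simp add: lookup_add power_add prod.distrib)
  also have "\<dots> = mon k * mon l"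
    by (simp add: mon_superset[of ?A])
  finally show ?thesis .
qed

lemma peval_superset:
  assumes "finite A" "keys g \<subseteq> A"
  shows "peval \<phi> \<theta> g = (\<Sum>k\<in>A. \<phi> (lookup g k) * mon k)"
  unfolding peval_def mon_def[symmetric]
  by (rule sum.mono_neutral_left) (use assms in \<open>auto simp: in_keys_iff\<close>)

lemma peval_add: "peval \<phi> \<theta> (f + g) = peval \<phi> \<theta> f + peval \<phi> \<theta> g"
proof -
  let ?A = "keys f \<union> keys g"
  have "peval \<phi> \<theta> (f + g) = (\<Sum>k\<in>?A. \<phi> (lookup (f + g) k) * mon k)"
    by (rule peval_superset) (use keys_add[of f g] in auto)
  also have "\<dots> = (\<Sum>k\<in>?A. \<phi> (lookup f k) * mon k) + (\<Sum>k\<in>?A. \<phi> (lookup g k) * mon k)"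
    by (simp add: lookup_add hom_add distrib_right sum.distrib)
  also have "\<dots> = peval \<phi> \<theta> f + peval \<phi> \<theta> g"
    by (simp add: peval_superset[of ?A])
  finally show ?thesis .
qed

lemma peval_zero: "peval \<phi> \<theta> 0 = 0"
  by (simp add: peval_def)

lemma peval_sum: "peval \<phi> \<theta> (sum f A) = (\<Sum>a\<in>A. peval \<phi> \<theta> (f a))"
  by (induction A rule: infinite_finite_induct) (simp_all add: peval_zero peval_add)

lemma peval_single: "peval \<phi> \<theta> (single k r) = \<phi> r * mon k"
  using peval_superset[of "{k}" "single k r"] by simp

lemma peval_mult: "peval \<phi> \<theta> (f * g) = peval \<phi> \<theta> f * peval \<phi> \<theta> g"
proof -
  have "f * g = (\<Sum>k\<in>keys f. \<Sum>l\<in>keys g. single (k + l)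
      (lookup f k * lookup g l))"
    by (subst (1) poly_mapping_sum_single[of f], subst (1) poly_mapping_sum_single[of g])
      (simp add: sum_product mult_single)
  then have "peval \<phi> \<theta> (f * g) = (\<Sum>k\<in>keys f. \<Sum>l\<in>keys g.
      (\<phi> (lookup f k) * mon k) * (\<phi> (lookup g l) * mon l))"
    by (simp add: peval_sum peval_single hom_mult mon_add mult_ac)
  also have "\<dots> = peval \<phi> \<theta> f * peval \<phi> \<theta> g"
    unfolding peval_def mon_def[symmetric] by (simp add: sum_product)
  finally show ?thesis .
qed

lemma peval_pconst: "peval \<phi> \<theta> (pconst r) = \<phi> r"
  unfolding pconst_def peval_single by (simp add: mon_def)

lemma peval_pvar: "peval \<phi> \<theta> (pvar j) = \<theta> j"
  unfolding pvar_def peval_single by (simp add: mon_def)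

lemma peval_hom: "comm_ring_hom (peval \<phi> \<theta>)"
  using peval_pconst[of 1] by unfold_locales (simp_all add: peval_zero peval_add peval_mult)

end

lemma
  assumes "comm_ring_hom \<phi>"
  shows comm_ring_hom_peval: "comm_ring_hom (peval \<phi> \<theta>)"
    and peval_pconst: "peval \<phi> \<theta> (pconst r) = \<phi> r"
    and peval_pvar: "peval \<phi> \<theta> (pvar j) = \<theta> j"
proof -
  interpret pol_eval \<phi> \<theta> using assms by (simp add: pol_eval_def)
  show "comm_ring_hom (peval \<phi> \<theta>)" "peval \<phi> \<theta> (pconst r) = \<phi> r" "peval \<phi> \<theta> (pvar j) = \<theta> j"
    by (rule peval_hom peval_pconst peval_pvar)+
qed

subsection \<open>Homogeneous components\<close>

text \<open>
  Substituting \<open>T\<^sub>j t\<close> for the variable \<open>T\<^sub>j\<close> gives a polynomial in \<open>t\<close> whose coefficients are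
  the homogeneous components. Being defined by a ring homomorphism, it needs no degrees of monomials.
\<close>

definition grading :: "'a::comm_ring_1 pol \<Rightarrow> 'a pol poly"
  where "grading = peval (\<lambda>r. [:pconst r:]) (\<lambda>j. monom (pvar j) 1)"

definition hom_part :: "nat \<Rightarrow> 'a::comm_ring_1 pol \<Rightarrow> 'a pol"
  where "hom_part n g = coeff (grading g) n"

definition form :: "nat \<Rightarrow> 'a::comm_ring_1 pol \<Rightarrow> bool"
  where "form n g \<longleftrightarrow> grading g = monom g n"

lemma pconst_poly_hom: "comm_ring_hom (\<lambda>r. [:pconst r:])"
  by unfold_locales (simp_all add: pconst.hom_add pconst.hom_mult)

lemmas grading_pconst = peval_pconst[OF pconst_poly_hom, of "\<lambda>j. monom (pvar j) 1", folded grading_def]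
lemmas grading_pvar = peval_pvar[OF pconst_poly_hom, of "\<lambda>j. monom (pvar j) 1", folded grading_def]

interpretation grading: comm_ring_hom "grading :: 'a::comm_ring_1 pol \<Rightarrow> 'a pol poly"
  unfolding grading_def by (rule comm_ring_hom_peval[OF pconst_poly_hom])

lemma hom_part_zero [simp]: "hom_part n 0 = 0"
  by (simp add: hom_part_def)

lemma hom_part_add: "hom_part n (f + g) = hom_part n f + hom_part n g"
  by (simp add: hom_part_def grading.hom_add)

lemma hom_part_diff: "hom_part n (f - g) = hom_part n f - hom_part n g"
  by (simp add: hom_part_def grading.hom_minus)

lemma hom_part_sum: "hom_part n (sum f A) = (\<Sum>a\<in>A. hom_part n (f a))"
  by (induction A rule: infinite_finite_induct) (simp_all add: hom_part_add)

lemma form_pconst: "form 0 (pconst r)"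
  by (simp add: form_def grading_pconst monom_0)

lemma form_pvar: "form 1 (pvar j)"
  by (simp add: form_def grading_pvar)

lemma form_zero: "form n 0"
  by (simp add: form_def)

lemma form_add: "form n f \<Longrightarrow> form n g \<Longrightarrow> form n (f + g)"
  by (simp add: form_def grading.hom_add add_monom)

lemma form_mult: "form m f \<Longrightarrow> form n g \<Longrightarrow> form (m + n) (f * g)"
  by (simp add: form_def grading.hom_mult mult_monom)

lemma form_pconst_mult: "form n g \<Longrightarrow> form n (pconst r * g)"
  using form_mult[OF form_pconst] by simp

lemma form_uminus: "form n f \<Longrightarrow> form n (- f)"
  by (simp add: form_def grading.hom_uminus minus_monom)

lemma form_diff: "form n f \<Longrightarrow> form n g \<Longrightarrow> form n (f - g)"
  using form_add[OF _ form_uminus] by fastforce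

lemma form_sum: "(\<And>a. a \<in> A \<Longrightarrow> form n (f a)) \<Longrightarrow> form n (sum f A)"
  by (induction A rule: infinite_finite_induct) (simp_all add: form_zero form_add)

lemma form_hom_part: "form n (hom_part n g)"
proof (induction g arbitrary: n rule: pol_induct)
  case (const r)
  show ?case by (cases n) (simp_all add: hom_part_def grading_pconst form_pconst form_zero coeff_pCons)
next
  case (var j)
  show ?case
    using form_pvar[of j] by (auto simp: hom_part_def grading_pvar form_zero)
next
  case (add f g)
  then show ?case by (simp add: hom_part_add form_add)
next
  case (mult f g)
  have "form n (\<Sum>i\<le>n. hom_part i f * hom_part (n - i) g)"
  proof (rule form_sum)
    fix i assume "i \<in> {..n}"
    then show "form n (hom_part i f * hom_part (n - i) g)"
      using form_mult[OF mult(1)[of i] mult(2)[of "n - i"]] by simp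
  qed
  then show ?case by (simp add: hom_part_def grading.hom_mult coeff_mult)
qed

lemma hom_part_form: "form n g \<Longrightarrow> hom_part n g = g"
  by (simp add: hom_part_def form_def)

lemma hom_part_form_mult:
  assumes "form k f"
  shows "hom_part n (f * g) = (if k \<le> n then f * hom_part (n - k) g else 0)"
  using assms by (simp add: form_def hom_part_def grading.hom_mult coeff_monom_mult not_le)

lemma hom_part_in_ideal:
  assumes A: "\<And>a. a \<in> A \<Longrightarrow> \<exists>k. form k a" and g: "g \<in> ideal_gen A"
  shows "hom_part n g \<in> ideal_gen A"
  using g
proof (induction rule: ideals.span_induct_alt)
  case base
  show ?case by (simp add: ideals.span_zero)
next
  case (step c a g)
  obtain k where k: "form k a" using A[OF step(1)] by blast
  have "hom_part n (c * a) = (if k \<le> n then hom_part (n - k) c * a else 0)"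
    using hom_part_form_mult[OF k, of n c] by (simp add: mult.commute)
  then have "hom_part n (c * a) \<in> ideal_gen A"
    using ideals.span_scale[OF ideals.span_base[OF step(1)]] by (simp add: ideals.span_zero)
  then show ?case using step(2) by (simp add: hom_part_add ideals.span_add)
qed

lemma form_0_pconst:
  assumes "form 0 g"
  shows "g = pconst (peval (\<lambda>r. r) (\<lambda>_. 0) g)"
proof -
  have id: "comm_ring_hom (\<lambda>r :: 'a. r)" by unfold_locales simp_all
  interpret h: comm_ring_hom "peval (\<lambda>r. r) (\<lambda>_. 0) :: 'a pol \<Rightarrow> 'a"
    by (rule comm_ring_hom_peval[OF id])
  have "hom_part 0 g = pconst (peval (\<lambda>r. r) (\<lambda>_. 0) g)"
    by (induction g rule: pol_induct)
      (simp_all add: hom_part_def grading_pconst grading_pvar peval_pconst[OF id] peval_pvar[OF id]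
        grading.hom_add grading.hom_mult h.hom_add h.hom_mult pconst.hom_add pconst.hom_mult coeff_mult)
  then show ?thesis using hom_part_form[OF assms] by simp
qed

text \<open>The coordinate changes below have the common denominator \<open>u\<close>; their
  composite is this substitution instead of the identity.\<close>

definition pscale :: "'a::comm_ring_1 \<Rightarrow> 'a pol \<Rightarrow> 'a pol"
  where "pscale u = peval pconst (\<lambda>j. pconst u * pvar j)"

lemma poly_eq_sum:
  fixes p :: "'b::comm_ring_1 poly"
  assumes "degree p \<le> N"
  shows "poly p x = (\<Sum>i\<le>N. coeff p i * x ^ i)"
  unfolding poly_altdef
  by (rule sum.mono_neutral_left) (use assms in \<open>auto simp: coeff_eq_0\<close>)

lemma poly_eval_hom: "comm_ring_hom (\<lambda>p :: 'b::comm_ring_1 poly. poly p c)"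
  by unfold_locales simp_all

lemma pscale_eq: "pscale u g = poly (grading g) (pconst u)"
proof (rule hom_eqI[of "pscale u" "\<lambda>g. poly (grading g) (pconst u)"])
  show "comm_ring_hom (pscale u)" unfolding pscale_def by (rule comm_ring_hom_peval[OF pconst_hom])
  show "comm_ring_hom (\<lambda>g. poly (grading g) (pconst u))"
    by (rule hom_compose[OF poly_eval_hom grading.comm_ring_hom_axioms])
  show "pscale u (pconst r) = poly (grading (pconst r)) (pconst u)" for r
    by (simp add: pscale_def peval_pconst[OF pconst_hom] grading_pconst)
  show "pscale u (pvar j) = poly (grading (pvar j)) (pconst u)" for j
    by (simp add: pscale_def peval_pvar[OF pconst_hom] grading_pvar poly_monom mult.commute)
qed

lemma pol_eq_sum_hom_part:
  assumes "degree (grading g) \<le> N"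
  shows "g = (\<Sum>n\<le>N. hom_part n g)"
proof -
  have "g = poly (grading g) 1"
  proof (rule hom_eqI[of "\<lambda>g. g" "\<lambda>g. poly (grading g) 1"])
    show "comm_ring_hom (\<lambda>g :: 'a pol. g)" by unfold_locales simp_all
    show "comm_ring_hom (\<lambda>g. poly (grading g) 1)"
      by (rule hom_compose[OF poly_eval_hom grading.comm_ring_hom_axioms])
  qed (simp_all add: grading_pconst grading_pvar poly_monom)
  also have "\<dots> = (\<Sum>n\<le>N. hom_part n g)"
    by (simp add: poly_eq_sum[OF assms] hom_part_def)
  finally show ?thesis .
qed

lemma hom_part_pscale: "hom_part n (pscale u g) = pconst u ^ n * hom_part n g"
proof -
  let ?N = "max n (degree (grading g))"
  have "pscale u g = (\<Sum>i\<le>?N. pconst (u ^ i) * hom_part i g)"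
    unfolding pscale_eq
    by (subst poly_eq_sum[of _ ?N]) (simp_all add: hom_part_def mult.commute pconst.hom_power)
  then have "hom_part n (pscale u g) = (\<Sum>i\<le>?N. hom_part n (pconst (u ^ i) * hom_part i g))"
    by (simp add: hom_part_sum)
  also have "\<dots> = (\<Sum>i\<le>?N. if i = n then pconst (u ^ i) * hom_part i g else 0)"
  proof (rule sum.cong[OF refl])
    fix i
    show "hom_part n (pconst (u ^ i) * hom_part i g) = (if i = n then pconst (u ^ i) * hom_part i g else 0)"
      using form_pconst_mult[OF form_hom_part[of i g], of "u ^ i"] by (simp add: hom_part_def form_def)
  qed
  finally show ?thesis by (simp add: pconst.hom_power)
qed

text \<open>Scaling multiplies the component of degree \<open>n\<close> by \<open>u ^ n\<close>.
  Filling up every component to the same power \<open>u ^ N\<close> turns information on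
  \<open>pscale u g\<close> into information on \<open>u ^ N\<close> times \<open>g\<close>.\<close>

lemma pconst_power_mult_eq:
  assumes "degree (grading g) \<le> N"
  shows "pconst u ^ N * g = (\<Sum>n\<le>N. pconst u ^ (N - n) * hom_part n (pscale u g))"
proof -
  have "pconst u ^ N * g = (\<Sum>n\<le>N. pconst u ^ N * hom_part n g)"
    by (subst pol_eq_sum_hom_part[OF assms]) (simp add: sum_distrib_left)
  also have "\<dots> = (\<Sum>n\<le>N. pconst u ^ (N - n) * hom_part n (pscale u g))"
    by (rule sum.cong[OF refl]) (simp add: hom_part_pscale mult.assoc[symmetric] power_add[symmetric])
  finally show ?thesis .
qed

lemma pscale_torsion:
  assumes A: "\<And>a. a \<in> A \<Longrightarrow> \<exists>k. form k a" and "pscale u g \<in> ideal_gen A"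
  shows "\<exists>N. pconst u ^ N * g \<in> ideal_gen A"
proof -
  have "pconst u ^ degree (grading g) * g \<in> ideal_gen A"
    unfolding pconst_power_mult_eq[OF order_refl]
    by (intro ideals.span_sum ideals.span_scale hom_part_in_ideal assms)
  then show ?thesis by blast
qed

subsection \<open>Coefficients in an ideal\<close>

text \<open>For an ideal \<open>\<aa>\<close> this is the ideal generated by the constants from
  \<open>\<aa>\<close> and the variables with index in \<open>C\<close>. The description by
  coefficients lets membership, cancellation of variables and grade be checked one monomial at a
  time.\<close>

definition coeffs_in :: "'a::comm_ring_1 set \<Rightarrow> nat set \<Rightarrow> 'a pol set"
  where "coeffs_in \<aa> C = {g. \<forall>k. keys k \<inter> C = {} \<longrightarrow> lookup g k \<in> \<aa>}"

lemma lookup_pconst_mult: "lookup (pconst r * g) k = r * lookup g k"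
  unfolding pconst_def mult_map_scale_conv_mult[symmetric] by (simp add: map.rep_eq when_def)

lemma pvar_mult_eq:
  "pvar j * g = (\<Sum>k\<in>keys g. single (single j 1 + k) (lookup g k))"
  by (subst poly_mapping_sum_single[of g]) (simp add: pvar_def sum_distrib_left mult_single)

lemma lookup_pvar_mult_add:
  "lookup (pvar j * g) (single j 1 + k) = lookup g k"
  by (auto simp: pvar_mult_eq lookup_sum lookup_single when_def in_keys_iff)

lemma lookup_pvar_mult_eq_0:
  assumes "j \<notin> keys k"
  shows "lookup (pvar j * g) k = 0"
proof -
  have "single j 1 + l \<noteq> k" for l
  proof
    assume "single j 1 + l = k"
    then have "lookup k j = 1 + lookup l j"
      by (auto simp: lookup_add)
    then show False using assms by (simp add: in_keys_iff)
  qed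
  then show ?thesis by (simp add: pvar_mult_eq lookup_sum lookup_single)
qed

lemma monomial_split:
  fixes k :: "nat \<Rightarrow>\<^sub>0 nat"
  assumes "j \<in> keys k"
  obtains l where "k = single j 1 + l" "keys l \<subseteq> keys k"
proof -
  have "k = single j 1 + (k - single j 1)"
    by (rule poly_mapping_eqI)
      (use assms in \<open>auto simp: lookup_add lookup_minus lookup_single when_def in_keys_iff\<close>)
  moreover have "keys (k - single j 1) \<subseteq> keys k"
    by (auto simp: in_keys_iff lookup_minus)
  ultimately show thesis by (rule that)
qed

lemma coeffs_in_ideal:
  assumes "is_ideal \<aa>"
  shows "is_ideal (coeffs_in \<aa> C)"
proof (rule ideals.subspaceI)
  show "0 \<in> coeffs_in \<aa> C"
    using ideals.subspace_0[OF assms] by (simp add: coeffs_in_def)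
  show "f + g \<in> coeffs_in \<aa> C" if "f \<in> coeffs_in \<aa> C" "g \<in> coeffs_in \<aa> C" for f g
    using that ideals.subspace_add[OF assms] by (simp add: coeffs_in_def lookup_add)
  show "h * g \<in> coeffs_in \<aa> C" if "g \<in> coeffs_in \<aa> C" for h g
    using that
  proof (induction h arbitrary: g rule: pol_induct)
    case (const r)
    then show ?case
      using ideal_mult_left[OF assms] by (simp add: coeffs_in_def lookup_pconst_mult)
  next
    case (var j)
    show ?case unfolding coeffs_in_def
    proof (intro CollectI allI impI)
      fix k :: "nat \<Rightarrow>\<^sub>0 nat" assume k: "keys k \<inter> C = {}"
      show "lookup (pvar j * g) k \<in> \<aa>"
      proof (cases "j \<in> keys k")
        case True
        then obtain l where l: "k = single j 1 + l" "keys l \<subseteq> keys k"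
          by (rule monomial_split)
        then have "keys l \<inter> C = {}" using k by blast
        then have "lookup g l \<in> \<aa>" using var unfolding coeffs_in_def by blast
        then show ?thesis unfolding l(1) lookup_pvar_mult_add .
      next
        case False
        then show ?thesis using ideals.subspace_0[OF assms] by (simp add: lookup_pvar_mult_eq_0)
      qed
    qed
  next
    case (add f f')
    have "f * g \<in> coeffs_in \<aa> C" "f' * g \<in> coeffs_in \<aa> C" using add by blast+
    then show ?case
      using ideals.subspace_add[OF assms] by (simp add: coeffs_in_def lookup_add distrib_right)
  next
    case (mult f f')
    have "f * (f' * g) \<in> coeffs_in \<aa> C" using mult by blast
    then show ?case by (simp add: mult.assoc)
  qed
qed

lemma pconst_in_coeffs_in: "is_ideal \<aa> \<Longrightarrow> r \<in> \<aa> \<Longrightarrow> pconst r \<in> coeffs_in \<aa> C"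
  using ideals.subspace_0 by (auto simp: coeffs_in_def pconst_def lookup_single when_def)

lemma pvar_in_coeffs_in:
  assumes "is_ideal \<aa>" "j \<in> C"
  shows "pvar j \<in> coeffs_in \<aa> C"
  using assms ideals.subspace_0[OF assms(1)]
  by (auto simp: coeffs_in_def pvar_def lookup_single when_def)

lemma coeffs_in_pvar_cancel:
  assumes "pvar j * g \<in> coeffs_in \<aa> C" "j \<notin> C"
  shows "g \<in> coeffs_in \<aa> C"
  unfolding coeffs_in_def
proof (intro CollectI allI impI)
  fix k :: "nat \<Rightarrow>\<^sub>0 nat" assume k: "keys k \<inter> C = {}"
  have "keys (single j 1 + k) \<inter> C = {}"
    using keys_add[of "single j 1" k] k assms(2) by auto
  then have "lookup (pvar j * g) (single j 1 + k) \<in> \<aa>"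
    using assms(1) unfolding coeffs_in_def by blast
  then show "lookup g k \<in> \<aa>" unfolding lookup_pvar_mult_add .
qed

lemma hom_coeffs_in:
  assumes h: "comm_ring_hom h" and K: "is_ideal K"
    and \<aa>: "\<And>r. r \<in> \<aa> \<Longrightarrow> h (pconst r) \<in> K" and C: "\<And>j. j \<in> C \<Longrightarrow> h (pvar j) \<in> K"
    and g: "g \<in> coeffs_in \<aa> C"
  shows "h g \<in> K"
proof -
  interpret h: comm_ring_hom h by fact
  have "h (single k (lookup g k)) \<in> K" for k
  proof (cases "keys k \<inter> C = {}")
    case True
    then have "h (pconst (lookup g k)) \<in> K" using g \<aa> unfolding coeffs_in_def by blast
    then show ?thesis
      by (subst single_eq_pconst_times) (simp add: h.hom_mult ideal_mult_right[OF K])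
  next
    case False
    then obtain j where j: "j \<in> keys k" "j \<in> C" by blast
    from j(1) obtain l where l: "k = single j 1 + l" by (rule monomial_split)
    have "single k (lookup g k) = pvar j * single l (lookup g k)"
      unfolding l by (simp add: pvar_def mult_single)
    then show ?thesis using C[OF j(2)] by (simp add: h.hom_mult ideal_mult_right[OF K])
  qed
  then have "(\<Sum>k\<in>keys g. h (single k (lookup g k))) \<in> K"
    by (intro ideals.subspace_sum[OF K])
  then show ?thesis by (subst poly_mapping_sum_single[of g]) (simp add: h.hom_sum)
qed

lemma lookup_list_diff:
  "lookup (list_diff (\<lambda>i. pconst (z i)) c L) k = list_diff z (\<lambda>L. lookup (c L) k) L"
  by (induction L arbitrary: c) (simp_all add: lookup_minus lookup_pconst_mult)

lemma finite_words: "finite I \<Longrightarrow> finite (words I p)"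
  unfolding words_def by (rule finite_lists_length_eq)

text \<open>The differential given by constants acts on each coefficient separately, so primitives
  are chosen monomial by monomial. As \<open>I\<close> is finite, only the finitely many monomials
  in \<open>S\<close> occur in a cochain of given degree; elsewhere the primitive \<open>0\<close>
  serves, and \<open>B\<close> has polynomial values.\<close>

lemma grade_ge_coeffs_in:
  assumes G: "grade_ge 1 z I \<aa> n" and I: "finite I" and \<aa>: "is_ideal \<aa>"
  shows "grade_ge 1 (\<lambda>i. pconst (z i)) I (coeffs_in \<aa> C) n"
  unfolding grade_ge_def power_one mult_1
proof (intro allI impI)
  fix p c
  assume p: "p < n" and c: "\<forall>L\<in>words I (Suc p). list_diff (\<lambda>i. pconst (z i)) c L \<in> coeffs_in \<aa> C"
  have "\<exists>b. \<forall>L\<in>words I p. lookup (c L) k - list_diff z b L \<in> \<aa>"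
    if k: "keys k \<inter> C = {}" for k
  proof -
    have "\<exists>N b. \<forall>L\<in>words I p. 1 ^ N * lookup (c L) k - list_diff z b L \<in> \<aa>"
    proof (rule grade_geD[OF G p])
      fix L assume "L \<in> words I (Suc p)"
      then have "list_diff (\<lambda>i. pconst (z i)) c L \<in> coeffs_in \<aa> C" using c by blast
      then show "list_diff z (\<lambda>L. lookup (c L) k) L \<in> \<aa>"
        using k unfolding coeffs_in_def lookup_list_diff[symmetric] by blast
    qed
    then show ?thesis unfolding power_one mult_1 by blast
  qed
  then have "\<forall>k. \<exists>b. keys k \<inter> C = {} \<longrightarrow> (\<forall>L\<in>words I p. lookup (c L) k - list_diff z b L \<in> \<aa>)"
    by blast
  from choice[OF this] obtain b where b: "\<And>k L. keys k \<inter> C = {} \<Longrightarrow> L \<in> words I p \<Longrightarrow>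
      lookup (c L) k - list_diff z (b k) L \<in> \<aa>"
    by blast
  define S where "S = (\<Union>L\<in>words I p. keys (c L))"
  have S: "finite S" unfolding S_def using finite_words[OF I] by simp
  define B where "B L = (\<Sum>k\<in>S. single k (b k L))" for L
  have B: "lookup (B L) k = (if k \<in> S then b k L else 0)" for L k
    unfolding B_def using S by (simp add: lookup_sum lookup_single when_def)
  have "c L - list_diff (\<lambda>i. pconst (z i)) B L \<in> coeffs_in \<aa> C" if L: "L \<in> words I p" for L
    unfolding coeffs_in_def
  proof (intro CollectI allI impI)
    fix k :: "nat \<Rightarrow>\<^sub>0 nat" assume k: "keys k \<inter> C = {}"
    show "lookup (c L - list_diff (\<lambda>i. pconst (z i)) B L) k \<in> \<aa>"
    proof (cases "k \<in> S")
      case True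
      then show ?thesis using b[OF k L] by (simp add: lookup_minus lookup_list_diff B)
    next
      case False
      then have "lookup (c L) k = 0" using L unfolding S_def by (auto simp: in_keys_iff)
      then show ?thesis using False ideals.subspace_0[OF \<aa>]
        by (simp add: lookup_minus lookup_list_diff B)
    qed
  qed
  then show "\<exists>N::nat. \<exists>b. \<forall>L\<in>words I p. c L - list_diff (\<lambda>i. pconst (z i)) b L \<in> coeffs_in \<aa> C"
    by blast
qed

lemma hom_list_diff:
  assumes "comm_ring_hom h"
  shows "h (list_diff z c L) = list_diff (\<lambda>i. h (z i)) (\<lambda>L. h (c L)) L"
proof -
  interpret h: comm_ring_hom h by fact
  show ?thesis by (induction L arbitrary: c) (simp_all add: h.hom_minus h.hom_mult)
qed

lemma hom_part_list_diff:
  "hom_part n (list_diff (\<lambda>i. pconst (z i)) c L) = list_diff (\<lambda>i. pconst (z i)) (\<lambda>L. hom_part n (c L)) L"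
  by (induction L arbitrary: c) (simp_all add: hom_part_diff hom_part_form_mult[OF form_pconst])

text \<open>The maps \<open>\<chi>\<close> and \<open>\<omega>\<close> are inverse only up to
  \<open>pscale u\<close>. A cocycle is carried to the side of \<open>E\<close>, its primitive is
  carried back, and the different powers of \<open>u\<close> in the different degrees are evened
  out; homogeneity of \<open>A\<close> permits working degree by degree.\<close>

lemma grade_ge_transport:
  assumes G: "grade_ge 1 (\<lambda>i. pconst (z i)) I E n" and I: "finite I"
    and A: "\<And>a. a \<in> A \<Longrightarrow> \<exists>k. form k a"
    and \<chi>: "comm_ring_hom \<chi>" "\<And>r. \<chi> (pconst r) = pconst r" "\<And>g. g \<in> ideal_gen A \<Longrightarrow> \<chi> g \<in> E"
    and \<omega>: "comm_ring_hom \<omega>" "\<And>r. \<omega> (pconst r) = pconst r" "\<And>g. g \<in> E \<Longrightarrow> \<omega> g \<in> ideal_gen A"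
    and \<omega>\<chi>: "\<And>g. \<omega> (\<chi> g) = pscale u g"
  shows "grade_ge (pconst u) (\<lambda>i. pconst (z i)) I (ideal_gen A) n"
  unfolding grade_ge_def
proof (intro allI impI)
  fix p c
  let ?z = "\<lambda>i. pconst (z i)"
  assume p: "p < n" and c: "\<forall>L\<in>words I (Suc p). list_diff ?z c L \<in> ideal_gen A"
  interpret \<omega>: comm_ring_hom \<omega> by fact
  have "\<exists>N b. \<forall>L\<in>words I p. 1 ^ N * \<chi> (c L) - list_diff ?z b L \<in> E"
  proof (rule grade_geD[OF G p])
    fix L assume "L \<in> words I (Suc p)"
    then have "\<chi> (list_diff ?z c L) \<in> E" using c by (intro \<chi>(3)) blast
    then show "list_diff ?z (\<lambda>L. \<chi> (c L)) L \<in> E" by (simp add: hom_list_diff[OF \<chi>(1)] \<chi>(2))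
  qed
  then obtain b where b: "\<And>L. L \<in> words I p \<Longrightarrow> \<chi> (c L) - list_diff ?z b L \<in> E"
    unfolding power_one mult_1 by blast
  \<comment> \<open>One exponent for all words, as \<open>grade_ge\<close> requires: it bounds the
    degrees of all values of \<open>c\<close>.\<close>
  define N where "N = Max (insert 0 ((\<lambda>L. degree (grading (c L))) ` words I p))"
  have N: "degree (grading (c L)) \<le> N" if "L \<in> words I p" for L
    unfolding N_def by (rule Max_ge) (use finite_words[OF I] that in auto)
  define b' where "b' L = (\<Sum>n\<le>N. pconst u ^ (N - n) * hom_part n (\<omega> (b L)))" for L
  have "pconst u ^ N * c L - list_diff ?z b' L \<in> ideal_gen A" if L: "L \<in> words I p" for L
  proof -
    have "\<omega> (\<chi> (c L) - list_diff ?z b L) \<in> ideal_gen A" by (intro \<omega>(3) b L)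
    then have "pscale u (c L) - list_diff ?z (\<lambda>L. \<omega> (b L)) L \<in> ideal_gen A"
      by (simp add: \<omega>.hom_minus \<omega>\<chi> hom_list_diff[OF \<omega>(1)] \<omega>(2))
    then have "(\<Sum>n\<le>N. pconst u ^ (N - n) * hom_part n (pscale u (c L) - list_diff ?z (\<lambda>L. \<omega> (b L)) L)) \<in> ideal_gen A"
      by (intro ideals.span_sum ideals.span_scale hom_part_in_ideal A)
    also have "(\<Sum>n\<le>N. pconst u ^ (N - n) * hom_part n (pscale u (c L) - list_diff ?z (\<lambda>L. \<omega> (b L)) L)) =
        pconst u ^ N * c L - list_diff ?z b' L"
      unfolding pconst_power_mult_eq[OF N[OF L]] b'_def list_diff_sum list_diff_scale
      by (simp add: hom_part_diff hom_part_list_diff right_diff_distrib sum_subtractf)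
    finally show ?thesis .
  qed
  then show "\<exists>N b. \<forall>L\<in>words I p. pconst u ^ N * c L - list_diff ?z b L \<in> ideal_gen A" by blast
qed

section \<open>Linear forms with coefficients from a matrix\<close>

definition block :: "(nat \<Rightarrow> nat \<Rightarrow> 'a::comm_ring_1) \<Rightarrow> nat \<Rightarrow> nat \<Rightarrow> 'a mat"
  where "block M s c = mat s s (\<lambda>(i, j). M (i + 1) (c + j))"

definition lin_form :: "(nat \<Rightarrow> nat \<Rightarrow> 'a::comm_ring_1) \<Rightarrow> nat \<Rightarrow> nat \<Rightarrow> 'a pol"
  where "lin_form M n i = (\<Sum>j\<in>{1..n}. pconst (M i j) * pvar j)"

lemma form_lin_form: "form 1 (lin_form M n i)"
  unfolding lin_form_def by (intro form_sum form_pconst_mult form_pvar)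

lemma adj_mat_left:
  fixes A :: "'a::comm_ring_1 mat"
  assumes "A \<in> carrier_mat s s" "i < s" "j < s"
  shows "(\<Sum>l<s. adj_mat A $$ (i, l) * A $$ (l, j)) = (if i = j then det A else 0)"
proof -
  have "(adj_mat A * A) $$ (i, j) = (det A \<cdot>\<^sub>m 1\<^sub>m s) $$ (i, j)"
    using adj_mat(3)[OF assms(1)] by simp
  then show ?thesis
    using assms adj_mat(1)[OF assms(1)] by (simp add: scalar_prod_def atLeast0LessThan)
qed

lemma adj_mat_right:
  fixes A :: "'a::comm_ring_1 mat"
  assumes "A \<in> carrier_mat s s" "i < s" "j < s"
  shows "(\<Sum>l<s. A $$ (i, l) * adj_mat A $$ (l, j)) = (if i = j then det A else 0)"
proof -
  have "(A * adj_mat A) $$ (i, j) = (det A \<cdot>\<^sub>m 1\<^sub>m s) $$ (i, j)"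
    using adj_mat(2)[OF assms(1)] by simp
  then show ?thesis
    using assms adj_mat(1)[OF assms(1)] by (simp add: scalar_prod_def atLeast0LessThan)
qed

lemma sum_block_columns:
  fixes c s n :: nat
  assumes "c \<ge> 1" "c + s \<le> n + 1"
  shows "(\<Sum>j\<in>{1..n}. h j) = (\<Sum>j<s. h (c + j)) + (\<Sum>j\<in>{1..n} - {c..<c + s}. h j)"
proof -
  have sub: "{c..<c + s} \<subseteq> {1..n}" using assms by auto
  have "(\<Sum>j\<in>{c..<c + s}. h j) = (\<Sum>j<s. h (c + j))"
    by (rule sum.reindex_bij_witness[of _ "\<lambda>j. c + j" "\<lambda>j. j - c"]) auto
  then show ?thesis using sum.subset_diff[OF sub, of h] by (simp add: add.commute)
qed

text \<open>
  After inverting the determinant \<open>u\<close> of a block, the linear forms of its rows and the variables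
  outside its columns form a new system of coordinates: \<open>to_coords\<close> and \<open>from_coords\<close> change
  between the systems, with \<open>u\<close> as a common denominator.
\<close>

locale coords =
  fixes M :: "nat \<Rightarrow> nat \<Rightarrow> 'a::comm_ring_1" and m s c :: nat
  assumes c: "1 \<le> c" "c + s \<le> m + 2"
begin

abbreviation A :: "'a mat" where "A \<equiv> block M s c"

abbreviation u :: 'a where "u \<equiv> det A"

definition rest :: "nat \<Rightarrow> 'a pol"
  where "rest i = (\<Sum>l\<in>{1..m + 1} - {c..<c + s}. pconst (M (i + 1) l) * pvar l)"

text \<open>Cramer's rule for the block variables, where the new variable \<open>c + i\<close>
  stands for the linear form of row \<open>i + 1\<close>. The denominator \<open>u\<close> is
  cleared by multiplying the variables outside the block by \<open>u\<close> as well.\<close>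

definition to_coords :: "'a pol \<Rightarrow> 'a pol"
  where "to_coords = peval pconst (\<lambda>j. if j \<in> {c..<c + s}
    then \<Sum>i<s. pconst (adj_mat A $$ (j - c, i)) * (pvar (c + i) - rest i) else pconst u * pvar j)"

definition from_coords :: "'a pol \<Rightarrow> 'a pol"
  where "from_coords = peval pconst (\<lambda>j. if j \<in> {c..<c + s} then lin_form M (m + 1) (j - c + 1) else pvar j)"

sublocale to_coords: comm_ring_hom to_coords
  unfolding to_coords_def by (rule comm_ring_hom_peval[OF pconst_hom])

sublocale from_coords: comm_ring_hom from_coords
  unfolding from_coords_def by (rule comm_ring_hom_peval[OF pconst_hom])

lemma A_carrier: "A \<in> carrier_mat s s"
  by (simp add: block_def)

lemma A_index: "i < s \<Longrightarrow> j < s \<Longrightarrow> A $$ (i, j) = M (i + 1) (c + j)"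
  by (simp add: block_def)

lemma to_coords_pconst: "to_coords (pconst r) = pconst r"
  unfolding to_coords_def by (rule peval_pconst[OF pconst_hom])

lemma from_coords_pconst: "from_coords (pconst r) = pconst r"
  unfolding from_coords_def by (rule peval_pconst[OF pconst_hom])

lemma to_coords_block:
  "b < s \<Longrightarrow> to_coords (pvar (c + b)) =
    (\<Sum>i<s. pconst (adj_mat A $$ (b, i)) * (pvar (c + i) - rest i))"
  unfolding to_coords_def by (simp add: peval_pvar[OF pconst_hom])

lemma to_coords_out: "j \<notin> {c..<c + s} \<Longrightarrow> to_coords (pvar j) = pconst u * pvar j"
  unfolding to_coords_def by (simp only: peval_pvar[OF pconst_hom] if_False)

lemma from_coords_block: "b < s \<Longrightarrow> from_coords (pvar (c + b)) = lin_form M (m + 1) (b + 1)"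
  unfolding from_coords_def by (simp add: peval_pvar[OF pconst_hom])

lemma from_coords_out: "j \<notin> {c..<c + s} \<Longrightarrow> from_coords (pvar j) = pvar j"
  unfolding from_coords_def by (simp only: peval_pvar[OF pconst_hom] if_False)

lemma lin_form_eq: "lin_form M (m + 1) (i + 1) = (\<Sum>j<s. pconst (M (i + 1) (c + j)) * pvar (c + j)) + rest i"
  unfolding lin_form_def rest_def by (rule sum_block_columns) (use c in simp_all)

lemma to_coords_rest: "to_coords (rest i) = pconst u * rest i"
  unfolding rest_def to_coords.hom_sum sum_distrib_left
  by (rule sum.cong[OF refl])
    (simp add: to_coords.hom_mult to_coords_pconst to_coords_out mult.left_commute del: atLeastLessThan_iff)

lemma from_coords_rest: "from_coords (rest i) = rest i"
  unfolding rest_def from_coords.hom_sum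
  by (rule sum.cong[OF refl])
    (simp add: from_coords.hom_mult from_coords_pconst from_coords_out del: atLeastLessThan_iff)

text \<open>The block times its adjugate is \<open>u\<close> times the identity, so the block part
  contributes \<open>u * (pvar (c + i) - rest i)\<close>, and the remaining part of the form
  contributes \<open>u * rest i\<close>.\<close>

lemma to_coords_lin_form:
  assumes i: "i < s"
  shows "to_coords (lin_form M (m + 1) (i + 1)) = pconst u * pvar (c + i)"
proof -
  have "(\<Sum>j<s. pconst (M (i + 1) (c + j)) * to_coords (pvar (c + j))) =
      (\<Sum>j<s. \<Sum>l<s. pconst (A $$ (i, j) * adj_mat A $$ (j, l)) * (pvar (c + l) - rest l))"
    using i by (intro sum.cong refl)
      (simp add: to_coords_block sum_distrib_left A_index pconst.hom_mult mult.assoc)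
  also have "\<dots> = (\<Sum>l<s. \<Sum>j<s. pconst (A $$ (i, j) * adj_mat A $$ (j, l)) * (pvar (c + l) - rest l))"
    by (rule sum.swap)
  also have "\<dots> = (\<Sum>l<s. pconst (\<Sum>j<s. A $$ (i, j) * adj_mat A $$ (j, l)) * (pvar (c + l) - rest l))"
    by (simp add: pconst.hom_sum sum_distrib_right)
  also have "\<dots> = (\<Sum>l<s. if l = i then pconst u * (pvar (c + l) - rest l) else 0)"
    by (intro sum.cong refl) (simp add: adj_mat_right[OF A_carrier i])
  also have "\<dots> = pconst u * (pvar (c + i) - rest i)" using i by simp
  finally show ?thesis
    unfolding lin_form_eq to_coords.hom_add to_coords_rest to_coords.hom_sum to_coords.hom_mult to_coords_pconst
    by (simp add: algebra_simps)
qed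

lemma from_coords_to_coords: "from_coords (to_coords g) = pscale u g"
proof (rule hom_eqI[of "\<lambda>g. from_coords (to_coords g)" "pscale u"])
  show "comm_ring_hom (\<lambda>g. from_coords (to_coords g))"
    by (rule hom_compose[OF from_coords.comm_ring_hom_axioms to_coords.comm_ring_hom_axioms])
  show "comm_ring_hom (pscale u)" unfolding pscale_def by (rule comm_ring_hom_peval[OF pconst_hom])
  show "from_coords (to_coords (pconst r)) = pscale u (pconst r)" for r
    by (simp add: to_coords_pconst from_coords_pconst pscale_def peval_pconst[OF pconst_hom])
  show "from_coords (to_coords (pvar j)) = pscale u (pvar j)" for j
  proof (cases "j \<in> {c..<c + s}")
    case True
    define b where "b = j - c"
    have b: "b < s" "j = c + b" using True by (auto simp: b_def)
    have "from_coords (to_coords (pvar j)) = (\<Sum>i<s. pconst (adj_mat A $$ (b, i)) * (lin_form M (m + 1) (i + 1) - rest i))"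
      using b by (simp add: to_coords_block from_coords.hom_sum from_coords.hom_mult from_coords.hom_minus
        from_coords_pconst from_coords_rest from_coords_block)
    also have "\<dots> = (\<Sum>i<s. \<Sum>l<s. pconst (adj_mat A $$ (b, i) * A $$ (i, l)) * pvar (c + l))"
      by (intro sum.cong refl) (simp add: lin_form_eq[simplified] sum_distrib_left A_index pconst.hom_mult mult.assoc)
    also have "\<dots> = (\<Sum>l<s. \<Sum>i<s. pconst (adj_mat A $$ (b, i) * A $$ (i, l)) * pvar (c + l))"
      by (rule sum.swap)
    also have "\<dots> = (\<Sum>l<s. pconst (\<Sum>i<s. adj_mat A $$ (b, i) * A $$ (i, l)) * pvar (c + l))"
      by (simp add: pconst.hom_sum sum_distrib_right)
    also have "\<dots> = (\<Sum>l<s. if l = b then pconst u * pvar (c + l) else 0)"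
      by (intro sum.cong refl) (simp add: adj_mat_left[OF A_carrier b(1)])
    also have "\<dots> = pconst u * pvar j" using b by simp
    finally show ?thesis by (simp add: pscale_def peval_pvar[OF pconst_hom])
  next
    case False
    then show ?thesis
      by (simp add: to_coords_out from_coords.hom_mult from_coords_pconst from_coords_out pscale_def
        peval_pvar[OF pconst_hom] del: atLeastLessThan_iff)
  qed
qed

end

text \<open>
  Only the variables \<open>T\<^sub>1, \<dots>, T\<^bsub>m+1\<^esub>\<close> are meant to be present, so the remaining ones are
  always put into the ideal.
\<close>

definition rees_gens ::
    "nat \<Rightarrow> (nat \<Rightarrow> 'a::comm_ring_1) \<Rightarrow> (nat \<Rightarrow> nat \<Rightarrow> 'a) \<Rightarrow> nat \<Rightarrow> nat \<Rightarrow> 'a pol set"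
  where "rees_gens m X M k i =
    pconst ` X ` {1..k} \<union> lin_form M (m + 1) ` {1..i} \<union> pvar ` (- {1..m + 1})"

lemma rees_gens_form: "a \<in> rees_gens m X M k i \<Longrightarrow> \<exists>d. form d a"
  unfolding rees_gens_def using form_pconst form_pvar form_lin_form by blast

lemma rees_gens_Suc_left: "rees_gens m X M (Suc k) i = insert (pconst (X (Suc k))) (rees_gens m X M k i)"
  unfolding rees_gens_def by (auto simp: atLeastAtMostSuc_conv)

lemma rees_gens_Suc_right: "rees_gens m X M k (Suc i) = insert (lin_form M (m + 1) (Suc i)) (rees_gens m X M k i)"
  unfolding rees_gens_def by (auto simp: atLeastAtMostSuc_conv)

lemma pconst_ideal_gen:
  assumes "r \<in> ideal_gen B" "\<And>b. b \<in> B \<Longrightarrow> pconst b \<in> ideal_gen A"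
  shows "pconst r \<in> ideal_gen A"
  using assms(1)
  by (induction rule: ideals.span_induct_alt)
    (auto simp: ideals.span_zero pconst.hom_add pconst.hom_mult intro!: ideals.span_add ideals.span_scale assms(2))

lemma pconst_in_rees:
  assumes "r \<in> ideal_gen (X ` {1..k})"
  shows "pconst r \<in> ideal_gen (rees_gens m X M k i)"
  by (rule pconst_ideal_gen[OF assms]) (auto simp: rees_gens_def intro!: ideals.span_base)

lemma rees_0_eq:
  "ideal_gen (rees_gens m X M k 0) = coeffs_in (ideal_gen (X ` {1..k})) (- {1..m + 1})" (is "?K = ?E")
proof (rule subset_antisym)
  have E: "is_ideal ?E" by (rule coeffs_in_ideal[OF is_ideal_gen])
  have "a \<in> ?E" if "a \<in> rees_gens m X M k 0" for a
    using that unfolding rees_gens_def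
  proof (elim UnE imageE)
    fix b i assume "a = pconst b" "b = X i" "i \<in> {1..k}"
    then show ?thesis
      by (simp only:) (intro pconst_in_coeffs_in is_ideal_gen ideals.span_base imageI)
  next
    fix j assume "a = pvar j" "j \<in> - {1..m + 1}"
    then show ?thesis by (simp only:) (rule pvar_in_coeffs_in[OF is_ideal_gen])
  qed simp
  then show "?K \<subseteq> ?E" by (intro ideal_gen_subset[OF E]) blast
next
  have id: "comm_ring_hom (\<lambda>g :: 'a pol. g)" by unfold_locales simp_all
  have var: "pvar j \<in> ?K" if "j \<in> - {1..m + 1}" for j
    unfolding rees_gens_def using that by (intro ideals.span_base) blast
  show "?E \<subseteq> ?K"
  proof
    fix g assume "g \<in> ?E"
    with id is_ideal_gen pconst_in_rees var show "g \<in> ?K" by (rule hom_coeffs_in)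
  qed
qed

context coords
begin

lemma to_coords_rees:
  assumes q: "q \<le> s" and g: "g \<in> ideal_gen (rees_gens m X M k q)"
  shows "to_coords g \<in> coeffs_in (ideal_gen (X ` {1..k})) ({c..<c + q} \<union> - {1..m + 1})"
    (is "_ \<in> ?E")
proof -
  have E: "is_ideal ?E" by (rule coeffs_in_ideal[OF is_ideal_gen])
  have pre: "is_ideal {g. to_coords g \<in> ?E}"
    by (rule ideals.subspaceI)
      (simp_all only: mem_Collect_eq to_coords.hom_zero to_coords.hom_add to_coords.hom_mult
        ideals.subspace_0[OF E] ideals.subspace_add[OF E] ideal_mult_left[OF E])
  have "to_coords a \<in> ?E" if "a \<in> rees_gens m X M k q" for a
    using that unfolding rees_gens_def
  proof (elim UnE imageE)
    fix b i assume "a = pconst b" "b = X i" "i \<in> {1..k}"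
    then show ?thesis
      by (simp only: to_coords_pconst) (intro pconst_in_coeffs_in is_ideal_gen ideals.span_base imageI)
  next
    fix i assume i: "a = lin_form M (m + 1) i" "i \<in> {1..q}"
    define b where "b = i - 1"
    have b: "b < q" "i = b + 1" using i by (auto simp: b_def)
    have "c + b \<in> {c..<c + q} \<union> - {1..m + 1}" using b by simp
    then have "pconst u * pvar (c + b) \<in> ?E"
      by (intro ideal_mult_left[OF E] pvar_in_coeffs_in[OF is_ideal_gen])
    then show ?thesis using to_coords_lin_form[of b] b q unfolding i(1) by simp
  next
    fix j assume j: "a = pvar j" "j \<in> - {1..m + 1}"
    then have "j \<notin> {c..<c + s}" using c by auto
    moreover have "pconst u * pvar j \<in> ?E"
      by (intro ideal_mult_left[OF E] pvar_in_coeffs_in[OF is_ideal_gen]) (use j in blast)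
    ultimately show ?thesis unfolding j(1) by (subst to_coords_out)
  qed
  then have "rees_gens m X M k q \<subseteq> {g. to_coords g \<in> ?E}" by blast
  from ideal_gen_subset[OF pre this] show ?thesis using g by blast
qed

lemma from_coords_rees:
  assumes q: "q \<le> s"
    and g: "g \<in> coeffs_in (ideal_gen (X ` {1..k})) ({c..<c + q} \<union> - {1..m + 1})"
  shows "from_coords g \<in> ideal_gen (rees_gens m X M k q)"
proof (rule hom_coeffs_in[OF from_coords.comm_ring_hom_axioms is_ideal_gen _ _ g])
  show "from_coords (pconst r) \<in> ideal_gen (rees_gens m X M k q)" if "r \<in> ideal_gen (X ` {1..k})" for r
    unfolding from_coords_pconst by (rule pconst_in_rees[OF that])
  show "from_coords (pvar j) \<in> ideal_gen (rees_gens m X M k q)" if j: "j \<in> {c..<c + q} \<union> - {1..m + 1}" for j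
  proof (rule ideals.span_base)
    show "from_coords (pvar j) \<in> rees_gens m X M k q"
    proof (cases "j \<in> {c..<c + q}")
      case True
      define b where "b = j - c"
      have b: "b < q" "j = c + b" using True by (auto simp: b_def)
      have "from_coords (pvar j) = lin_form M (m + 1) (b + 1)" "b + 1 \<in> {1..q}"
        using b q from_coords_block[of b] by simp_all
      then show ?thesis unfolding rees_gens_def by blast
    next
      case False
      then have j': "j \<in> - {1..m + 1}" using j by blast
      then have "j \<notin> {c..<c + s}" using c by auto
      from from_coords_out[OF this] show ?thesis using j' unfolding rees_gens_def by blast
    qed
  qed
qed

text \<open>In the coordinates of a block of size \<open>i + 1\<close> the form becomes
  \<open>u\<close> times a variable that is not among those in the ideal, and such a variable
  cancels. The factor \<open>u\<close> and the change of coordinates cost only powers of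
  \<open>u\<close>.\<close>

lemma lin_form_torsion:
  assumes s: "s = Suc i" and g: "lin_form M (m + 1) (Suc i) * g \<in> ideal_gen (rees_gens m X M k i)"
  shows "\<exists>N. pconst u ^ N * g \<in> ideal_gen (rees_gens m X M k i)"
proof -
  let ?E = "coeffs_in (ideal_gen (X ` {1..k})) ({c..<c + i} \<union> - {1..m + 1})"
  have i: "i \<le> s" "i < s" using s by simp_all
  have "to_coords (lin_form M (m + 1) (Suc i) * g) \<in> ?E"
    by (rule to_coords_rees[OF i(1) g])
  moreover have "to_coords (lin_form M (m + 1) (Suc i) * g) = pvar (c + i) * (pconst u * to_coords g)"
    unfolding to_coords.hom_mult using to_coords_lin_form[OF i(2)] by (simp add: mult_ac)
  ultimately have "pvar (c + i) * (pconst u * to_coords g) \<in> ?E" by (simp only:)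
  moreover have "c + i \<notin> {c..<c + i} \<union> - {1..m + 1}" using c s by auto
  ultimately have "pconst u * to_coords g \<in> ?E" by (rule coeffs_in_pvar_cancel)
  then have "from_coords (pconst u * to_coords g) \<in> ideal_gen (rees_gens m X M k i)"
    by (rule from_coords_rees[OF i(1)])
  moreover have "pconst u * to_coords g = to_coords (pconst u * g)"
    by (simp only: to_coords.hom_mult to_coords_pconst)
  ultimately have "pscale u (pconst u * g) \<in> ideal_gen (rees_gens m X M k i)"
    by (simp only: from_coords_to_coords)
  then have "\<exists>N. pconst u ^ N * (pconst u * g) \<in> ideal_gen (rees_gens m X M k i)"
    by (intro pscale_torsion rees_gens_form)
  then obtain N where "pconst u ^ N * (pconst u * g) \<in> ideal_gen (rees_gens m X M k i)" ..
  then have "pconst u ^ Suc N * g \<in> ideal_gen (rees_gens m X M k i)" by (simp add: mult_ac)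
  then show ?thesis ..
qed

text \<open>After inverting \<open>u\<close>, the quotient by the first \<open>s\<close> forms is a
  polynomial ring over the base modulo the \<open>X\<close>, so the grade of a family of constants
  carries over.\<close>

lemma grade_ge_rees:
  assumes "grade_ge 1 z I (ideal_gen (X ` {1..k})) d" "finite I"
  shows "grade_ge (pconst u) (\<lambda>i. pconst (z i)) I (ideal_gen (rees_gens m X M k s)) d"
  by (rule grade_ge_transport[OF grade_ge_coeffs_in[OF assms is_ideal_gen] assms(2) rees_gens_form
      to_coords.comm_ring_hom_axioms to_coords_pconst to_coords_rees[OF order_refl]
      from_coords.comm_ring_hom_axioms from_coords_pconst from_coords_rees[OF order_refl]
      from_coords_to_coords])

end

text \<open>
  The grade condition on the minors is the one under which the symmetric algebra of the ideal of
  maximal minors agrees with its Rees algebra.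
\<close>

locale generic_minors =
  fixes m :: nat and X :: "nat \<Rightarrow> 'a::comm_ring_1" and M :: "nat \<Rightarrow> nat \<Rightarrow> 'a"
  assumes X_regular: "\<And>k. k \<le> m \<Longrightarrow> regular_mod (ideal_gen (X ` {1..k})) (X (Suc k))"
    and minors_grade: "\<And>t k N. 1 \<le> t \<Longrightarrow> t \<le> m \<Longrightarrow> k \<le> m + 1 \<Longrightarrow>
      grade_ge 1 (\<lambda>c. det (block M t c) ^ Suc N) {1..m + 2 - t} (ideal_gen (X ` {1..k})) (m + 2 - t - k)"
begin

abbreviation rees :: "nat \<Rightarrow> nat \<Rightarrow> 'a pol set"
  where "rees k i \<equiv> ideal_gen (rees_gens m X M k i)"

abbreviation lin :: "nat \<Rightarrow> 'a pol"
  where "lin i \<equiv> lin_form M (m + 1) i"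

text \<open>Passing from size \<open>t + 1\<close> to \<open>t\<close>: where a block of size
  \<open>t\<close> is inverted, the determinants of size \<open>t + 1\<close> have grade at least
  \<open>m + 1 - t - k\<close> modulo the first \<open>t\<close> forms. Cutting by the other
  \<open>i - t\<close> forms leaves \<open>m + 1 - k - i\<close>, which is positive, so an element
  killed by powers of these determinants is killed by a power of the smaller one.\<close>

lemma descent:
  assumes "k + i \<le> m" and reg: "\<And>j. j < i \<Longrightarrow> regular_mod (rees k j) (lin (Suc j))"
    and "t \<le> i + 1" "t \<le> m"
    and "\<And>c. c \<in> {1..m + 2 - t} \<Longrightarrow> \<exists>N. pconst (det (block M t c)) ^ N * g \<in> rees k i"
  shows "g \<in> rees k i"
  using assms(3-)
proof (induction t)
  case 0
  have "det (block M 0 1) = 1" by (simp add: block_def)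
  moreover have "(1::nat) \<in> {1..m + 2 - 0}" by simp
  ultimately show ?case using 0(3)[of 1] by (auto simp: power_one)
next
  case (Suc t)
  have "\<exists>N. pconst (det (block M t c)) ^ N * g \<in> rees k i" if c: "c \<in> {1..m + 2 - t}" for c
  proof -
    let ?I = "{1..m + 2 - Suc t}"
    have "\<forall>b\<in>?I. \<exists>N. pconst (det (block M (Suc t) b)) ^ N * g \<in> rees k i"
      using Suc.prems(3) by blast
    from bchoice[OF this] obtain N where
      N: "\<And>b. b \<in> ?I \<Longrightarrow> pconst (det (block M (Suc t) b)) ^ N b * g \<in> rees k i"
      by blast
    \<comment> \<open>A common exponent for all blocks, and a positive one, as
      \<open>minors_grade\<close> speaks of exponents \<open>Suc N\<close>.\<close>
    define N' where "N' = Suc (\<Sum>b\<in>?I. N b)"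
    have N': "pconst (det (block M (Suc t) b) ^ N') * g \<in> rees k i" if b: "b \<in> ?I" for b
    proof -
      have "N b \<le> (\<Sum>b\<in>?I. N b)" by (rule member_le_sum) (use b in auto)
      then have "N b \<le> N'" unfolding N'_def by simp
      then have "pconst (det (block M (Suc t) b) ^ N') * g =
          pconst (det (block M (Suc t) b)) ^ (N' - N b) * (pconst (det (block M (Suc t) b)) ^ N b * g)"
        by (simp add: pconst.hom_power mult.assoc[symmetric] power_add[symmetric])
      then show ?thesis using ideals.span_scale[OF N[OF b]] by simp
    qed
    interpret coords M m t c
      by unfold_locales (use c Suc.prems in auto)
    let ?w = "\<lambda>j. lin (Suc (t + j))"
    have eq: "rees_gens m X M k t \<union> ?w ` {..<j} = rees_gens m X M k (t + j)" for j
      by (induction j) (simp_all add: lessThan_Suc rees_gens_Suc_right)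
    have it: "t + (i - t) = i" using Suc.prems(1) by simp
    have d: "m + 2 - Suc t - k = (m + 1 - k - i) + (i - t)" using Suc.prems assms(1) by simp
    have "grade_ge (pconst (det (block M t c))) (\<lambda>b. pconst (det (block M (Suc t) b) ^ N')) ?I
        (rees k t) (m + 2 - Suc t - k)"
      unfolding N'_def by (rule grade_ge_rees[OF minors_grade]) (use Suc.prems assms(1) in simp_all)
    then have "grade_ge (pconst (det (block M t c))) (\<lambda>b. pconst (det (block M (Suc t) b) ^ N')) ?I
        (ideal_gen (rees_gens m X M k t \<union> ?w ` {..<i - t})) (m + 1 - k - i)"
      unfolding d
    proof (rule grade_ge_cuts)
      fix j assume "j < i - t"
      then show "regular_mod (ideal_gen (rees_gens m X M k t \<union> ?w ` {..<j})) (?w j)"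
        unfolding eq by (intro reg) simp
    qed
    then have "grade_ge (pconst (det (block M t c))) (\<lambda>b. pconst (det (block M (Suc t) b) ^ N')) ?I
        (rees k i) (m + 1 - k - i)"
      unfolding eq it .
    then show ?thesis
      by (rule grade_ge_torsion) (use assms(1) N' in simp_all)
  qed
  then show ?case using Suc by simp
qed

text \<open>By \<open>lin_form_torsion\<close> the claim holds up to powers of each block of size
  \<open>i + 1\<close>, and \<open>descent\<close> removes these powers. It asks only for regularity
  of the earlier forms, which strong induction supplies.\<close>

lemma lin_regular:
  assumes "i < m" "k + i \<le> m"
  shows "regular_mod (rees k i) (lin (Suc i))"
  using assms
proof (induction i rule: less_induct)
  case (less i)
  show ?case unfolding regular_mod_def
  proof (intro allI impI)
    fix g assume g: "lin (Suc i) * g \<in> rees k i"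
    show "g \<in> rees k i"
    proof (rule descent[of k i "Suc i"])
      show "regular_mod (rees k j) (lin (Suc j))" if "j < i" for j
        using less.IH[OF that] less.prems that by simp
    next
      fix c assume c: "c \<in> {1..m + 2 - Suc i}"
      interpret coords M m "Suc i" c
        by unfold_locales (use c less.prems in auto)
      show "\<exists>N. pconst (det (block M (Suc i) c)) ^ N * g \<in> rees k i"
        by (rule lin_form_torsion[OF refl g])
    qed (use less.prems in simp_all)
  qed
qed

text \<open>Regular elements are interchanged: in a relation \<open>x * a = r * f\<close>,
  regularity of \<open>f\<close> modulo \<open>x\<close> makes \<open>r\<close> a multiple of
  \<open>x\<close>, and then \<open>x\<close> cancels because it is regular before \<open>f\<close>
  is added.\<close>

lemma X_regular_rees:
  assumes "k + i \<le> m"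
  shows "regular_mod (rees k i) (pconst (X (Suc k)))"
  using assms
proof (induction i)
  case 0
  then have "regular_mod (ideal_gen (X ` {1..k})) (X (Suc k))" by (intro X_regular) simp
  from regular_modD[OF this] show ?case
    unfolding regular_mod_def rees_0_eq coeffs_in_def mem_Collect_eq lookup_pconst_mult by blast
next
  case (Suc i)
  let ?x = "pconst (X (Suc k))"
  have x: "regular_mod (rees k i) ?x" using Suc by simp
  have f: "regular_mod (rees (Suc k) i) (lin (Suc i))" by (rule lin_regular) (use Suc in auto)
  note K = is_ideal_gen[of "rees_gens m X M k i"]
  show ?case unfolding regular_mod_def
  proof (intro allI impI)
    fix a assume "?x * a \<in> rees k (Suc i)"
    then obtain r where r: "?x * a - r * lin (Suc i) \<in> rees k i"
      unfolding rees_gens_Suc_right mem_ideal_gen_insert by blast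
    have "- (r * lin (Suc i)) - (- a) * ?x \<in> rees k i" using r by (simp add: algebra_simps)
    then have "- (r * lin (Suc i)) \<in> rees (Suc k) i"
      unfolding rees_gens_Suc_left mem_ideal_gen_insert by blast
    then have "- (- (r * lin (Suc i))) \<in> rees (Suc k) i" by (rule ideals.span_neg)
    then have "lin (Suc i) * r \<in> rees (Suc k) i" by (simp add: mult.commute)
    then have "r \<in> rees (Suc k) i" by (rule regular_modD[OF f])
    then obtain t where t: "r - t * ?x \<in> rees k i"
      unfolding rees_gens_Suc_left mem_ideal_gen_insert by blast
    have "(?x * a - r * lin (Suc i)) + lin (Suc i) * (r - t * ?x) \<in> rees k i"
      by (intro ideals.span_add r ideals.span_scale t)
    then have "?x * (a - t * lin (Suc i)) \<in> rees k i" by (simp add: algebra_simps)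
    then have "a - t * lin (Suc i) \<in> rees k i" by (rule regular_modD[OF x])
    then show "a \<in> rees k (Suc i)"
      unfolding rees_gens_Suc_right mem_ideal_gen_insert by blast
  qed
qed

end

section \<open>Linear correspondences between quotients\<close>

text \<open>A linear relation that induces an isomorphism of \<open>A/B\<close> with
  \<open>A'/B'\<close>: totality on both sides gives definedness and surjectivity,
  \<open>mem_iff\<close> gives independence of representatives and injectivity. The two scalings
  differ because ring elements act on polynomials through constants.\<close>

locale corresponding =
  fixes s :: "'r \<Rightarrow> 'x::ab_group_add \<Rightarrow> 'x" and t :: "'r \<Rightarrow> 'y::ab_group_add \<Rightarrow> 'y"
    and A B :: "'x set" and A' B' :: "'y set" and L :: "('x \<times> 'y) set"
  assumes left: "(a, a') \<in> L \<Longrightarrow> a \<in> A" and right: "(a, a') \<in> L \<Longrightarrow> a' \<in> A'"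
    and left_total: "a \<in> A \<Longrightarrow> \<exists>a'. (a, a') \<in> L" and right_total: "a' \<in> A' \<Longrightarrow> \<exists>a. (a, a') \<in> L"
    and mem_iff: "(a, a') \<in> L \<Longrightarrow> a \<in> B \<longleftrightarrow> a' \<in> B'"
    and add: "(a, a') \<in> L \<Longrightarrow> (b, b') \<in> L \<Longrightarrow> (a + b, a' + b') \<in> L"
    and diff: "(a, a') \<in> L \<Longrightarrow> (b, b') \<in> L \<Longrightarrow> (a - b, a' - b') \<in> L"
    and scale: "(a, a') \<in> L \<Longrightarrow> (s r a, t r a') \<in> L"

lemma corresponding_trans:
  assumes "corresponding s t A B A' B' L" "corresponding t v A' B' A'' B'' L'"
  shows "corresponding s v A B A'' B'' (L O L')"
proof -
  interpret l: corresponding s t A B A' B' L by fact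
  interpret r: corresponding t v A' B' A'' B'' L' by fact
  show ?thesis
  proof
    show "a \<in> A" if "(a, c) \<in> L O L'" for a c using that l.left by (elim relcompE) simp
    show "c \<in> A''" if "(a, c) \<in> L O L'" for a c using that r.right by (elim relcompE) simp
    show "\<exists>c. (a, c) \<in> L O L'" if a: "a \<in> A" for a
    proof -
      obtain b where b: "(a, b) \<in> L" using l.left_total[OF a] ..
      obtain c where "(b, c) \<in> L'" using r.left_total[OF l.right[OF b]] ..
      then show ?thesis using b by (intro exI relcompI)
    qed
    show "\<exists>a. (a, c) \<in> L O L'" if c: "c \<in> A''" for c
    proof -
      obtain b where b: "(b, c) \<in> L'" using r.right_total[OF c] ..
      obtain a where "(a, b) \<in> L" using l.right_total[OF r.left[OF b]] ..
      then show ?thesis using b by (intro exI relcompI)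
    qed
    show "a \<in> B \<longleftrightarrow> c \<in> B''" if "(a, c) \<in> L O L'" for a c
      using that l.mem_iff r.mem_iff by (elim relcompE) simp
    show "(a + b, c + e) \<in> L O L'" "(a - b, c - e) \<in> L O L'"
      if ac: "(a, c) \<in> L O L'" and be: "(b, e) \<in> L O L'" for a b c e
    proof -
      obtain y z where "(a, y) \<in> L" "(y, c) \<in> L'" "(b, z) \<in> L" "(z, e) \<in> L'"
        using ac be by blast
      note yz = this
      show "(a + b, c + e) \<in> L O L'"
        by (rule relcompI[OF l.add[OF yz(1,3)] r.add[OF yz(2,4)]])
      show "(a - b, c - e) \<in> L O L'"
        by (rule relcompI[OF l.diff[OF yz(1,3)] r.diff[OF yz(2,4)]])
    qed
    show "(s r a, v r c) \<in> L O L'" if "(a, c) \<in> L O L'" for r a c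
      using that l.scale r.scale by (elim relcompE) force
  qed
qed

text \<open>If \<open>w * b\<close> is congruent to \<open>t * u\<close>, multiplying by
  \<open>v\<close> gives \<open>u * w * c\<close> congruent to \<open>u * t * v\<close>, and
  \<open>u\<close> cancels. Thus whatever multiplies \<open>b\<close> into the ideal with
  \<open>u\<close> multiplies \<open>c\<close> into the ideal with \<open>v\<close>.\<close>

lemma exchange_colon:
  fixes S :: "'a::comm_ring_1 set"
  assumes u: "regular_mod (ideal_gen S) u" and vb: "v * b - u * c \<in> ideal_gen S"
    and b: "w * b \<in> ideal_gen (insert u S)"
  shows "w * c \<in> ideal_gen (insert v S)"
proof -
  obtain t where t: "w * b - t * u \<in> ideal_gen S" using b unfolding mem_ideal_gen_insert by blast
  have "v * (w * b - t * u) - w * (v * b - u * c) \<in> ideal_gen S"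
    by (rule ideals.span_diff[OF ideals.span_scale[OF t] ideals.span_scale[OF vb]])
  then have "u * (w * c - t * v) \<in> ideal_gen S" by (simp add: algebra_simps)
  then have "w * c - t * v \<in> ideal_gen S" by (rule regular_modD[OF u])
  then show ?thesis unfolding mem_ideal_gen_insert by blast
qed

lemma exchange_mem:
  fixes S :: "'a::comm_ring_1 set"
  assumes "regular_mod (ideal_gen S) u" "v * b - u * c \<in> ideal_gen S" "b \<in> ideal_gen (insert u S)"
  shows "c \<in> ideal_gen (insert v S)"
  using exchange_colon[OF assms(1,2), of 1] assms(3) by simp

lemma hom_part_mult_form: "form k f \<Longrightarrow> hom_part (k + n) (f * h) = f * hom_part n h"
  by (simp add: hom_part_form_mult)

lemma hom_part_pconst_mult: "hom_part n (pconst r * h) = pconst r * hom_part n h"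
  using hom_part_mult_form[OF form_pconst, of n r h] by simp

lemma hom_part_lin_form_mult: "hom_part (Suc n) (lin_form M d i * h) = lin_form M d i * hom_part n h"
  using hom_part_mult_form[OF form_lin_form, of n M d i h] by simp

lemma lookup_lin_form:
  assumes "j \<in> {1..n}"
  shows "lookup (lin_form M n i) (single j 1) = M i j"
proof -
  have "lookup (pconst (M i l) * pvar l) (single j 1) = (if l = j then M i l else 0)" for l
    unfolding lookup_pconst_mult by (auto simp: pvar_def lookup_single when_def dest!: arg_cong[where f = keys])
  then show ?thesis using assms unfolding lin_form_def lookup_sum by simp
qed

abbreviation pmult :: "'a::comm_ring_1 \<Rightarrow> 'a pol \<Rightarrow> 'a pol"
  where "pmult r g \<equiv> pconst r * g"

lemma peval_scaled_form:
  assumes \<phi>: "comm_ring_hom \<phi>" and g: "form n g"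
  shows "peval \<phi> (\<lambda>j. t * \<theta> j) g = t ^ n * peval \<phi> \<theta> g"
proof -
  interpret \<phi>: comm_ring_hom \<phi> by fact
  interpret h: comm_ring_hom "peval \<phi> \<theta>" by (rule comm_ring_hom_peval[OF \<phi>])
  interpret h': comm_ring_hom "peval \<phi> (\<lambda>j. t * \<theta> j)" by (rule comm_ring_hom_peval[OF \<phi>])
  have "peval \<phi> (\<lambda>j. t * \<theta> j) (hom_part n g) = t ^ n * peval \<phi> \<theta> (hom_part n g)" for n
  proof (induction g arbitrary: n rule: pol_induct)
    case (const r)
    show ?case
      by (cases n) (simp_all add: hom_part_def grading_pconst coeff_pCons peval_pconst[OF \<phi>])
  next
    case (var j)
    show ?case by (auto simp: hom_part_def grading_pvar peval_pvar[OF \<phi>])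
  next
    case (add f g)
    then show ?case by (simp add: hom_part_add h.hom_add h'.hom_add distrib_left)
  next
    case (mult f g)
    have "hom_part n (f * g) = (\<Sum>i\<le>n. hom_part i f * hom_part (n - i) g)"
      by (simp add: hom_part_def grading.hom_mult coeff_mult)
    moreover have "peval \<phi> (\<lambda>j. t * \<theta> j) (hom_part i f * hom_part (n - i) g) =
        t ^ n * peval \<phi> \<theta> (hom_part i f * hom_part (n - i) g)" if "i \<le> n" for i
    proof -
      have "t ^ n = t ^ i * t ^ (n - i)" using that by (simp add: power_add[symmetric])
      then show ?thesis by (simp add: h.hom_mult h'.hom_mult mult mult_ac)
    qed
    ultimately show ?case by (simp add: h.hom_sum h'.hom_sum sum_distrib_left)
  qed
  then show ?thesis using hom_part_form[OF g] by metis
qed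

context generic_minors
begin

text \<open>The numerator after \<open>m - i\<close> exchanges, in its only relevant degree
  \<open>i\<close>. The \<open>m + 1 - i\<close> parameters and \<open>i\<close> linear forms always
  number \<open>m + 1\<close> together.\<close>

definition link_num :: "nat \<Rightarrow> 'a pol set"
  where "link_num i = {b. form i b \<and> (\<forall>v\<in>rees_gens m X M (m + 1) m. v * b \<in> rees (m + 1 - i) i)}"

lemma ideal_multiples_closed:
  assumes "v * a \<in> ideal_gen S" "v * b \<in> ideal_gen S"
  shows "v * (a + b) \<in> ideal_gen S" "v * (a - b) \<in> ideal_gen S" "v * (pconst r * a) \<in> ideal_gen S"
  using ideals.span_add[OF assms] ideals.span_diff[OF assms] ideals.span_scale[OF assms(1), of "pconst r"]
  by (simp_all add: algebra_simps)

lemma link_num_closed: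
  assumes "a \<in> link_num i" "b \<in> link_num i"
  shows "a + b \<in> link_num i" "a - b \<in> link_num i" "pconst r * a \<in> link_num i"
proof -
  have ab: "form i a" "form i b" and v: "\<And>v. v \<in> rees_gens m X M (m + 1) m \<Longrightarrow> v * a \<in> rees (m + 1 - i) i"
      "\<And>v. v \<in> rees_gens m X M (m + 1) m \<Longrightarrow> v * b \<in> rees (m + 1 - i) i"
    using assms unfolding link_num_def by blast+
  show "a + b \<in> link_num i" "a - b \<in> link_num i" "pconst r * a \<in> link_num i"
    unfolding link_num_def
    using form_add[OF ab] form_diff[OF ab] form_pconst_mult[OF ab(1)] ideal_multiples_closed[OF v] by blast+
qed

text \<open>
  For regular elements \<open>u\<close> and \<open>v\<close> modulo \<open>B\<close> in an ideal \<open>V\<close>, the quotients of \<open>(B + u) : V\<close> by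
  \<open>B + u\<close> and of \<open>(B + v) : V\<close> by \<open>B + v\<close> are isomorphic: \<open>b\<close> corresponds to \<open>c\<close> when
  \<open>v b \<equiv> u c\<close> modulo \<open>B\<close>. Here \<open>u\<close> is a linear form and \<open>v\<close> a constant, so the degree drops by one.
\<close>

lemma link_step:
  assumes i: "Suc i \<le> m"
  shows "\<exists>L. corresponding pmult pmult (link_num (Suc i)) (rees (m + 1 - Suc i) (Suc i))
    (link_num i) (rees (m + 1 - i) i) L"
proof -
  define k where "k = m - i"
  have k: "m + 1 - Suc i = k" "m + 1 - i = Suc k" "k + i = m" "Suc k \<le> m + 1"
    using i by (simp_all add: k_def)
  let ?S = "rees_gens m X M k i" and ?u = "lin (Suc i)" and ?v = "pconst (X (Suc k))"
  let ?G = "rees_gens m X M (m + 1) m"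
  have u: "regular_mod (ideal_gen ?S) ?u" using i k by (intro lin_regular) simp_all
  have v: "regular_mod (ideal_gen ?S) ?v" using k by (intro X_regular_rees) simp
  have uG: "?u \<in> ?G" "?v \<in> ?G" using i k unfolding rees_gens_def by auto
  have gens: "rees_gens m X M (m + 1 - Suc i) (Suc i) = insert ?u ?S" "rees_gens m X M (m + 1 - i) i = insert ?v ?S"
    unfolding k by (rule rees_gens_Suc_right rees_gens_Suc_left)+
  define L where "L = {(b, c). b \<in> link_num (Suc i) \<and> c \<in> link_num i \<and> ?v * b - ?u * c \<in> ideal_gen ?S}"
  have swap: "?u * c - ?v * b \<in> ideal_gen ?S" if "?v * b - ?u * c \<in> ideal_gen ?S" for b c
    using ideals.span_neg[OF that] by simp
  have LD: "b \<in> link_num (Suc i)" "c \<in> link_num i" "?v * b - ?u * c \<in> ideal_gen ?S" if "(b, c) \<in> L" for b c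
    using that unfolding L_def by blast+
  have LI: "(b, c) \<in> L" if "b \<in> link_num (Suc i)" "c \<in> link_num i" "?v * b - ?u * c \<in> ideal_gen ?S" for b c
    using that unfolding L_def by blast
  have "corresponding pmult pmult (link_num (Suc i)) (rees (m + 1 - Suc i) (Suc i))
      (link_num i) (rees (m + 1 - i) i) L"
  proof
    show "\<exists>c. (b, c) \<in> L" if b: "b \<in> link_num (Suc i)" for b
    proof -
      have fb: "form (Suc i) b" and Gb: "\<And>w. w \<in> ?G \<Longrightarrow> w * b \<in> ideal_gen (insert ?u ?S)"
        using b unfolding link_num_def gens by blast+
      obtain r where r: "?v * b - r * ?u \<in> ideal_gen ?S"
        using Gb[OF uG(2)] unfolding mem_ideal_gen_insert by blast
      \<comment> \<open>Taking the component of degree \<open>Suc i\<close> replaces the arbitrary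
        cofactor \<open>r\<close> by a form of degree \<open>i\<close>.\<close>
      have "hom_part (Suc i) (?v * b - ?u * r) \<in> ideal_gen ?S"
        using r by (intro hom_part_in_ideal rees_gens_form) (simp_all add: mult.commute)
      then have c: "?v * b - ?u * hom_part i r \<in> ideal_gen ?S"
        by (simp only: hom_part_diff hom_part_pconst_mult hom_part_lin_form_mult hom_part_form[OF fb])
      have "hom_part i r \<in> link_num i"
        unfolding link_num_def gens using exchange_colon[OF u c Gb] form_hom_part by blast
      from LI[OF b this c] show ?thesis ..
    qed
    show "\<exists>b. (b, c) \<in> L" if c: "c \<in> link_num i" for c
    proof -
      have fc: "form i c" and Gc: "\<And>w. w \<in> ?G \<Longrightarrow> w * c \<in> ideal_gen (insert ?v ?S)"
        using c unfolding link_num_def gens by blast+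
      obtain r where r: "?u * c - r * ?v \<in> ideal_gen ?S"
        using Gc[OF uG(1)] unfolding mem_ideal_gen_insert by blast
      have "hom_part (Suc i) (?u * c - ?v * r) \<in> ideal_gen ?S"
        using r by (intro hom_part_in_ideal rees_gens_form) (simp_all add: mult.commute)
      then have b: "?u * c - ?v * hom_part (Suc i) r \<in> ideal_gen ?S"
        by (simp only: hom_part_diff hom_part_pconst_mult hom_part_lin_form_mult hom_part_form[OF fc])
      have "hom_part (Suc i) r \<in> link_num (Suc i)"
        unfolding link_num_def gens using exchange_colon[OF v b Gc] form_hom_part by blast
      moreover have "?v * hom_part (Suc i) r - ?u * c \<in> ideal_gen ?S"
        using ideals.span_neg[OF b] by simp
      ultimately have "(hom_part (Suc i) r, c) \<in> L" by (rule LI[OF _ c])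
      then show ?thesis ..
    qed
    show "b \<in> rees (m + 1 - Suc i) (Suc i) \<longleftrightarrow> c \<in> rees (m + 1 - i) i" if "(b, c) \<in> L" for b c
      unfolding gens
      using exchange_mem[OF u LD(3)[OF that]] exchange_mem[OF v swap[OF LD(3)[OF that]]] by blast
    show "(a + b, a' + b') \<in> L" "(a - b, a' - b') \<in> L" if L: "(a, a') \<in> L" "(b, b') \<in> L" for a a' b b'
      using ideals.span_add[OF LD(3)[OF L(1)] LD(3)[OF L(2)]]
        ideals.span_diff[OF LD(3)[OF L(1)] LD(3)[OF L(2)]]
      by (intro LI link_num_closed LD(1,2)[OF L(1)] LD(1,2)[OF L(2)]; simp add: algebra_simps)+
    show "(pconst r * a, pconst r * a') \<in> L" if L: "(a, a') \<in> L" for r a a'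
      using ideals.span_scale[OF LD(3)[OF L], of "pconst r"]
      by (intro LI link_num_closed(3)[OF LD(1)[OF L] LD(1)[OF L]] link_num_closed(3)[OF LD(2)[OF L] LD(2)[OF L]])
        (simp add: algebra_simps)
  qed (use LD in blast)+
  then show ?thesis ..
qed

lemma link_chain:
  assumes "i \<le> m"
  shows "\<exists>L. corresponding pmult pmult (link_num i) (rees (m + 1 - i) i) (link_num 0) (rees (m + 1) 0) L"
  using assms
proof (induction i)
  case 0
  have "corresponding pmult pmult (link_num 0) (rees (m + 1) 0) (link_num 0) (rees (m + 1) 0)
      ((\<lambda>b. (b, b)) ` link_num 0)"
    by unfold_locales (use link_num_closed[of _ 0] in \<open>auto simp: image_iff\<close>)
  then show ?case by auto
next
  case (Suc i)
  then obtain L where "corresponding pmult pmult (link_num i) (rees (m + 1 - i) i) (link_num 0) (rees (m + 1) 0) L"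
    by auto
  moreover obtain L' where "corresponding pmult pmult (link_num (Suc i)) (rees (m + 1 - Suc i) (Suc i))
      (link_num i) (rees (m + 1 - i) i) L'"
    using link_step[OF Suc.prems] ..
  ultimately show ?case using corresponding_trans by blast
qed

definition entry_colon :: "'a set"
  where "entry_colon = {r. \<forall>i\<in>{1..m}. \<forall>j\<in>{1..m + 1}. r * M i j \<in> ideal_gen (X ` {1..m + 1})}"

lemma pconst_mem_rees: "pconst r \<in> rees (m + 1) 0 \<longleftrightarrow> r \<in> ideal_gen (X ` {1..m + 1})"
proof
  assume "pconst r \<in> rees (m + 1) 0"
  then have "lookup (pconst r) 0 \<in> ideal_gen (X ` {1..m + 1})"
    unfolding rees_0_eq coeffs_in_def mem_Collect_eq by (metis inf_bot_left keys_zero)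
  then show "r \<in> ideal_gen (X ` {1..m + 1})" by (simp add: pconst_def)
qed (rule pconst_in_rees)

text \<open>For a constant, multiplication by a linear form is tested on coefficients, and those are
  the entries of \<open>M\<close>. The other generators of \<open>V\<close> already lie in the ideal
  of all parameters and surplus variables.\<close>

lemma pconst_link_num: "pconst r \<in> link_num 0 \<longleftrightarrow> r \<in> entry_colon"
proof
  assume r: "pconst r \<in> link_num 0"
  show "r \<in> entry_colon" unfolding entry_colon_def
  proof (intro CollectI ballI)
    fix i j assume i: "i \<in> {1..m}" and j: "j \<in> {1..m + 1}"
    have "lin i \<in> rees_gens m X M (m + 1) m" unfolding rees_gens_def using i by blast
    then have "lin i * pconst r \<in> rees (m + 1 - 0) 0" using r unfolding link_num_def by blast
    then have "pconst r * lin i \<in> rees (m + 1) 0" by (simp add: mult.commute)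
    moreover have "keys (single j (1::nat)) \<inter> - {1..m + 1} = {}" using j by simp
    ultimately have "lookup (pconst r * lin i) (single j 1) \<in> ideal_gen (X ` {1..m + 1})"
      unfolding rees_0_eq coeffs_in_def by blast
    then show "r * M i j \<in> ideal_gen (X ` {1..m + 1})"
      unfolding lookup_pconst_mult lookup_lin_form[OF j] .
  qed
next
  assume r: "r \<in> entry_colon"
  have "v * pconst r \<in> rees (m + 1) 0" if "v \<in> rees_gens m X M (m + 1) m" for v
  proof -
    from that have "v \<in> pconst ` X ` {1..m + 1} \<union> lin ` {1..m} \<union> pvar ` (- {1..m + 1})"
      unfolding rees_gens_def .
    then show ?thesis
    proof (elim UnE imageE)
      fix b i assume "v = pconst b" "b = X i" "i \<in> {1..m + 1}"
      then have "v \<in> rees_gens m X M (m + 1) 0" unfolding rees_gens_def by blast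
      from ideals.span_scale[OF ideals.span_base[OF this], of "pconst r"] show ?thesis
        by (simp add: mult.commute)
    next
      fix i assume v: "v = lin i" and i: "i \<in> {1..m}"
      have "pvar j * pconst (r * M i j) \<in> rees (m + 1) 0" if j: "j \<in> {1..m + 1}" for j
      proof -
        have "r * M i j \<in> ideal_gen (X ` {1..m + 1})" using r i j unfolding entry_colon_def by blast
        from ideals.span_scale[OF pconst_in_rees[OF this]] show ?thesis .
      qed
      then have "(\<Sum>j\<in>{1..m + 1}. pvar j * pconst (r * M i j)) \<in> rees (m + 1) 0"
        by (rule ideals.span_sum)
      moreover have "v * pconst r = (\<Sum>j\<in>{1..m + 1}. pvar j * pconst (r * M i j))"
        unfolding v lin_form_def sum_distrib_right by (simp add: pconst.hom_mult mult_ac)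
      ultimately show ?thesis by simp
    next
      fix j assume "v = pvar j" "j \<in> - {1..m + 1}"
      then have "v \<in> rees_gens m X M (m + 1) 0" unfolding rees_gens_def by blast
      from ideals.span_scale[OF ideals.span_base[OF this], of "pconst r"] show ?thesis
        by (simp add: mult.commute)
    qed
  qed
  then show "pconst r \<in> link_num 0" unfolding link_num_def by (simp add: form_pconst)
qed

lemma link_last:
  "\<exists>L. corresponding pmult (*) (link_num 0) (rees (m + 1) 0) entry_colon (ideal_gen (X ` {1..m + 1})) L"
proof -
  define L where "L = (\<lambda>r. (pconst r, r)) ` entry_colon"
  have closed: "a + b \<in> entry_colon" "a - b \<in> entry_colon" "r * a \<in> entry_colon"
    if "a \<in> entry_colon" "b \<in> entry_colon" for a b r
    using that unfolding entry_colon_def mem_Collect_eq distrib_right left_diff_distrib mult.assoc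
    by (blast intro: ideals.span_add ideals.span_diff ideals.span_scale)+
  have "corresponding pmult (*) (link_num 0) (rees (m + 1) 0) entry_colon
      (ideal_gen (X ` {1..m + 1})) L"
  proof
    show "\<exists>r. (b, r) \<in> L" if b: "b \<in> link_num 0" for b
    proof -
      have "b = pconst (peval (\<lambda>r. r) (\<lambda>_. 0) b)"
        using b unfolding link_num_def by (intro form_0_pconst) blast
      then obtain r where r: "b = pconst r" by blast
      then have "r \<in> entry_colon" using b pconst_link_num by simp
      then show ?thesis unfolding L_def r by blast
    qed
    show "(a + b, a' + b') \<in> L" "(a - b, a' - b') \<in> L" if "(a, a') \<in> L" "(b, b') \<in> L" for a a' b b'
      using that closed unfolding L_def
      by (auto simp: image_iff pconst.hom_add[symmetric] pconst.hom_minus[symmetric])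
    show "(pconst r * a, r * a') \<in> L" if "(a, a') \<in> L" for r a a'
      using that closed unfolding L_def by (auto simp: image_iff pconst.hom_mult[symmetric])
    show "a \<in> rees (m + 1) 0 \<longleftrightarrow> a' \<in> ideal_gen (X ` {1..m + 1})" if "(a, a') \<in> L" for a a'
      using that pconst_mem_rees unfolding L_def by blast
  qed (use pconst_link_num in \<open>auto simp: L_def\<close>)
  then show ?thesis ..
qed

end

section \<open>The Rees algebra of the ideal of maximal minors\<close>

text \<open>\<open>d\<close> is the vector of signed maximal minors, extended by zero, and
  \<open>e\<close> holds the signs that compare it with the two blocks of size \<open>m\<close>,
  which omit the last and the first column.\<close>

locale maximal_minors = generic_minors +
  fixes d :: "nat \<Rightarrow> 'a::comm_ring_1" and e :: "nat \<Rightarrow> 'a"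
  assumes m_pos: "m \<ge> 1"
    and d_out: "\<And>j. j \<notin> {1..m + 1} \<Longrightarrow> d j = 0"
    and M_d: "\<And>i. i \<in> {1..m} \<Longrightarrow> (\<Sum>j\<in>{1..m + 1}. M i j * d j) = 0"
    and block_d: "det (block M m 1) = e 1 * d (m + 1)" "det (block M m 2) = e 2 * d 1"
begin

lemma id_hom: "comm_ring_hom (\<lambda>r :: 'a. r)"
  by unfold_locales simp_all

definition at_minors :: "'a pol \<Rightarrow> 'a"
  where "at_minors = peval (\<lambda>r. r) d"

sublocale at_minors: comm_ring_hom at_minors
  unfolding at_minors_def by (rule comm_ring_hom_peval[OF id_hom])

lemma at_minors_pconst: "at_minors (pconst r) = r"
  unfolding at_minors_def by (rule peval_pconst[OF id_hom])

lemma at_minors_pvar: "at_minors (pvar j) = d j"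
  unfolding at_minors_def by (rule peval_pvar[OF id_hom])

lemma at_minors_rees: "g \<in> rees 0 m \<Longrightarrow> at_minors g = 0"
proof -
  have "is_ideal {g. at_minors g = 0}"
    by (rule ideals.subspaceI) (simp_all add: at_minors.hom_add at_minors.hom_mult)
  moreover have "rees_gens m X M 0 m \<subseteq> {g. at_minors g = 0}"
  proof
    fix a assume "a \<in> rees_gens m X M 0 m"
    then have "at_minors a = 0" unfolding rees_gens_def
    proof (elim UnE imageE)
      fix i assume "a = lin i" "i \<in> {1..m}"
      then show ?thesis using M_d[of i]
        by (simp only: lin_form_def at_minors.hom_sum at_minors.hom_mult at_minors_pconst at_minors_pvar)
    next
      fix j assume "a = pvar j" "j \<in> - {1..m + 1}"
      then show ?thesis using d_out[of j] by (simp only: at_minors_pvar) simp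
    qed simp
    then show "a \<in> {g. at_minors g = 0}" by simp
  qed
  ultimately have "rees 0 m \<subseteq> {g. at_minors g = 0}" by (rule ideal_gen_subset)
  then show "g \<in> rees 0 m \<Longrightarrow> at_minors g = 0" by blast
qed

text \<open>Modulo the linear forms, Cramer's rule gives \<open>u * T_j = w_j * T_l\<close>, and the
  same identity for the minors reads \<open>u * d_j = w_j * d_l\<close>. Scaling by \<open>u\<close>
  therefore turns \<open>g\<close> into \<open>T_l ^ n\<close> times the constant
  \<open>g(w)\<close>. From \<open>g(d) = 0\<close> follows \<open>d_l ^ n * g(w) = 0\<close>, and
  so \<open>u ^ n * g(w) = 0\<close> since \<open>u\<close> is a multiple of
  \<open>d_l\<close>.\<close>

lemma kernel_torsion:
  assumes cl: "c \<ge> 1" "c + m \<le> m + 2" "l \<in> {1..m + 1}" "{1..m + 1} - {c..<c + m} = {l}"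
    and u: "det (block M m c) = q * d l" and g: "form n g" "at_minors g = 0"
  shows "\<exists>N. pconst (det (block M m c)) ^ N * g \<in> rees 0 m"
proof -
  interpret coords M m m c by unfold_locales (use cl in auto)
  define w where "w j = (if j \<in> {c..<c + m} then - (\<Sum>i<m. adj_mat A $$ (j - c, i) * M (i + 1) l)
    else if j = l then u else 0)" for j
  have l: "l \<notin> {c..<c + m}" using cl(4) by blast
  have wb: "w (c + b) = - (\<Sum>i<m. adj_mat A $$ (b, i) * M (i + 1) l)" if "b < m" for b
    using that by (simp add: w_def)
  have wl: "w l = u" unfolding w_def using l by (simp only: if_False if_True refl)
  have cases: "(\<exists>b<m. j = c + b) \<or> j = l \<or> (j \<notin> {1..m + 1} \<and> w j = 0)" for j
  proof (cases "j \<in> {c..<c + m}")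
    case True
    then show ?thesis by (intro disjI1 exI[of _ "j - c"]) auto
  next
    case False
    then show ?thesis using cl(4) l unfolding w_def by auto
  qed
  \<comment> \<open>Stated for any homomorphism \<open>h\<close>, as it is used twice: with the
    identity at the minors, and with \<open>pconst\<close> at the variables.\<close>
  have solve: "(\<Sum>i<m. h (adj_mat A $$ (b, i)) * (\<Sum>j\<in>{1..m + 1}. h (M (i + 1) j) * y j)) =
      h u * y (c + b) - h (w (c + b)) * y l"
    if b: "b < m" and h: "comm_ring_hom h" for b and h :: "'a \<Rightarrow> 'b::comm_ring_1" and y
  proof -
    interpret h: comm_ring_hom h by fact
    have "(\<Sum>j\<in>{1..m + 1}. h (M (i + 1) j) * y j) =
        (\<Sum>j<m. h (A $$ (i, j)) * y (c + j)) + h (M (i + 1) l) * y l" if "i < m" for i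
      using sum_block_columns[of c m "m + 1" "\<lambda>j. h (M (i + 1) j) * y j"] cl that
      by (simp add: A_index)
    then have "(\<Sum>i<m. h (adj_mat A $$ (b, i)) * (\<Sum>j\<in>{1..m + 1}. h (M (i + 1) j) * y j)) =
        (\<Sum>i<m. \<Sum>j<m. h (adj_mat A $$ (b, i) * A $$ (i, j)) * y (c + j)) +
        (\<Sum>i<m. h (adj_mat A $$ (b, i) * M (i + 1) l) * y l)"
      by (simp add: distrib_left sum.distrib sum_distrib_left h.hom_mult mult.assoc)
    also have "(\<Sum>i<m. \<Sum>j<m. h (adj_mat A $$ (b, i) * A $$ (i, j)) * y (c + j)) =
        (\<Sum>j<m. h (\<Sum>i<m. adj_mat A $$ (b, i) * A $$ (i, j)) * y (c + j))"
      by (subst sum.swap) (simp add: h.hom_sum sum_distrib_right)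
    also have "\<dots> = (\<Sum>j<m. if j = b then h u * y (c + j) else 0)"
      by (intro sum.cong refl) (simp add: adj_mat_left[OF A_carrier b])
    also have "(\<Sum>i<m. h (adj_mat A $$ (b, i) * M (i + 1) l) * y l) = - (h (w (c + b)) * y l)"
      by (simp add: wb[OF b] h.hom_sum h.hom_uminus sum_distrib_right)
    finally show ?thesis using b by simp
  qed
  have ud: "u * d j = d l * w j" for j
    using cases[of j]
  proof (elim disjE exE conjE)
    fix b assume b: "b < m" "j = c + b"
    have "(\<Sum>i<m. adj_mat A $$ (b, i) * (\<Sum>j\<in>{1..m + 1}. M (i + 1) j * d j)) = 0"
      by (rule sum.neutral) (use M_d[of "_ + 1"] in simp)
    then show ?thesis using solve[OF b(1) id_hom, of d] b by (simp add: mult.commute)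
  next
    assume "j = l" then show ?thesis using wl by (simp add: mult.commute)
  next
    assume "j \<notin> {1..m + 1}" "w j = 0" then show ?thesis using d_out[of j] by simp
  qed
  define \<eta> where "\<eta> = peval pconst (\<lambda>j. pvar l * pconst (w j))"
  interpret \<eta>: comm_ring_hom \<eta> unfolding \<eta>_def by (rule comm_ring_hom_peval[OF pconst_hom])
  interpret ps: comm_ring_hom "pscale u" unfolding pscale_def by (rule comm_ring_hom_peval[OF pconst_hom])
  have cong: "pscale u f - \<eta> f \<in> rees 0 m" for f
  proof (induction f rule: pol_induct)
    case (const r)
    show ?case
      by (simp add: pscale_def \<eta>_def peval_pconst[OF pconst_hom] ideals.span_zero)
  next
    case (var j)
    have eq: "pscale u (pvar j) - \<eta> (pvar j) = pconst u * pvar j - pconst (w j) * pvar l"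
      by (simp add: pscale_def \<eta>_def peval_pvar[OF pconst_hom] mult.commute)
    show ?case unfolding eq using cases[of j]
    proof (elim disjE exE conjE)
      fix b assume b: "b < m" "j = c + b"
      have "lin (i + 1) \<in> rees 0 m" if "i < m" for i
        unfolding rees_gens_def using that by (intro ideals.span_base) auto
      then have "(\<Sum>i<m. pconst (adj_mat A $$ (b, i)) * lin (i + 1)) \<in> rees 0 m"
        by (intro ideals.span_sum ideals.span_scale) simp
      then show "pconst u * pvar j - pconst (w j) * pvar l \<in> rees 0 m"
        using solve[OF b(1) pconst_hom, of pvar] b by (simp add: lin_form_def)
    next
      assume "j = l"
      then show "pconst u * pvar j - pconst (w j) * pvar l \<in> rees 0 m"
        using wl by (simp add: ideals.span_zero)
    next
      assume "j \<notin> {1..m + 1}" and w: "w j = 0"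
      then have "pvar j \<in> rees_gens m X M 0 m" unfolding rees_gens_def by blast
      from ideals.span_scale[OF ideals.span_base[OF this]]
      show "pconst u * pvar j - pconst (w j) * pvar l \<in> rees 0 m" using w by simp
    qed
  next
    case (add f f')
    from ideals.span_add[OF add] show ?case by (simp add: ps.hom_add \<eta>.hom_add algebra_simps)
  next
    case (mult f f')
    have "pscale u f' * (pscale u f - \<eta> f) + \<eta> f * (pscale u f' - \<eta> f') \<in> rees 0 m"
      by (intro ideals.span_add ideals.span_scale mult)
    then show ?case by (simp add: ps.hom_mult \<eta>.hom_mult algebra_simps)
  qed
  let ?a = "peval (\<lambda>r. r) w g"
  have "peval (\<lambda>r. r) (\<lambda>j. u * d j) g = 0"
    using peval_scaled_form[OF id_hom g(1), of u d] g(2) by (simp add: at_minors_def)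
  then have "d l ^ n * ?a = 0"
    unfolding ud by (simp add: peval_scaled_form[OF id_hom g(1)])
  then have ua: "u ^ n * ?a = 0" by (simp add: u power_mult_distrib mult.assoc)
  have "peval pconst (\<lambda>j. pconst (w j)) g = pconst ?a"
  proof (rule hom_eqI[of "peval pconst (\<lambda>j. pconst (w j))" "\<lambda>g. pconst (peval (\<lambda>r. r) w g)"])
    show "comm_ring_hom (\<lambda>g. pconst (peval (\<lambda>r. r) w g))"
      by (rule hom_compose[OF pconst_hom comm_ring_hom_peval[OF id_hom]])
  qed (simp_all add: comm_ring_hom_peval pconst_hom peval_pconst peval_pvar id_hom)
  then have "\<eta> g = pvar l ^ n * pconst ?a"
    unfolding \<eta>_def by (simp add: peval_scaled_form[OF pconst_hom g(1)])
  then have "pconst (u ^ n) * \<eta> g = pvar l ^ n * pconst (u ^ n * ?a)"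
    by (simp only: pconst.hom_mult mult_ac)
  then have "pconst (u ^ n) * \<eta> g = 0" unfolding ua by simp
  moreover have "pconst (u ^ n) * (pscale u g - \<eta> g) \<in> rees 0 m"
    by (intro ideals.span_scale cong)
  moreover have "pscale u (pconst (u ^ n) * g) = pconst (u ^ n) * pscale u g"
    by (simp add: ps.hom_mult) (simp add: pscale_def peval_pconst[OF pconst_hom])
  ultimately have "pscale u (pconst (u ^ n) * g) \<in> rees 0 m" by (simp add: right_diff_distrib)
  then have "\<exists>N. pconst u ^ N * (pconst (u ^ n) * g) \<in> rees 0 m"
    by (intro pscale_torsion rees_gens_form)
  then obtain N where "pconst u ^ N * (pconst (u ^ n) * g) \<in> rees 0 m" ..
  then have "pconst u ^ (N + n) * g \<in> rees 0 m"
    by (simp add: pconst.hom_power power_add mult.assoc)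
  then show ?thesis ..
qed

text \<open>There are just two blocks of size \<open>m\<close> with consecutive columns, and
  \<open>kernel_torsion\<close> applies to both; \<open>descent\<close> removes the powers of their
  determinants.\<close>

lemma kernel:
  assumes g: "form n g" "at_minors g = 0"
  shows "g \<in> rees 0 m"
proof (rule descent[of 0 m m])
  show "regular_mod (rees 0 j) (lin (Suc j))" if "j < m" for j
    using that by (intro lin_regular) simp_all
  fix c assume "c \<in> {1..m + 2 - m}"
  then consider "c = 1" | "c = 2" by fastforce
  then show "\<exists>N. pconst (det (block M m c)) ^ N * g \<in> rees 0 m"
  proof cases
    case 1
    have "{1..m + 1} - {1..<1 + m} = {m + 1}" by auto
    then show ?thesis using kernel_torsion[of 1 "m + 1" "e 1" n g] block_d g 1 by simp
  next
    case 2
    have "{1..m + 1} - {2..<2 + m} = {1}" using m_pos by auto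
    then show ?thesis using kernel_torsion[of 2 1 "e 2" n g] block_d g 2 by simp
  qed
qed simp_all

text \<open>This set is the \<open>m\<close>-th power of the ideal of minors, as
  \<open>power_forms_eq\<close> shows later; the values of forms are the shape in which
  \<open>kernel\<close> can be applied.\<close>

definition power_forms :: "'a set"
  where "power_forms = {at_minors g | g. form m g}"

definition param_colon :: "'a set"
  where "param_colon = {a. \<forall>k\<in>{1..m + 1}. X k * a \<in> power_forms}"

lemma power_forms_closed:
  assumes "a \<in> power_forms" "b \<in> power_forms"
  shows "a + b \<in> power_forms" "a - b \<in> power_forms" "r * a \<in> power_forms"
proof -
  obtain f g where fg: "form m f" "form m g" "a = at_minors f" "b = at_minors g"
    using assms unfolding power_forms_def by blast
  show "a + b \<in> power_forms"
    unfolding power_forms_def using fg form_add by (auto intro!: exI[of _ "f + g"] simp: at_minors.hom_add)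
  show "a - b \<in> power_forms"
    unfolding power_forms_def using fg form_diff by (auto intro!: exI[of _ "f - g"] simp: at_minors.hom_minus)
  show "r * a \<in> power_forms"
    unfolding power_forms_def using fg form_pconst_mult
    by (auto intro!: exI[of _ "pconst r * f"] simp: at_minors.hom_mult at_minors_pconst)
qed

lemma param_colon_closed:
  assumes "a \<in> param_colon" "b \<in> param_colon"
  shows "a + b \<in> param_colon" "a - b \<in> param_colon" "r * a \<in> param_colon"
  using assms unfolding param_colon_def mem_Collect_eq distrib_left right_diff_distrib mult.left_commute[of _ r]
  by (blast intro: power_forms_closed)+

lemma rees_1_eq: "rees 1 m = ideal_gen (insert (pconst (X 1)) (rees_gens m X M 0 m))"
  using rees_gens_Suc_left[of m X M 0 m] by simp

lemma rees_1_hom_part: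
  assumes "form m b" "b' = pconst r * b" "b' \<in> rees 1 m"
  obtains h where "form m h" "at_minors b' = X 1 * at_minors h"
proof -
  obtain t where t: "b' - t * pconst (X 1) \<in> rees 0 m"
    using assms(3) unfolding rees_1_eq mem_ideal_gen_insert by blast
  have b': "form m b'" unfolding assms(2) by (rule form_pconst_mult[OF assms(1)])
  have "hom_part m (b' - pconst (X 1) * t) \<in> rees 0 m"
    using t by (intro hom_part_in_ideal rees_gens_form) (simp_all add: mult.commute)
  then have "b' - pconst (X 1) * hom_part m t \<in> rees 0 m"
    by (simp only: hom_part_diff hom_part_pconst_mult hom_part_form[OF b'])
  from at_minors_rees[OF this] have "at_minors b' = X 1 * at_minors (hom_part m t)"
    by (simp add: at_minors.hom_minus at_minors.hom_mult at_minors_pconst)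
  then show thesis using that form_hom_part by blast
qed

lemma X1_cancel: "X 1 * a = X 1 * b \<Longrightarrow> a = b"
  using X_regular[of 0] by (auto simp: regular_mod_def right_diff_distrib dest!: spec[of _ "a - b"])

text \<open>If \<open>X k * a = g_k(d)\<close> for all \<open>k\<close>, then \<open>a\<close>
  corresponds to \<open>g_1\<close>: the form \<open>X k * g_1 - X 1 * g_k\<close> vanishes at the
  minors and lies in the ideal of the linear forms by \<open>kernel\<close>. Conversely, for
  \<open>b\<close> in the colon ideal, \<open>X 2 * b(d)\<close> is a multiple of
  \<open>X 1\<close>; as \<open>X 2\<close> is regular modulo \<open>X 1\<close>, so is
  \<open>b(d)\<close>, and the quotient is \<open>a\<close>.\<close>

lemma link_first:
  "\<exists>L. corresponding (*) pmult param_colon power_forms (link_num m) (rees 1 m) L"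
proof -
  let ?G = "rees_gens m X M (m + 1) m"
  define L where "L = {(a, b). a \<in> param_colon \<and> b \<in> link_num m \<and> X 1 * a = at_minors b}"
  have "corresponding (*) pmult param_colon power_forms (link_num m) (rees 1 m) L"
  proof
    show "\<exists>b. (a, b) \<in> L" if a: "a \<in> param_colon" for a
    proof -
      from a have "\<forall>k\<in>{1..m + 1}. \<exists>g. form m g \<and> X k * a = at_minors g"
        unfolding param_colon_def power_forms_def by blast
      from bchoice[OF this] obtain g where
        g: "\<And>k. k \<in> {1..m + 1} \<Longrightarrow> form m (g k)" "\<And>k. k \<in> {1..m + 1} \<Longrightarrow> X k * a = at_minors (g k)"
        by blast
      have 1: "1 \<in> {1..m + 1}" by simp
      have "v * g 1 \<in> rees 1 m" if "v \<in> ?G" for v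
      proof -
        from that have "v \<in> pconst ` X ` {1..m + 1} \<union> lin ` {1..m} \<union> pvar ` (- {1..m + 1})"
          unfolding rees_gens_def .
        then show ?thesis
        proof (elim UnE imageE)
          fix b k assume v: "v = pconst b" "b = X k" and k: "k \<in> {1..m + 1}"
          have "form m (pconst (X k) * g 1 - pconst (X 1) * g k)"
            by (intro form_diff form_pconst_mult g 1 k)
          moreover have "at_minors (pconst (X k) * g 1 - pconst (X 1) * g k) = 0"
            unfolding at_minors.hom_minus at_minors.hom_mult at_minors_pconst g(2)[OF 1, symmetric] g(2)[OF k, symmetric]
            by (simp add: mult.left_commute)
          ultimately have "pconst (X k) * g 1 - g k * pconst (X 1) \<in> rees 0 m"
            using kernel by (simp add: mult.commute)
          then show ?thesis unfolding v rees_1_eq mem_ideal_gen_insert by blast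
        next
          fix i assume "v = lin i" "i \<in> {1..m}"
          then have "v \<in> rees_gens m X M 1 m" unfolding rees_gens_def by blast
          from ideals.span_scale[OF ideals.span_base[OF this], of "g 1"] show ?thesis by (simp add: mult.commute)
        next
          fix j assume "v = pvar j" "j \<in> - {1..m + 1}"
          then have "v \<in> rees_gens m X M 1 m" unfolding rees_gens_def by blast
          from ideals.span_scale[OF ideals.span_base[OF this], of "g 1"] show ?thesis by (simp add: mult.commute)
        qed
      qed
      moreover have "m + 1 - m = 1" by simp
      ultimately have "g 1 \<in> link_num m" unfolding link_num_def using g(1)[OF 1] by (simp only:) blast
      then show ?thesis unfolding L_def using a g(2)[OF 1] by blast
    qed
    show "\<exists>a. (a, b) \<in> L" if b: "b \<in> link_num m" for b
    proof -
      from b have fb: "form m b" and Gb: "\<And>v. v \<in> ?G \<Longrightarrow> v * b \<in> rees 1 m"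
        unfolding link_num_def by simp_all
      have XG: "pconst (X k) \<in> ?G" if "k \<in> {1..m + 1}" for k
        unfolding rees_gens_def using that by blast
      have 2: "2 \<in> {1..m + 1}" using m_pos by simp
      obtain h where h: "at_minors (pconst (X 2) * b) = X 1 * at_minors h"
        using rees_1_hom_part[OF fb refl Gb[OF XG[OF 2]]] by blast
      have "X 2 * at_minors b = at_minors h * X 1"
        using h by (simp add: at_minors.hom_mult at_minors_pconst mult.commute)
      then have "X 2 * at_minors b \<in> ideal_gen (X ` {1..1})"
        by (simp add: mem_ideal_gen_insert) (metis eq_iff_diff_eq_0)
      then have "at_minors b \<in> ideal_gen (X ` {1..1})"
        using regular_modD[OF X_regular[OF m_pos]] by (simp add: numeral_2_eq_2)
      then obtain a where a: "X 1 * a = at_minors b"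
        by (auto simp: mem_ideal_gen_insert mult.commute)
      have "X k * a \<in> power_forms" if k: "k \<in> {1..m + 1}" for k
      proof -
        obtain h where h: "form m h" "at_minors (pconst (X k) * b) = X 1 * at_minors h"
          using rees_1_hom_part[OF fb refl Gb[OF XG[OF k]]] by blast
        have "X 1 * (X k * a) = X k * (X 1 * a)" by (simp only: mult.left_commute)
        then have "X 1 * (X k * a) = X 1 * at_minors h"
          using h(2) unfolding a at_minors.hom_mult at_minors_pconst by (rule trans)
        then have "X k * a = at_minors h" by (rule X1_cancel)
        then show ?thesis unfolding power_forms_def using h(1) by blast
      qed
      then have "a \<in> param_colon" unfolding param_colon_def by blast
      then show ?thesis unfolding L_def using a b by blast
    qed
    show "a \<in> power_forms \<longleftrightarrow> b \<in> rees 1 m" if ab: "(a, b) \<in> L" for a b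
    proof
      assume "a \<in> power_forms"
      then obtain h where h: "form m h" "a = at_minors h" unfolding power_forms_def by blast
      have "form m (b - pconst (X 1) * h)"
        using ab h unfolding L_def link_num_def by (auto intro: form_diff form_pconst_mult)
      moreover have "at_minors (b - pconst (X 1) * h) = 0"
        using ab h unfolding L_def by (simp add: at_minors.hom_minus at_minors.hom_mult at_minors_pconst)
      ultimately have "b - h * pconst (X 1) \<in> rees 0 m" using kernel by (simp add: mult.commute)
      then show "b \<in> rees 1 m" unfolding rees_1_eq mem_ideal_gen_insert by blast
    next
      assume b: "b \<in> rees 1 m"
      have "form m b" using ab unfolding L_def link_num_def by blast
      then obtain h where "form m h" "at_minors b = X 1 * at_minors h"
        using rees_1_hom_part[of b b 1] b by auto
      then show "a \<in> power_forms"
        using ab X1_cancel unfolding L_def power_forms_def by auto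
    qed
    show "(a + b, a' + b') \<in> L" "(a - b, a' - b') \<in> L" if "(a, a') \<in> L" "(b, b') \<in> L" for a a' b b'
      using that unfolding L_def
      by (simp_all add: param_colon_closed link_num_closed at_minors.hom_add at_minors.hom_minus
        distrib_left right_diff_distrib)
    show "(r * a, pconst r * a') \<in> L" if "(a, a') \<in> L" for r a a'
      using that param_colon_closed(3)[of a a r] link_num_closed(3)[of a' m a' r] unfolding L_def
      by (simp add: at_minors.hom_mult at_minors_pconst mult.left_commute[of _ r])
  qed (auto simp: L_def)
  then show ?thesis ..
qed

theorem colon_correspondence:
  "\<exists>L. corresponding (*) (*) param_colon power_forms entry_colon (ideal_gen (X ` {1..m + 1})) L"
proof -
  obtain L1 L2 L3 where L: "corresponding (*) pmult param_colon power_forms (link_num m) (rees 1 m) L1"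
    "corresponding pmult pmult (link_num m) (rees (m + 1 - m) m) (link_num 0) (rees (m + 1) 0) L2"
    "corresponding pmult (*) (link_num 0) (rees (m + 1) 0) entry_colon (ideal_gen (X ` {1..m + 1})) L3"
    using link_first link_chain[OF order_refl] link_last by blast
  have "corresponding pmult pmult (link_num m) (rees 1 m) (link_num 0) (rees (m + 1) 0) L2"
    using L(2) by simp
  from corresponding_trans[OF L(1) this] have
    "corresponding (*) pmult param_colon power_forms (link_num 0) (rees (m + 1) 0) (L1 O L2)" .
  from corresponding_trans[OF this L(3)] show ?thesis by blast
qed

end

section \<open>The matrix of powers of parameters\<close>

lemma radical_ideal:
  assumes J: "is_ideal J"
  shows "is_ideal (radical J)"
proof (rule ideals.subspaceI)
  show "0 \<in> radical J"
    unfolding radical_def using ideals.subspace_0[OF J] by (auto intro!: exI[of _ 1])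
  show "r * a \<in> radical J" if "a \<in> radical J" for r a
    using that ideal_mult_left[OF J] unfolding radical_def by (auto simp: power_mult_distrib)
  show "a + b \<in> radical J" if "a \<in> radical J" "b \<in> radical J" for a b
  proof -
    obtain n k where n: "a ^ n \<in> J" and k: "b ^ k \<in> J"
      using \<open>a \<in> radical J\<close> \<open>b \<in> radical J\<close> unfolding radical_def by blast
    have "of_nat ((n + k) choose i) * a ^ i * b ^ (n + k - i) \<in> J" for i
    proof (cases "n \<le> i")
      case True
      then have "a ^ i = a ^ (i - n) * a ^ n" by (simp add: power_add[symmetric])
      then show ?thesis using n
        by (simp add: ideal_mult_left[OF J] ideal_mult_right[OF J] mult.assoc)
    next
      case False
      then have "b ^ (n + k - i) = b ^ (n - i) * b ^ k" by (simp add: power_add[symmetric])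
      then show ?thesis using k by (simp add: ideal_mult_left[OF J])
    qed
    then have "(a + b) ^ (n + k) \<in> J"
      unfolding binomial_ring by (intro ideals.subspace_sum[OF J])
    then show ?thesis unfolding radical_def by blast
  qed
qed

lemma radical_power: "a ^ n \<in> radical J \<Longrightarrow> a \<in> radical J"
  unfolding radical_def by (auto simp: power_mult[symmetric])

lemma radical_subset_radical:
  assumes J: "is_ideal J" and S: "S \<subseteq> radical J"
  shows "radical (ideal_gen S) \<subseteq> radical J"
proof
  fix r assume "r \<in> radical (ideal_gen S)"
  then obtain n where "r ^ n \<in> ideal_gen S" unfolding radical_def by blast
  then have "r ^ n \<in> radical J" using ideal_gen_subset[OF radical_ideal[OF J] S] by blast
  then show "r \<in> radical J" by (rule radical_power)
qed

lemma ideal_prod_mem: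
  assumes J: "is_ideal J" and "finite S" "i \<in> S" "f i \<in> J"
  shows "prod f S \<in> J"
  using ideal_mult_right[OF J assms(4)] prod.remove[OF assms(2,3), of f] by simp

lemma det_in_ideal:
  fixes A :: "'a::comm_ring_1 mat"
  assumes A: "A \<in> carrier_mat t t" "t > 0" and J: "is_ideal J"
    and entries: "\<And>i j. i < t \<Longrightarrow> j < t \<Longrightarrow> A $$ (i, j) \<in> J"
  shows "det A \<in> J"
  unfolding det_def'[OF A(1)]
proof (rule ideals.subspace_sum[OF J])
  fix p assume "p \<in> {p. p permutes {0..<t}}"
  then have "p 0 < t" using A(2) permutes_in_image[of p "{0..<t}" 0] by simp
  then have "(\<Prod>i = 0..<t. A $$ (i, p i)) \<in> J"
    by (intro ideal_prod_mem[OF J, of _ 0]) (use A(2) entries in auto)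
  then show "signof p * (\<Prod>i = 0..<t. A $$ (i, p i)) \<in> J" by (rule ideal_mult_left[OF J])
qed

definition reversal :: "nat \<Rightarrow> nat \<Rightarrow> nat"
  where "reversal t i = (if i < t then t - 1 - i else i)"

lemma reversal_permutes: "reversal t permutes {0..<t}"
proof (rule bij_imp_permutes)
  show "bij_betw (reversal t) {0..<t} {0..<t}"
    by (rule bij_betw_byWitness[where f' = "reversal t"]) (auto simp: reversal_def)
qed (simp add: reversal_def)

text \<open>Both permutations have the same sum of values, while \<open>p i\<close> is at most the
  reversed value at every place.\<close>

lemma permutes_eq_reversal:
  assumes p: "p permutes {0..<t}" and le: "\<And>i. i < t \<Longrightarrow> i + p i < t"
  shows "p = reversal t"
proof
  fix i
  have "(\<Sum>i\<in>{0..<t}. p i) = (\<Sum>i\<in>{0..<t}. i)"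
    using sum.permute[OF p, of "\<lambda>i. i"] by (simp add: comp_def)
  moreover have "(\<Sum>i\<in>{0..<t}. reversal t i) = (\<Sum>i\<in>{0..<t}. i)"
    using sum.permute[OF reversal_permutes, of "\<lambda>i. i" t] by (simp add: comp_def)
  ultimately have eq: "(\<Sum>i\<in>{0..<t}. reversal t i) = (\<Sum>i\<in>{0..<t}. p i)" by simp
  have le': "p i \<le> reversal t i" if "i < t" for i
    using le[OF that] that by (simp add: reversal_def)
  show "p i = reversal t i"
  proof (cases "i < t")
    case True
    show ?thesis
    proof (rule ccontr)
      assume "p i \<noteq> reversal t i"
      then have "p i < reversal t i" using le'[OF True] by simp
      then have "(\<Sum>i\<in>{0..<t}. p i) < (\<Sum>i\<in>{0..<t}. reversal t i)"
        by (intro sum_strict_mono_ex1) (use True le' in auto)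
      then show False using eq by simp
    qed
  next
    case False
    then show ?thesis using permutes_not_in[OF p, of i] by (simp add: reversal_def)
  qed
qed

text \<open>In the Leibniz formula every permutation other than the reversal picks an entry below
  the antidiagonal, so modulo \<open>J\<close> the determinant is the antidiagonal product up to a
  sign.\<close>

lemma antitriangular_prod_in_ideal:
  fixes A :: "'a::comm_ring_1 mat"
  assumes A: "A \<in> carrier_mat t t" and J: "is_ideal J" and det: "det A \<in> J"
    and entries: "\<And>i j. i < t \<Longrightarrow> j < t \<Longrightarrow> t \<le> i + j \<Longrightarrow> A $$ (i, j) \<in> J"
  shows "(\<Prod>i = 0..<t. A $$ (i, t - 1 - i)) \<in> J"
proof -
  let ?P = "{p. p permutes {0..<t}}" and ?r = "reversal t"
  let ?f = "\<lambda>p. signof p * (\<Prod>i = 0..<t. A $$ (i, p i))"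
  have other: "?f p \<in> J" if p: "p \<in> ?P - {?r}" for p
  proof -
    have pp: "p permutes {0..<t}" using p by simp
    obtain i where i: "i < t" "t \<le> i + p i"
      using permutes_eq_reversal[OF pp] p by (metis DiffD2 not_le singletonI)
    have "p i < t" using permutes_in_image[OF pp, of i] i(1) by simp
    then have "(\<Prod>i = 0..<t. A $$ (i, p i)) \<in> J"
      by (intro ideal_prod_mem[OF J, of _ i]) (use i entries in auto)
    then show ?thesis by (rule ideal_mult_left[OF J])
  qed
  have "det A = ?f ?r + (\<Sum>p\<in>?P - {?r}. ?f p)"
    unfolding det_def'[OF A]
    by (rule sum.remove) (use reversal_permutes finite_permutations in auto)
  moreover have "(\<Sum>p\<in>?P - {?r}. ?f p) \<in> J"
    by (rule ideals.subspace_sum[OF J other])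
  ultimately have "?f ?r \<in> J" using ideals.subspace_diff[OF J det] by fastforce
  then have "signof ?r * ?f ?r \<in> J" by (rule ideal_mult_left[OF J])
  moreover have "signof ?r * ?f ?r = (\<Prod>i = 0..<t. A $$ (i, ?r i))"
    by (simp add: mult.assoc[symmetric] sign_def)
  moreover have "(\<Prod>i = 0..<t. A $$ (i, ?r i)) = (\<Prod>i = 0..<t. A $$ (i, t - 1 - i))"
    by (rule prod.cong) (auto simp: reversal_def)
  ultimately show ?thesis by simp
qed

text \<open>Modulo all the elements the bound is \<open>0\<close>; they are taken out of the ideal
  one by one, the last first, and each belongs to the family itself, so \<open>grade_ge_lift\<close>
  gains one each time.\<close>

lemma grade_ge_regular_sequence:
  assumes reg: "\<And>i. i < n \<Longrightarrow> regular_mod (ideal_gen (z ` {1..i})) (z (Suc i))"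
  shows "grade_ge 1 z {1..n} (ideal_gen {}) n"
proof -
  have "grade_ge 1 z {1..n} (ideal_gen (z ` {1..n - i})) i" if "i \<le> n" for i
    using that
  proof (induction i)
    case 0
    show ?case by (simp add: grade_ge_def)
  next
    case (Suc i)
    define j where "j = n - Suc i"
    have j: "n - i = Suc j" "Suc j \<in> {1..n}" "j < n" using Suc.prems by (auto simp: j_def)
    have "grade_ge 1 z {1..n} (ideal_gen (insert (z (Suc j)) (z ` {1..j}))) i"
      using Suc j by (simp add: atLeastAtMostSuc_conv)
    from grade_ge_lift[OF this reg[OF j(3)] j(2) refl] show ?case by (simp add: j_def)
  qed
  from this[of n] show ?thesis by simp
qed

lemma image_Suc_lessThan_eq: "(\<lambda>i. f (Suc i)) ` {..<n} = f ` {1..n}"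
proof -
  have "(\<lambda>i. f (Suc i)) ` {..<n} = f ` Suc ` {..<n}" by (simp only: image_image)
  also have "Suc ` {..<n} = {1..n}"
    by (simp add: lessThan_atLeast0 image_Suc_atLeastLessThan atLeastLessThanSuc_atLeastAtMost)
  finally show ?thesis .
qed

section \<open>Grades of the block determinants and regularity of powers of the parameters\<close>

locale parameters =
  fixes m :: nat and \<mm> :: "'a::comm_ring_1 set" and x :: "nat \<Rightarrow> 'a" and \<alpha> :: "nat \<Rightarrow> nat \<Rightarrow> nat"
  assumes m_ge_1: "m \<ge> 1" and CM: "cohen_macaulay_local \<mm>"
    and dim: "krull_dim TYPE('a) = enat (m + 1)"
    and sop: "system_of_parameters \<mm> (map x [1..<m + 2])"
    and \<alpha>_pos: "\<And>i j. i \<in> {1..m} \<Longrightarrow> j \<in> {1..m + 1} \<Longrightarrow> \<alpha> i j > 0"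
begin

abbreviation M :: "nat \<Rightarrow> nat \<Rightarrow> 'a" where "M \<equiv> param_entry m x \<alpha>"

lemma set_parameters: "set (map x [1..<m + 2]) = x ` {1..m + 1}"
  unfolding set_map set_upt by (rule arg_cong[where f = "(`) x"]) auto

lemma parameters_mem: "k \<in> {1..m + 1} \<Longrightarrow> x k \<in> \<mm>"
  using sop unfolding system_of_parameters_def set_parameters by blast

lemma radical_parameters: "radical (ideal_gen (x ` {1..m + 1})) = \<mm>"
  using sop unfolding system_of_parameters_def set_parameters by blast

lemma ideal_\<mm>: "is_ideal \<mm>"
  using radical_ideal[OF is_ideal_gen, of "x ` {1..m + 1}"] unfolding radical_parameters .

lemma sop_criterion:
  assumes "is_ideal J" "\<And>k. k \<in> {1..m + 1} \<Longrightarrow> x k \<in> radical J"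
  shows "\<mm> \<subseteq> radical J"
  using radical_subset_radical[OF assms(1), of "x ` {1..m + 1}"] assms(2)
  unfolding radical_parameters by blast

lemma power_mem: "is_ideal J \<Longrightarrow> a \<in> J \<Longrightarrow> n > 0 \<Longrightarrow> a ^ n \<in> J"
  using ideal_mult_right[of J a "a ^ (n - 1)"] by (cases n) auto

lemma entry_in_ideal:
  assumes J: "is_ideal J" and ij: "i \<in> {1..m}" "j \<in> {1..m + 1}"
    and x: "x (if i + j \<le> m + 2 then i + j - 1 else i + j - m - 2) \<in> J"
  shows "M i j \<in> J"
  unfolding param_entry_def using power_mem[OF J x \<alpha>_pos[OF ij]] by (simp split: if_splits)

lemma block_carrier: "block M t c \<in> carrier_mat t t"
  by (simp add: block_def)

lemma block_det_mem:
  assumes "1 \<le> t" "t \<le> m" "c \<in> {1..m + 2 - t}"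
  shows "det (block M t c) \<in> \<mm>"
proof (rule det_in_ideal[OF block_carrier _ ideal_\<mm>])
  fix i j assume ij: "i < t" "j < t"
  have "x (if (i + 1) + (c + j) \<le> m + 2 then (i + 1) + (c + j) - 1 else (i + 1) + (c + j) - m - 2) \<in> \<mm>"
    by (rule parameters_mem) (use assms ij in auto)
  then have "M (i + 1) (c + j) \<in> \<mm>"
    by (intro entry_in_ideal[OF ideal_\<mm>]) (use assms ij in auto)
  then show "block M t c $$ (i, j) \<in> \<mm>" using ij by (simp add: block_def)
qed (use assms in simp)

text \<open>Descending induction on \<open>k\<close>. The block with \<open>t + c = k + 1\<close>
  has powers of \<open>x k\<close> on its antidiagonal. Below it stand powers of parameters of
  larger index, already treated, or, where the indices wrap around, of index below \<open>t\<close>.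
  So the radical contains a power of \<open>x k\<close>.\<close>

lemma minors_radical:
  assumes t: "1 \<le> t" "t \<le> m" and J: "is_ideal J"
    and x: "\<And>k. k \<in> {1..<t} \<Longrightarrow> x k \<in> radical J"
    and minors: "\<And>c. c \<in> {1..m + 2 - t} \<Longrightarrow> det (block M t c) \<in> radical J"
    and k: "k \<in> {1..m + 1}"
  shows "x k \<in> radical J"
  using k
proof (induction "m + 1 - k" arbitrary: k rule: less_induct)
  case less
  note rJ = radical_ideal[OF J]
  show ?case
  proof (cases "k < t")
    case True
    then show ?thesis using x less.prems by simp
  next
    case False
    define c where "c = k + 1 - t"
    have c: "c \<in> {1..m + 2 - t}" "t + c = k + 1" using False less.prems t by (auto simp: c_def)
    have "(\<Prod>i = 0..<t. block M t c $$ (i, t - 1 - i)) \<in> radical J"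
    proof (rule antitriangular_prod_in_ideal[OF block_carrier rJ minors[OF c(1)]])
      fix i j assume ij: "i < t" "j < t" "t \<le> i + j"
      have "x (if (i + 1) + (c + j) \<le> m + 2 then (i + 1) + (c + j) - 1 else (i + 1) + (c + j) - m - 2) \<in> radical J"
      proof (cases "(i + 1) + (c + j) \<le> m + 2")
        case True
        then have "x ((i + 1) + (c + j) - 1) \<in> radical J"
          by (intro less.hyps) (use c ij less.prems in auto)
        then show ?thesis using True by simp
      next
        case False
        have "x ((i + 1) + (c + j) - m - 2) \<in> radical J"
          by (rule x) (use False c ij less.prems t in auto)
        then show ?thesis using False by simp
      qed
      then have "M (i + 1) (c + j) \<in> radical J"
        by (intro entry_in_ideal[OF rJ]) (use c ij t in auto)
      then show "block M t c $$ (i, j) \<in> radical J" using ij by (simp add: block_def)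
    qed
    moreover have "block M t c $$ (i, t - 1 - i) = x k ^ \<alpha> (i + 1) (c + (t - 1 - i))" if "i \<in> {0..<t}" for i
    proof -
      have "i + 1 + (c + (t - 1 - i)) = k + 1" using that c(2) by auto
      then show ?thesis using that less.prems by (simp add: block_def param_entry_def)
    qed
    ultimately have "x k ^ (\<Sum>i = 0..<t. \<alpha> (i + 1) (c + (t - 1 - i))) \<in> radical J"
      by (simp add: power_sum)
    then show ?thesis by (rule radical_power)
  qed
qed

lemma minors_regular:
  assumes t: "1 \<le> t" "t \<le> m" and i: "i < m + 2 - t"
  shows "regular_mod (ideal_gen ((\<lambda>c. det (block M t c) ^ Suc N) ` {1..i})) (det (block M t (Suc i)) ^ Suc N)"
proof -
  \<comment> \<open>The parameters \<open>x 1, ..., x (t - 1)\<close> complete the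
    \<open>m + 2 - t\<close> determinant powers to \<open>m + 1\<close> elements; the shift sends
    the index \<open>m + 2 - t\<close> to \<open>x 1\<close>. By \<open>minors_radical\<close> the
    result is a system of parameters.\<close>
  define w where "w i = (if i < m + 2 - t then det (block M t (Suc i)) ^ Suc N else x (i + t - m - 1))" for i
  let ?J = "ideal_gen (w ` {..<m + 1})"
  have J: "is_ideal ?J" by (rule is_ideal_gen)
  have "regular_mod (ideal_gen (w ` {..<i})) (w i)"
  proof (rule cohen_macaulay_regular[OF CM dim])
    show "w i \<in> \<mm>" if "i < m + 1" for i
    proof (cases "i < m + 2 - t")
      case True
      then have "det (block M t (Suc i)) ^ Suc N \<in> \<mm>"
        by (intro power_mem[OF ideal_\<mm>] block_det_mem t) auto
      then show ?thesis using True by (simp add: w_def)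
    next
      case False
      then have "x (i + t - m - 1) \<in> \<mm>" by (intro parameters_mem) (use that t in auto)
      then show ?thesis using False by (simp add: w_def)
    qed
    have mem: "w i \<in> ?J" if "i < m + 1" for i by (rule ideals.span_base) (use that in auto)
    show "\<mm> \<subseteq> radical ?J"
    proof (rule sop_criterion[OF J minors_radical[OF t J]])
      fix k assume k: "k \<in> {1..<t}"
      have "\<not> m + 1 - t + k < m + 2 - t" "m + 1 - t + k + t - m - 1 = k" using k t by auto
      then have "w (m + 1 - t + k) = x k" by (simp only: w_def if_False)
      moreover have "w (m + 1 - t + k) \<in> ?J" by (rule mem) (use k t in auto)
      ultimately have "x k ^ 1 \<in> ?J" by simp
      then show "x k \<in> radical ?J" unfolding radical_def by blast
    next
      fix c assume c: "c \<in> {1..m + 2 - t}"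
      then have "w (c - 1) = det (block M t c) ^ Suc N" using t by (auto simp: w_def)
      moreover have "w (c - 1) \<in> ?J" by (rule mem) (use c t in auto)
      ultimately have "det (block M t c) ^ Suc N \<in> ?J" by simp
      then show "det (block M t c) \<in> radical ?J" unfolding radical_def by blast
    qed
    show "i < m + 1" using i t by simp
  qed
  moreover have "w i = det (block M t (Suc i)) ^ Suc N" using i by (simp add: w_def)
  moreover have "w ` {..<i} = (\<lambda>c. det (block M t c) ^ Suc N) ` {1..i}"
  proof -
    have "w ` {..<i} = (\<lambda>j. det (block M t (Suc j)) ^ Suc N) ` {..<i}"
      by (rule image_cong) (use i in \<open>auto simp: w_def\<close>)
    also have "\<dots> = (\<lambda>c. det (block M t c) ^ Suc N) ` {1..i}" by (rule image_Suc_lessThan_eq)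
    finally show ?thesis .
  qed
  ultimately show ?thesis by simp
qed

lemma powers_regular:
  assumes e: "\<And>k. k \<in> {1..m + 1} \<Longrightarrow> e k > 0" and k: "k \<le> m"
  shows "regular_mod (ideal_gen ((\<lambda>k. x k ^ e k) ` {1..k})) (x (Suc k) ^ e (Suc k))"
proof -
  let ?w = "\<lambda>i. x (Suc i) ^ e (Suc i)"
  let ?J = "ideal_gen (?w ` {..<m + 1})"
  have "regular_mod (ideal_gen (?w ` {..<k})) (?w k)"
  proof (rule cohen_macaulay_regular[OF CM dim])
    show "?w i \<in> \<mm>" if "i < m + 1" for i
      by (rule power_mem[OF ideal_\<mm> parameters_mem e]) (use that in auto)
    show "\<mm> \<subseteq> radical ?J"
    proof (rule sop_criterion[OF is_ideal_gen])
      fix k assume "k \<in> {1..m + 1}"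
      then have "x k ^ e k \<in> ?w ` {..<m + 1}" by (intro image_eqI[of _ _ "k - 1"]) auto
      then have "x k ^ e k \<in> ?J" by (rule ideals.span_base)
      then show "x k \<in> radical ?J" unfolding radical_def by blast
    qed
    show "k < m + 1" using k by simp
  qed
  moreover have "?w ` {..<k} = (\<lambda>k. x k ^ e k) ` {1..k}" by (rule image_Suc_lessThan_eq)
  ultimately show ?thesis by simp
qed

text \<open>The determinants start with grade \<open>m + 2 - t\<close> over the ring, and each of
  the \<open>k\<close> powers of parameters lowers it by at most one. For \<open>k\<close> beyond
  \<open>m + 2 - t\<close> the truncated difference is \<open>0\<close> and the bound is
  void.\<close>

lemma generic_minors_powers:
  assumes e: "\<And>k. k \<in> {1..m + 1} \<Longrightarrow> e k > 0"
  shows "generic_minors m (\<lambda>k. x k ^ e k) M"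
proof
  show "regular_mod (ideal_gen ((\<lambda>k. x k ^ e k) ` {1..k})) (x (Suc k) ^ e (Suc k))" if "k \<le> m" for k
    by (rule powers_regular[OF e that])
  fix t k N assume t: "1 \<le> t" "t \<le> m" and k: "k \<le> m + 1"
  let ?z = "\<lambda>c. det (block M t c) ^ Suc N"
  show "grade_ge 1 ?z {1..m + 2 - t} (ideal_gen ((\<lambda>k. x k ^ e k) ` {1..k})) (m + 2 - t - k)"
  proof (cases "k \<le> m + 2 - t")
    case True
    let ?w = "\<lambda>j. x (Suc j) ^ e (Suc j)"
    have eq: "?w ` {..<j} = (\<lambda>k. x k ^ e k) ` {1..j}" for j by (rule image_Suc_lessThan_eq)
    have "grade_ge 1 ?z {1..m + 2 - t} (ideal_gen {}) (m + 2 - t)"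
      by (rule grade_ge_regular_sequence[OF minors_regular[OF t]])
    then have "grade_ge 1 ?z {1..m + 2 - t} (ideal_gen {}) ((m + 2 - t - k) + k)"
      by (subst le_add_diff_inverse2[OF True])
    then have "grade_ge 1 ?z {1..m + 2 - t} (ideal_gen ({} \<union> ?w ` {..<k})) (m + 2 - t - k)"
    proof (rule grade_ge_cuts)
      fix j assume "j < k"
      then show "regular_mod (ideal_gen ({} \<union> ?w ` {..<j})) (?w j)"
        unfolding eq Un_empty_left using k by (intro powers_regular[OF e]) simp_all
    qed
    then show ?thesis unfolding eq Un_empty_left .
  next
    case False
    then show ?thesis by (simp add: grade_ge_def)
  qed
qed

end

section \<open>The signed maximal minors as cofactors\<close>

lemma mat_delete_eqI:
  assumes "\<And>i' j'. i' < n \<Longrightarrow> j' < n \<Longrightarrow> i' \<noteq> i \<Longrightarrow> A $$ (i', j') = B $$ (i', j')"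
    and "A \<in> carrier_mat n n" "B \<in> carrier_mat n n"
  shows "mat_delete A i j = mat_delete B i j"
  unfolding mat_delete_def using assms by (intro cong_mat) (auto intro!: assms(1))

lemma submatrix_delete_column:
  fixes A :: "'a mat"
  assumes A: "A \<in> carrier_mat m (Suc m)" and j: "j \<le> m"
  shows "submatrix A {..<m} ({..<Suc m} - {j}) = mat m m (\<lambda>(i, k). A $$ (i, if k < j then k else Suc k))"
proof -
  have pick1: "pick {..<m} i = i" if "i < m" for i
  proof -
    have "{a \<in> {..<m}. a < i} = {..<i}" using that by auto
    then show ?thesis using pick_card_in_set[of i "{..<m}"] that by simp
  qed
  have pick2: "pick ({..<Suc m} - {j}) k = (if k < j then k else Suc k)" if k: "k < m" for k
  proof (cases "k < j")
    case True
    then have "{a \<in> {..<Suc m} - {j}. a < k} = {..<k}" using j by auto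
    then show ?thesis using pick_card_in_set[of k "{..<Suc m} - {j}"] True j by simp
  next
    case False
    then have "{a \<in> {..<Suc m} - {j}. a < Suc k} = {..<Suc k} - {j}" using k by auto
    moreover have "card ({..<Suc k} - {j}) = k" using False by simp
    ultimately show ?thesis using pick_card_in_set[of "Suc k" "{..<Suc m} - {j}"] False k by simp
  qed
  have rows: "{i. i < dim_row A \<and> i \<in> {..<m}} = {..<m}" using A by auto
  have cols: "{i. i < dim_col A \<and> i \<in> {..<Suc m} - {j}} = {..<Suc m} - {j}" using A by auto
  have "card ({..<Suc m} - {j}) = m" using j by simp
  then show ?thesis
    unfolding submatrix_def rows cols using pick1 pick2 by (intro cong_mat) auto
qed

context parameters
begin

text \<open>A row of zeros is added below \<^term>\<open>M\<close>, so that the maximal minors of \<^term>\<open>M\<close> are cofactors.\<close>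

definition padded :: "'a mat"
  where "padded = mat (Suc m) (Suc m) (\<lambda>(i, j). if i < m then M (i + 1) (j + 1) else 0)"

definition signed_minor :: "nat \<Rightarrow> 'a"
  where "signed_minor j = (if j \<in> {1..m + 1} then cofactor padded m (j - 1) else 0)"

lemma padded_carrier: "padded \<in> carrier_mat (Suc m) (Suc m)"
  by (simp add: padded_def)

lemma mat_delete_padded:
  assumes "j \<le> m"
  shows "mat_delete padded m j = mat m m (\<lambda>(i, k). M (i + 1) (if k < j then k + 1 else k + 2))"
  unfolding mat_delete_def padded_def using assms by (intro eq_matI) auto

text \<open>With a copy of row \<open>i\<close> in place of the zero row the matrix has two equal
  rows. Its cofactors along the last row are those of \<open>padded\<close>, as that row gets
  deleted.\<close>

lemma row_signed_minors:
  assumes i: "i \<in> {1..m}"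
  shows "(\<Sum>j\<in>{1..m + 1}. M i j * signed_minor j) = 0"
proof -
  let ?B = "mat (Suc m) (Suc m) (\<lambda>(r, j). if r < m then M (r + 1) (j + 1) else M i (j + 1))"
  have B: "?B \<in> carrier_mat (Suc m) (Suc m)" by simp
  have "det ?B = 0"
    by (rule det_identical_rows[OF B, of "i - 1" m]) (use i in \<open>auto intro!: eq_vecI\<close>)
  moreover have "det ?B = (\<Sum>j<Suc m. ?B $$ (m, j) * cofactor ?B m j)"
    by (rule laplace_expansion_row[OF B]) simp
  moreover have "?B $$ (m, j) * cofactor ?B m j = M i (j + 1) * signed_minor (j + 1)" if "j < Suc m" for j
  proof -
    have "mat_delete ?B m j = mat_delete padded m j"
      by (rule mat_delete_eqI[OF _ B padded_carrier]) (auto simp: padded_def)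
    then show ?thesis using that by (simp add: cofactor_def signed_minor_def)
  qed
  ultimately have "(\<Sum>j<Suc m. M i (j + 1) * signed_minor (j + 1)) = 0" by simp
  moreover have "(\<Sum>j\<in>{1..m + 1}. M i j * signed_minor j) = (\<Sum>j<Suc m. M i (j + 1) * signed_minor (j + 1))"
    by (rule sum.reindex_bij_witness[of _ "\<lambda>j. j + 1" "\<lambda>j. j - 1"]) auto
  ultimately show ?thesis by simp
qed

lemma signed_minor_eq:
  assumes "j \<le> m"
  shows "signed_minor (j + 1) = (- 1) ^ (m + j) * det (mat_delete padded m j)"
  using assms by (simp add: signed_minor_def cofactor_def)

lemma signs_cancel: "(- 1) ^ k * ((- 1) ^ k * a) = (a :: 'a)"
  by (simp add: mult.assoc[symmetric] power_mult_distrib[symmetric])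

text \<open>The two signs are those of the cofactors in the last and the first column of
  \<open>padded\<close>, left unevaluated so that \<open>signs_cancel\<close> matches them.\<close>

lemma maximal_minors_powers:
  assumes e: "\<And>k. k \<in> {1..m + 1} \<Longrightarrow> e k > 0"
  shows "maximal_minors m (\<lambda>k. x k ^ e k) M signed_minor (\<lambda>c. if c = 1 then (- 1) ^ (m + m) else (- 1) ^ (m + 0))"
proof -
  interpret generic_minors m "\<lambda>k. x k ^ e k" M by (rule generic_minors_powers[OF e])
  show ?thesis
  proof
    have "block M m 1 = mat_delete padded m m"
      by (subst mat_delete_padded) (auto simp: block_def intro!: cong_mat)
    then show "det (block M m 1) = (if (1::nat) = 1 then (- 1) ^ (m + m) else (- 1) ^ (m + 0)) * signed_minor (m + 1)"
      using signed_minor_eq[of m] signs_cancel by simp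
    have "block M m 2 = mat_delete padded m 0"
      by (subst mat_delete_padded) (auto simp: block_def intro!: cong_mat)
    then show "det (block M m 2) = (if (2::nat) = 1 then (- 1) ^ (m + m) else (- 1) ^ (m + 0)) * signed_minor 1"
      using signed_minor_eq[of 0] signs_cancel by simp
  qed (use m_ge_1 row_signed_minors in \<open>auto simp: signed_minor_def\<close>)
qed

text \<open>A choice of \<open>m\<close> among \<open>m + 1\<close> columns omits exactly one, so
  the minors are the cofactors up to sign.\<close>

lemma ideal_gen_minors: "ideal_gen (minors m (param_matrix m x \<alpha>)) = ideal_gen (signed_minor ` {1..m + 1})"
proof -
  let ?A = "param_matrix m x \<alpha>"
  have A: "?A \<in> carrier_mat m (Suc m)" by (simp add: param_matrix_def)
  have sub: "submatrix ?A {..<m} ({..<Suc m} - {j}) = mat_delete padded m j" if "j \<le> m" for j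
    unfolding submatrix_delete_column[OF A that] mat_delete_padded[OF that]
    by (intro cong_mat) (auto simp: param_matrix_def)
  have min: "minors m ?A = (\<lambda>j. det (mat_delete padded m j)) ` {..m}"
  proof (intro subset_antisym subsetI)
    fix a assume "a \<in> minors m ?A"
    then obtain I J where a: "a = det (submatrix ?A I J)" and I: "I \<subseteq> {..<m}" "card I = m"
      and J: "J \<subseteq> {..<Suc m}" "card J = m"
      unfolding minors_def using A by auto
    have I': "I = {..<m}" using card_subset_eq[OF _ I(1)] I(2) by simp
    have "card ({..<Suc m} - J) = 1" using J by (simp add: card_Diff_subset finite_subset)
    then obtain j where j: "{..<Suc m} - J = {j}" by (rule card_1_singletonE)
    then have "j \<le> m" "J = {..<Suc m} - {j}" using J by auto
    then show "a \<in> (\<lambda>j. det (mat_delete padded m j)) ` {..m}" unfolding a I' using sub by auto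
  next
    fix a assume "a \<in> (\<lambda>j. det (mat_delete padded m j)) ` {..m}"
    then obtain j where j: "j \<le> m" "a = det (submatrix ?A {..<m} ({..<Suc m} - {j}))" using sub by auto
    then show "a \<in> minors m ?A" unfolding minors_def using A
      by (intro CollectI exI[of _ "{..<m}"] exI[of _ "{..<Suc m} - {j}"]) auto
  qed
  show ?thesis
  proof (rule subset_antisym; rule ideal_gen_subset[OF is_ideal_gen]; rule subsetI)
    fix a assume "a \<in> minors m ?A"
    then obtain j where j: "j \<le> m" "a = det (mat_delete padded m j)" unfolding min by auto
    then have "a = (- 1) ^ (m + j) * signed_minor (j + 1)"
      by (simp add: signed_minor_eq[OF j(1), simplified] signs_cancel)
    moreover have "signed_minor (j + 1) \<in> signed_minor ` {1..m + 1}" using j by (intro imageI) simp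
    ultimately show "a \<in> ideal_gen (signed_minor ` {1..m + 1})"
      by (simp only: ideals.span_scale ideals.span_base)
  next
    fix a assume "a \<in> signed_minor ` {1..m + 1}"
    then obtain j where "j \<in> {1..m + 1}" "a = signed_minor j" by blast
    then have j: "j - 1 \<le> m" "a = signed_minor (j - 1 + 1)" by auto
    then have "a = (- 1) ^ (m + (j - 1)) * det (mat_delete padded m (j - 1))"
      by (simp only: signed_minor_eq)
    moreover have "det (mat_delete padded m (j - 1)) \<in> minors m ?A" unfolding min using j(1) by blast
    ultimately show "a \<in> ideal_gen (minors m ?A)"
      by (simp only: ideals.span_scale ideals.span_base)
  qed
qed

text \<open>So the generators of \<open>Q\<close> occur among the entries of \<open>M\<close>;
  conversely \<open>entry_multiple\<close> shows that every entry is a multiple of such a generator,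
  so that the entries generate \<open>Q\<close>.\<close>

lemma min_exponent_attained:
  assumes k: "k \<in> {1..m + 1}"
  obtains i j where "i \<in> {1..m}" "j \<in> {1..m + 1}" "M i j = x k ^ min_exponent m \<alpha> k" "\<alpha> i j = min_exponent m \<alpha> k"
proof (cases "k < m")
  case True
  let ?S = "(\<lambda>i. \<alpha> i (k - i + 1)) ` {1..k} \<union> (\<lambda>i. \<alpha> i (k + m + 2 - i)) ` {k<..m}"
  have "Min ?S \<in> ?S" by (rule Min_in) (use k in auto)
  then have "min_exponent m \<alpha> k \<in> ?S" using True by (simp add: min_exponent_def)
  then show thesis
  proof (elim UnE imageE)
    fix i assume i: "min_exponent m \<alpha> k = \<alpha> i (k - i + 1)" "i \<in> {1..k}"
    then have s: "i + (k - i + 1) = k + 1" by auto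
    have "M i (k - i + 1) = x k ^ min_exponent m \<alpha> k"
      unfolding param_entry_def s i(1) using True by simp
    then show thesis using i True by (intro that[of i "k - i + 1"]) auto
  next
    fix i assume i: "min_exponent m \<alpha> k = \<alpha> i (k + m + 2 - i)" "i \<in> {k<..m}"
    then have s: "i + (k + m + 2 - i) = k + m + 2" by auto
    have "M i (k + m + 2 - i) = x k ^ min_exponent m \<alpha> k"
      unfolding param_entry_def s i(1) using k by simp
    then show thesis using i k by (intro that[of i "k + m + 2 - i"]) auto
  qed
next
  case False
  let ?S = "(\<lambda>i. \<alpha> i (k - i + 1)) ` {1..m}"
  have "Min ?S \<in> ?S" by (rule Min_in) (use m_ge_1 in auto)
  then have "min_exponent m \<alpha> k \<in> ?S" using False by (simp add: min_exponent_def)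
  then show thesis
  proof (elim imageE)
    fix i assume i: "min_exponent m \<alpha> k = \<alpha> i (k - i + 1)" "i \<in> {1..m}"
    then have s: "i + (k - i + 1) = k + 1" using False by auto
    have "M i (k - i + 1) = x k ^ min_exponent m \<alpha> k"
      unfolding param_entry_def s i(1) using k by simp
    then show thesis using i k by (intro that[of i "k - i + 1"]) auto
  qed
qed

lemma min_exponent_pos:
  assumes "k \<in> {1..m + 1}"
  shows "min_exponent m \<alpha> k > 0"
proof -
  obtain i j where "i \<in> {1..m}" "j \<in> {1..m + 1}" "\<alpha> i j = min_exponent m \<alpha> k"
    using min_exponent_attained[OF assms] by metis
  then show ?thesis using \<alpha>_pos[of i j] by simp
qed

lemma entry_multiple:
  assumes i: "i \<in> {1..m}" and j: "j \<in> {1..m + 1}"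
  obtains k where "k \<in> {1..m + 1}" "M i j = x k ^ \<alpha> i j" "min_exponent m \<alpha> k \<le> \<alpha> i j"
proof (cases "i + j \<le> m + 2")
  case True
  define k where "k = i + j - 1"
  have k: "k \<in> {1..m + 1}" "j = k - i + 1" "i \<le> k" using i j True by (auto simp: k_def)
  have "min_exponent m \<alpha> k \<le> \<alpha> i (k - i + 1)"
    unfolding min_exponent_def using i k by (auto intro!: Min_le)
  then have "min_exponent m \<alpha> k \<le> \<alpha> i j" using k by simp
  moreover have "M i j = x k ^ \<alpha> i j" using True by (simp add: param_entry_def k_def)
  ultimately show thesis using k by (intro that[of k])
next
  case False
  define k where "k = i + j - m - 2"
  have k: "k \<in> {1..m + 1}" "j = k + m + 2 - i" "k < i" "k < m" using i j False by (auto simp: k_def)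
  have "min_exponent m \<alpha> k \<le> \<alpha> i (k + m + 2 - i)"
    unfolding min_exponent_def using i k by (auto intro!: Min_le)
  then have "min_exponent m \<alpha> k \<le> \<alpha> i j" using k by simp
  moreover have "M i j = x k ^ \<alpha> i j" using False by (simp add: param_entry_def k_def)
  ultimately show thesis using k by (intro that[of k])
qed

lemma entry_in_ideal_gen:
  assumes "i \<in> {1..m}" "j \<in> {1..m + 1}"
  shows "M i j \<in> ideal_gen ((\<lambda>k. x k ^ min_exponent m \<alpha> k) ` {1..m + 1})" (is "_ \<in> ?Q")
proof -
  obtain k where k: "k \<in> {1..m + 1}" "M i j = x k ^ \<alpha> i j" "min_exponent m \<alpha> k \<le> \<alpha> i j"
    using entry_multiple[OF assms] .
  have "M i j = x k ^ (\<alpha> i j - min_exponent m \<alpha> k) * x k ^ min_exponent m \<alpha> k"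
    unfolding k(2) using k(3) by (simp add: power_add[symmetric])
  moreover have "x k ^ min_exponent m \<alpha> k \<in> ?Q" by (rule ideals.span_base) (use k(1) in blast)
  ultimately show ?thesis by (simp only: ideals.span_scale)
qed

lemma colon_gen:
  assumes "is_ideal J"
  shows "r \<in> colon J (ideal_gen S) \<longleftrightarrow> (\<forall>s\<in>S. s * r \<in> J)"
proof
  assume "r \<in> colon J (ideal_gen S)"
  then show "\<forall>s\<in>S. s * r \<in> J" unfolding colon_def using ideals.span_base by (auto simp: mult.commute)
next
  assume S: "\<forall>s\<in>S. s * r \<in> J"
  have "is_ideal {s. s * r \<in> J}"
    by (rule ideals.subspaceI)
      (auto simp: distrib_right mult.assoc ideals.subspace_0[OF assms]
        intro: ideals.subspace_add[OF assms] ideal_mult_left[OF assms])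
  then have "ideal_gen S \<subseteq> {s. s * r \<in> J}" by (rule ideal_gen_subset) (use S in blast)
  then show "r \<in> colon J (ideal_gen S)" unfolding colon_def by (auto simp: mult.commute)
qed

end

section \<open>Powers of ideals and saturation\<close>

lemma ideal_power_ideal: "is_ideal (ideal_power J n)"
  by (cases n) (simp_all add: ideal_mult_def is_ideal_gen ideals.subspace_UNIV)

lemma mult_in_ideal_mult: "a \<in> J \<Longrightarrow> b \<in> K \<Longrightarrow> a * b \<in> ideal_mult J K"
  unfolding ideal_mult_def by (intro ideals.span_base set_times_intro)

lemma ideal_mult_subset:
  assumes "is_ideal H" "\<And>a b. a \<in> J \<Longrightarrow> b \<in> K \<Longrightarrow> a * b \<in> H"
  shows "ideal_mult J K \<subseteq> H"
  unfolding ideal_mult_def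
  by (rule ideal_gen_subset[OF assms(1)]) (auto simp: set_times_def assms(2))

lemma ideal_power_mult:
  assumes "a \<in> ideal_power J n" "b \<in> ideal_power J k"
  shows "a * b \<in> ideal_power J (n + k)"
  using assms
proof (induction n arbitrary: a b)
  case 0
  then show ?case using ideal_mult_left[OF ideal_power_ideal] by simp
next
  case (Suc n)
  have K: "is_ideal {a. a * b \<in> ideal_power J (Suc n + k)}"
    by (rule ideals.subspaceI)
      (auto simp: distrib_right mult.assoc ideals.subspace_0[OF ideal_power_ideal]
        intro: ideals.subspace_add[OF ideal_power_ideal] ideal_mult_left[OF ideal_power_ideal]
        simp del: ideal_power.simps)
  have "ideal_mult J (ideal_power J n) \<subseteq> {a. a * b \<in> ideal_power J (Suc n + k)}"
  proof (rule ideal_mult_subset[OF K])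
    fix p q assume "p \<in> J" "q \<in> ideal_power J n"
    then have "p * (q * b) \<in> ideal_power J (Suc (n + k))"
      using Suc.IH Suc.prems(2) by (simp add: mult_in_ideal_mult)
    then show "p * q \<in> {a. a * b \<in> ideal_power J (Suc n + k)}" by (simp only: mem_Collect_eq mult.assoc add_Suc)
  qed
  then show ?case using Suc.prems(1) by auto
qed

lemma ideal_power_1: "is_ideal J \<Longrightarrow> a \<in> J \<Longrightarrow> a \<in> ideal_power J 1"
  using mult_in_ideal_mult[of a J 1 UNIV] by simp

lemma power_in_ideal_power:
  assumes "is_ideal J" "a \<in> J"
  shows "a ^ n \<in> ideal_power J n"
  by (induction n) (use assms mult_in_ideal_mult in auto)

lemma ideal_power_antimono:
  assumes "n \<le> k" shows "ideal_power J k \<subseteq> ideal_power J n"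
proof -
  have "ideal_power J (Suc i) \<subseteq> ideal_power J i" for i
    unfolding ideal_power.simps(2)
    by (rule ideal_mult_subset[OF ideal_power_ideal]) (rule ideal_mult_left[OF ideal_power_ideal])
  then show ?thesis by (rule lift_Suc_antimono_le[OF _ assms])
qed

text \<open>In a product of \<open>n + 1\<close> elements, each split as
  \<open>(a - r * y) + r * y\<close>, either no factor \<open>y\<close> occurs or one can be pulled
  out.\<close>

lemma ideal_power_insert:
  "ideal_power (ideal_gen (insert y F)) (Suc n) \<subseteq>
    {a. \<exists>b\<in>ideal_power (ideal_gen F) (Suc n). \<exists>c\<in>ideal_power (ideal_gen (insert y F)) n. a = b + y * c}"
  (is "_ \<subseteq> ?R n")
proof (induction n)
  let ?J = "ideal_gen (insert y F)" and ?J1 = "ideal_gen F"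
  have R: "is_ideal (?R n)" for n
  proof (rule ideals.subspaceI)
    have "0 = 0 + y * 0" by simp
    then show "0 \<in> ?R n" using ideals.subspace_0[OF ideal_power_ideal] by blast
  next
    fix a a' assume "a \<in> ?R n" "a' \<in> ?R n"
    then obtain b c b' c' where bc: "b \<in> ideal_power ?J1 (Suc n)" "c \<in> ideal_power ?J n" "a = b + y * c"
      "b' \<in> ideal_power ?J1 (Suc n)" "c' \<in> ideal_power ?J n" "a' = b' + y * c'" by blast
    then have "a + a' = (b + b') + y * (c + c')" by (simp add: algebra_simps)
    then show "a + a' \<in> ?R n"
      using ideals.subspace_add[OF ideal_power_ideal bc(1,4)] ideals.subspace_add[OF ideal_power_ideal bc(2,5)] by blast
  next
    fix r a assume "a \<in> ?R n"
    then obtain b c where bc: "b \<in> ideal_power ?J1 (Suc n)" "c \<in> ideal_power ?J n" "a = b + y * c" by blast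
    then have "r * a = r * b + y * (r * c)" by (simp add: algebra_simps)
    then show "r * a \<in> ?R n"
      using ideal_mult_left[OF ideal_power_ideal bc(1)] ideal_mult_left[OF ideal_power_ideal bc(2)] by blast
  qed
  {
    case 0
    have "a * c \<in> ?R 0" if a: "a \<in> ?J" for a c
    proof -
      obtain r where "a - r * y \<in> ?J1" using a unfolding mem_ideal_gen_insert by blast
      then have "c * (a - r * y) \<in> ?J1" by (rule ideals.span_scale)
      then have "c * (a - r * y) \<in> ideal_power ?J1 (Suc 0)" using ideal_power_1[OF is_ideal_gen] by simp
      moreover have "a * c = c * (a - r * y) + y * (r * c)" by (simp add: algebra_simps)
      ultimately show ?thesis by auto
    qed
    then show ?case by (simp only: ideal_power.simps) (rule ideal_mult_subset[OF R[of 0, unfolded ideal_power.simps]]; simp)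
  next
    case (Suc n)
    have "a * q \<in> ?R (Suc n)" if a: "a \<in> ?J" and q: "q \<in> ideal_power ?J (Suc n)" for a q
    proof -
      obtain r where r: "a - r * y \<in> ?J1" using a unfolding mem_ideal_gen_insert by blast
      obtain b c where bc: "b \<in> ideal_power ?J1 (Suc n)" "c \<in> ideal_power ?J n" "q = b + y * c"
        using Suc q by blast
      have "(a - r * y) * b \<in> ideal_power ?J1 (Suc (Suc n))"
        using mult_in_ideal_mult[OF r bc(1)] by simp
      moreover have "(a - r * y) * c + r * q \<in> ideal_power ?J (Suc n)"
      proof (rule ideals.subspace_add[OF ideal_power_ideal _ ideal_mult_left[OF ideal_power_ideal q]])
        have "a - r * y \<in> ?J" using r ideal_gen_subset_insert by blast
        then show "(a - r * y) * c \<in> ideal_power ?J (Suc n)"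
          using mult_in_ideal_mult[OF _ bc(2)] by simp
      qed
      moreover have "a * q = (a - r * y) * b + y * ((a - r * y) * c + r * q)"
        unfolding bc(3) by (simp add: algebra_simps)
      ultimately show ?thesis by blast
    qed
    then have "ideal_mult ?J (ideal_power ?J (Suc n)) \<subseteq> ?R (Suc n)"
      by (rule ideal_mult_subset[OF R])
    then show ?case by (simp only: ideal_power.simps(2)[of ?J "Suc n"])
  }
qed

text \<open>If the power \<open>n\<close> for the smaller generating set lies in \<open>K\<close>,
  then pulling out \<open>y\<close> repeatedly shows that elements of the power \<open>n + i\<close>
  are, modulo \<open>K\<close>, multiples of \<open>y ^ i\<close>. For \<open>i = k\<close> these
  lie in \<open>K\<close>.\<close>

lemma ideal_power_subset_radical:
  assumes "finite F" and K: "is_ideal K" and F: "F \<subseteq> radical K"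
  shows "\<exists>n. ideal_power (ideal_gen F) n \<subseteq> K"
  using assms(1,3)
proof (induction F)
  case empty
  have "ideal_power (ideal_gen {}) 1 \<subseteq> K"
    using ideal_mult_subset[OF K, of "ideal_gen {}" UNIV] ideals.subspace_0[OF K] by simp
  then show ?case by blast
next
  case (insert y F)
  let ?J = "ideal_gen (insert y F)"
  obtain n where n: "ideal_power (ideal_gen F) n \<subseteq> K" using insert by blast
  obtain k where k: "y ^ k \<in> K" using insert.prems unfolding radical_def by blast
  have "a \<in> {a. \<exists>b\<in>K. \<exists>c. a = b + y ^ i * c}" if "a \<in> ideal_power ?J (n + i)" for a i
    using that
  proof (induction i arbitrary: a)
    case 0
    have "a = 0 + y ^ 0 * a" by simp
    then show ?case using ideals.subspace_0[OF K] by blast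
  next
    case (Suc i)
    then obtain b c where bc: "b \<in> ideal_power (ideal_gen F) (Suc (n + i))" "c \<in> ideal_power ?J (n + i)" "a = b + y * c"
      using ideal_power_insert[of y F "n + i"] by (simp only: add_Suc_right) blast
    obtain b' c' where b': "b' \<in> K" "c = b' + y ^ i * c'" using Suc.IH[OF bc(2)] by blast
    have "b \<in> K" using bc(1) n ideal_power_antimono[of n "Suc (n + i)" "ideal_gen F"] by auto
    then have "b + y * b' \<in> K" using b' by (intro ideals.subspace_add[OF K] ideal_mult_left[OF K])
    moreover have "a = (b + y * b') + y ^ Suc i * c'" using bc(3) b'(2) by (simp add: algebra_simps)
    ultimately show ?case by blast
  qed
  from this[of _ k] have "ideal_power ?J (n + k) \<subseteq> K"
    using k ideals.subspace_add[OF K] ideal_mult_right[OF K] by blast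
  then show ?case by blast
qed

section \<open>Isomorphisms of quotient modules\<close>

lemma coset_eq_iff:
  assumes B: "is_ideal B"
  shows "a +o B = b +o B \<longleftrightarrow> a - b \<in> B"
proof
  assume "a +o B = b +o B"
  moreover have "a \<in> a +o B" using ideals.subspace_0[OF B] by (auto simp: elt_set_plus_def)
  ultimately show "a - b \<in> B" by (auto simp: elt_set_plus_def)
next
  have sub: "a +o B \<subseteq> b +o B" if "a - b \<in> B" for a b
  proof
    fix z assume "z \<in> a +o B"
    then obtain w where "w \<in> B" "z = a + w" by (auto simp: elt_set_plus_def)
    then show "z \<in> b +o B"
      using ideals.subspace_add[OF B that, of w] by (auto simp: elt_set_plus_def intro!: bexI[of _ "a - b + w"])
  qed
  assume "a - b \<in> B"
  moreover from this have "b - a \<in> B" using ideals.subspace_neg[OF B] by fastforce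
  ultimately show "a +o B = b +o B" using sub by blast
qed

lemma corresponding_isomorphic:
  assumes "corresponding (*) (*) A B A' B' L" and B: "is_ideal B" and B': "is_ideal B'"
  shows "quotient_modules_isomorphic A B A' B'"
proof -
  interpret corresponding "(*)" "(*)" A B A' B' L by fact
  \<comment> \<open>The coset does not depend on the chosen partner: differences of related pairs
    are related, and \<open>mem_iff\<close> compares their membership in \<open>B\<close> and
    \<open>B'\<close>.\<close>
  define \<phi> where "\<phi> X = (SOME a'. \<exists>a. (a, a') \<in> L \<and> X = a +o B) +o B'" for X
  have iff: "a +o B = b +o B \<longleftrightarrow> a' +o B' = b' +o B'" if "(a, a') \<in> L" "(b, b') \<in> L" for a a' b b'
    unfolding coset_eq_iff[OF B] coset_eq_iff[OF B'] by (rule mem_iff[OF diff[OF that]])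
  have \<phi>: "\<phi> (a +o B) = a' +o B'" if L: "(a, a') \<in> L" for a a'
  proof -
    have "\<exists>a'. \<exists>b. (b, a') \<in> L \<and> a +o B = b +o B" using L by blast
    then obtain b where "(b, SOME a'. \<exists>b. (b, a') \<in> L \<and> a +o B = b +o B) \<in> L" "a +o B = b +o B"
      by (rule someI_ex[THEN exE]) blast
    then show ?thesis unfolding \<phi>_def using iff[OF L] by blast
  qed
  have QX: "\<exists>a a'. (a, a') \<in> L \<and> X = a +o B" if "X \<in> quotient_module A B" for X
    using that left_total unfolding quotient_module_def by blast
  have "bij_betw \<phi> (quotient_module A B) (quotient_module A' B')"
    unfolding bij_betw_def
  proof
    show "inj_on \<phi> (quotient_module A B)"
    proof (rule inj_onI)
      fix X Y assume XY: "X \<in> quotient_module A B" "Y \<in> quotient_module A B" "\<phi> X = \<phi> Y"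
      obtain a a' where a: "(a, a') \<in> L" "X = a +o B" using QX[OF XY(1)] by blast
      obtain b b' where b: "(b, b') \<in> L" "Y = b +o B" using QX[OF XY(2)] by blast
      show "X = Y" using XY(3) iff[OF a(1) b(1)] \<phi>[OF a(1)] \<phi>[OF b(1)] a(2) b(2) by simp
    qed
    show "\<phi> ` quotient_module A B = quotient_module A' B'"
    proof (intro subset_antisym subsetI)
      fix Y assume "Y \<in> \<phi> ` quotient_module A B"
      then obtain a a' where "(a, a') \<in> L" "Y = \<phi> (a +o B)" using QX by blast
      then show "Y \<in> quotient_module A' B'" using \<phi> right unfolding quotient_module_def by auto
    next
      fix Y assume "Y \<in> quotient_module A' B'"
      then obtain a a' where aa: "(a, a') \<in> L" "Y = a' +o B'"
        using right_total unfolding quotient_module_def by blast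
      then have "Y = \<phi> (a +o B)" using \<phi> by simp
      then show "Y \<in> \<phi> ` quotient_module A B" using left[OF aa(1)] unfolding quotient_module_def by blast
    qed
  qed
  moreover have "\<phi> (X + Y) = \<phi> X + \<phi> Y" if XY: "X \<in> quotient_module A B" "Y \<in> quotient_module A B" for X Y
  proof -
    obtain a a' where a: "(a, a') \<in> L" "X = a +o B" using QX[OF XY(1)] by blast
    obtain b b' where b: "(b, b') \<in> L" "Y = b +o B" using QX[OF XY(2)] by blast
    show ?thesis
      unfolding a(2) b(2) coset_add[OF B] \<phi>[OF a(1)] \<phi>[OF b(1)] \<phi>[OF add[OF a(1) b(1)]] coset_add[OF B'] ..
  qed
  moreover have "\<phi> (coset_scale B r X) = coset_scale B' r (\<phi> X)" if X: "X \<in> quotient_module A B" for r X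
  proof -
    obtain a a' where a: "(a, a') \<in> L" "X = a +o B" using QX[OF X] by blast
    show ?thesis
      unfolding a(2) coset_scale_coset[OF B] \<phi>[OF a(1)] \<phi>[OF scale[OF a(1)]] coset_scale_coset[OF B'] ..
  qed
  ultimately show ?thesis unfolding quotient_modules_isomorphic_def by blast
qed

context maximal_minors
begin

text \<open>Stated for components of arbitrary polynomials, because induction over sums and products
  does not stay within forms.\<close>

lemma at_minors_hom_part_in_power:
  assumes I: "I = ideal_gen (d ` {1..m + 1})"
  shows "at_minors (hom_part n g) \<in> ideal_power I n"
proof (induction g arbitrary: n rule: pol_induct)
  case (const r)
  show ?case
    by (cases n) (simp_all add: hom_part_def grading_pconst coeff_pCons ideals.subspace_0[OF ideal_power_ideal]
      del: ideal_power.simps(2))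
next
  case (var j)
  have "d j \<in> I"
    unfolding I using d_out[of j] ideals.span_base[of "d j" "d ` {1..m + 1}"]
    by (cases "j \<in> {1..m + 1}") (simp_all add: ideals.span_zero)
  then have "d j \<in> ideal_power I 1" unfolding I by (rule ideal_power_1[OF is_ideal_gen])
  then show ?case
    by (auto simp: hom_part_def grading_pvar at_minors_pvar ideals.subspace_0[OF ideal_power_ideal]
      simp del: ideal_power.simps)
next
  case (add f g)
  then show ?case by (simp add: hom_part_add at_minors.hom_add ideals.subspace_add[OF ideal_power_ideal])
next
  case (mult f g)
  have "at_minors (hom_part i f * hom_part (n - i) g) \<in> ideal_power I n" if "i \<le> n" for i
    using ideal_power_mult[OF mult(1)[of i] mult(2)[of "n - i"]] that by (simp add: at_minors.hom_mult)
  then have "(\<Sum>i\<le>n. at_minors (hom_part i f * hom_part (n - i) g)) \<in> ideal_power I n"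
    by (intro ideals.subspace_sum[OF ideal_power_ideal]) simp
  moreover have "hom_part n (f * g) = (\<Sum>i\<le>n. hom_part i f * hom_part (n - i) g)"
    by (simp add: hom_part_def grading.hom_mult coeff_mult)
  ultimately show ?case by (simp only: at_minors.hom_sum)
qed

lemma power_in_forms:
  assumes I: "I = ideal_gen (d ` {1..m + 1})" and a: "a \<in> ideal_power I n"
  shows "\<exists>g. form n g \<and> a = at_minors g"
  using a
proof (induction n arbitrary: a)
  case 0
  show ?case using form_pconst at_minors_pconst by metis
next
  case (Suc n)
  let ?F = "\<lambda>n. {a. \<exists>g. form n g \<and> a = at_minors g}"
  have F: "is_ideal (?F n)" for n
  proof (rule ideals.subspaceI)
    show "0 \<in> ?F n" using form_zero[of n] by (auto intro!: exI[of _ 0])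
    show "a + b \<in> ?F n" if ab: "a \<in> ?F n" "b \<in> ?F n" for a b
    proof -
      obtain f g where "form n f" "a = at_minors f" "form n g" "b = at_minors g" using ab by blast
      then show ?thesis by (auto intro!: exI[of _ "f + g"] simp: form_add at_minors.hom_add)
    qed
    show "r * a \<in> ?F n" if a: "a \<in> ?F n" for r a
    proof -
      obtain f where "form n f" "a = at_minors f" using a by blast
      then show ?thesis
        by (auto intro!: exI[of _ "pconst r * f"] simp: form_pconst_mult at_minors.hom_mult at_minors_pconst)
    qed
  qed
  have "I \<subseteq> ?F 1"
    unfolding I
  proof (rule ideal_gen_subset[OF F])
    show "d ` {1..m + 1} \<subseteq> ?F 1" using form_pvar at_minors_pvar by (auto intro!: exI[of _ "pvar _"])
  qed
  then have "ideal_mult I (ideal_power I n) \<subseteq> ?F (Suc n)"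
  proof (intro ideal_mult_subset[OF F])
    fix a b assume sub: "I \<subseteq> ?F 1" and ab: "a \<in> I" "b \<in> ideal_power I n"
    obtain f g where "form 1 f" "a = at_minors f" "form n g" "b = at_minors g"
      using sub ab(1) Suc.IH[OF ab(2)] by blast
    then show "a * b \<in> ?F (Suc n)"
      using form_mult[of 1 f n g] by (auto intro!: exI[of _ "f * g"] simp: at_minors.hom_mult)
  qed
  then show ?case using Suc.prems by auto
qed

lemma power_forms_eq:
  assumes I: "I = ideal_gen (d ` {1..m + 1})"
  shows "power_forms = ideal_power I m"
proof (intro subset_antisym subsetI)
  fix a assume "a \<in> power_forms"
  then obtain g where "form m g" "a = at_minors g" unfolding power_forms_def by blast
  then show "a \<in> ideal_power I m" using at_minors_hom_part_in_power[OF I, of m g] hom_part_form by metis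
next
  fix a assume "a \<in> ideal_power I m"
  then show "a \<in> power_forms" using power_in_forms[OF I] unfolding power_forms_def by blast
qed

end

context parameters
begin

text \<open>The exponents are free because two choices are needed: equal large ones to bound the
  saturation, and the minimal ones to compute the quotient.\<close>

lemma colon_correspondence_powers:
  assumes e: "\<And>k. k \<in> {1..m + 1} \<Longrightarrow> e k > 0" and I: "I = ideal_gen (minors m (param_matrix m x \<alpha>))"
  shows "\<exists>L. corresponding (*) (*) {a. \<forall>k\<in>{1..m + 1}. x k ^ e k * a \<in> ideal_power I m} (ideal_power I m)
    {r. \<forall>i\<in>{1..m}. \<forall>j\<in>{1..m + 1}. r * M i j \<in> ideal_gen ((\<lambda>k. x k ^ e k) ` {1..m + 1})}
    (ideal_gen ((\<lambda>k. x k ^ e k) ` {1..m + 1})) L"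
proof -
  interpret maximal_minors m "\<lambda>k. x k ^ e k" M signed_minor
    "\<lambda>c. if c = 1 then (- 1) ^ (m + m) else (- 1) ^ (m + 0)"
    by (rule maximal_minors_powers[OF e])
  show ?thesis
    using colon_correspondence
    unfolding param_colon_def entry_colon_def power_forms_eq[OF I[unfolded ideal_gen_minors]] .
qed

end

theorem theorem4p2:
  fixes m :: nat
    and \<mm> :: "'a::comm_ring_1 set"
    and x :: "nat \<Rightarrow> 'a"
    and \<alpha> :: "nat \<Rightarrow> nat \<Rightarrow> nat"
    and I Q :: "'a set"
  assumes "m \<ge> 2"
    and "cohen_macaulay_local \<mm>"
    and "krull_dim TYPE('a) = enat (m + 1)"
    and "system_of_parameters \<mm> (map x [1..<m + 2])"
    and "\<And>i j. i \<in> {1..m} \<Longrightarrow> j \<in> {1..m + 1} \<Longrightarrow> \<alpha> i j > 0"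
    and "I = ideal_gen (minors m (param_matrix m x \<alpha>))"
    and "Q = ideal_gen ((\<lambda>k. x k ^ min_exponent m \<alpha> k) ` {1..m + 1})"
  shows "saturation \<mm> (ideal_power I m) = colon (ideal_power I m) Q \<and>
    quotient_modules_isomorphic (saturation \<mm> (ideal_power I m)) (ideal_power I m) UNIV Q"
proof -
  interpret parameters m \<mm> x \<alpha>
    by unfold_locales (use assms in auto)
  let ?J = "ideal_power I m"
  note J = ideal_power_ideal[of I m]
  have Q: "is_ideal Q" unfolding assms(7) by (rule is_ideal_gen)
  have sat: "saturation \<mm> ?J = colon ?J Q"
  proof (intro subset_antisym subsetI)
    fix a assume "a \<in> saturation \<mm> ?J"
    then obtain n where n: "n > 0" "a \<in> colon ?J (ideal_power \<mm> n)" unfolding saturation_def by auto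
    \<comment> \<open>All exponents are set to \<open>n\<close>, because \<open>x k ^ n\<close> lies
      in the \<open>n\<close>-th power of \<open>\<mm>\<close> and so multiplies \<open>a\<close>
      into \<open>?J\<close>.\<close>
    let ?A = "{a. \<forall>k\<in>{1..m + 1}. x k ^ n * a \<in> ?J}" and ?X = "ideal_gen ((\<lambda>k. x k ^ n) ` {1..m + 1})"
    let ?C = "{r. \<forall>i\<in>{1..m}. \<forall>j\<in>{1..m + 1}. r * M i j \<in> ?X}"
    obtain L where "corresponding (*) (*) ?A ?J ?C ?X L"
      using colon_correspondence_powers[OF n(1) assms(6)] by blast
    then interpret corresponding "(*)" "(*)" ?A ?J ?C ?X L .
    have "a * x k ^ n \<in> ?J" if "k \<in> {1..m + 1}" for k
      using n(2) power_in_ideal_power[OF ideal_\<mm> parameters_mem[OF that]] unfolding colon_def by blast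
    then have "a \<in> ?A" by (simp add: mult.commute)
    then obtain c where c: "(a, c) \<in> L" using left_total by blast
    have "x k ^ min_exponent m \<alpha> k * a \<in> ?J" if k: "k \<in> {1..m + 1}" for k
    proof -
      obtain i j where ij: "i \<in> {1..m}" "j \<in> {1..m + 1}" "M i j = x k ^ min_exponent m \<alpha> k"
        using min_exponent_attained[OF k] .
      have "c * M i j \<in> ?X" using right[OF c] ij by blast
      then have "M i j * c \<in> ?X" by (simp add: mult.commute)
      \<comment> \<open>The entry \<open>M i j\<close> is the generator of \<open>Q\<close> in
        question; \<open>scale\<close> relates \<open>M i j * a\<close> to \<open>M i j * c\<close>,
        and the latter lies in \<open>?X\<close>, so the former lies in \<open>?J\<close>.\<close>
      then show ?thesis unfolding ij(3)[symmetric] using mem_iff[OF scale[OF c]] by blast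
    qed
    then show "a \<in> colon ?J Q" unfolding assms(7) colon_gen[OF J] by blast
  next
    fix a assume a: "a \<in> colon ?J Q"
    obtain F where F: "finite F" "\<mm> = ideal_gen F"
      using CM ideal_\<mm> unfolding cohen_macaulay_local_def noetherian_def by blast
    have "\<mm> \<subseteq> radical Q"
    proof (rule sop_criterion[OF Q])
      fix k assume "k \<in> {1..m + 1}"
      then have "x k ^ min_exponent m \<alpha> k \<in> Q" unfolding assms(7) by (intro ideals.span_base) blast
      then show "x k \<in> radical Q" unfolding radical_def by blast
    qed
    then have "F \<subseteq> radical Q" using ideals.span_superset[of F] F(2) by blast
    from ideal_power_subset_radical[OF F(1) Q this] obtain n where "ideal_power \<mm> n \<subseteq> Q"
      unfolding F(2) by blast
    \<comment> \<open>The saturation is a union over positive exponents, while \<open>n\<close> may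
      be \<open>0\<close>.\<close>
    then have "ideal_power \<mm> (Suc n) \<subseteq> Q" using ideal_power_antimono[of n "Suc n" \<mm>] by auto
    then have "a \<in> colon ?J (ideal_power \<mm> (Suc n))" using a unfolding colon_def by blast
    then show "a \<in> saturation \<mm> ?J" unfolding saturation_def by blast
  qed
  obtain L where L: "corresponding (*) (*) {a. \<forall>k\<in>{1..m + 1}. x k ^ min_exponent m \<alpha> k * a \<in> ?J} ?J
      {r. \<forall>i\<in>{1..m}. \<forall>j\<in>{1..m + 1}. r * M i j \<in> Q} Q L"
    using colon_correspondence_powers[of "min_exponent m \<alpha>", OF min_exponent_pos assms(6)]
    unfolding assms(7) by blast
  have "{a. \<forall>k\<in>{1..m + 1}. x k ^ min_exponent m \<alpha> k * a \<in> ?J} = colon ?J Q"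
    unfolding assms(7) by (auto simp: colon_gen[OF J])
  \<comment> \<open>With the minimal exponents every entry lies in \<open>Q\<close>, so the colon
    condition is void and the right-hand quotient is all of \<open>R/Q\<close>.\<close>
  moreover have "{r. \<forall>i\<in>{1..m}. \<forall>j\<in>{1..m + 1}. r * M i j \<in> Q} = UNIV"
    using ideal_mult_left[OF Q] entry_in_ideal_gen unfolding assms(7) by blast
  ultimately have "quotient_modules_isomorphic (colon ?J Q) ?J UNIV Q"
    using corresponding_isomorphic[OF L J Q] by simp
  then show ?thesis unfolding sat by simp
qed

end
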